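(* Let $k\ge0$ be fixed. Then $\mathsf{RCA}_0$ proves the following statement: for every dynamical hierarchy $\mathcal B=(B_i)_{i\in\mathbb N}$ such that $S_{B_0}(b)\le\min(3b,\,b\cdot\min B_0)$ for every $b\in B_0$ and $S_{B_0}(b)=3b$ for $k$ many $b\in B_0$, for every $n\in\mathbb N$ there is $i$ such that $\mathbb G^{\mathcal B}_i(n)=0$.
   Context: Let $\mathbb N=\{0,1,2,\dots\}$; $\infty$ is regarded as greater than, and divisible by, every positive integer. For $b\ge 2$ and $n>0$, the $b$-decomposition of $n$ is the unique $n=b^e a+r$ with $b^e\le n<b^{e+1}$, $0<a<b$, $r<b^e$. For nonempty $B\subseteq\mathbb N\setminus\{0,1\}$: $\mathrm{base}_B(n)=\max\{b\in B: b\le n\}$ if $n\ge\min B$, else $\min B$; $S_B(n)=\min\{b\in B:b>n\}$ if this exists, else $\infty$. A base hierarchy is a nonempty $B\subseteq\mathbb N\setminus\{0,1\}$ with $b\mid S_B(b)$ for all $b\in B$. Upgrade: for base hierarchies $B,C$ with $\min B\le\min C$, define ${\uparrow}n={\uparrow}_B^C n\in\mathbb N\cup\{\infty\}$ recursively. If $n<\min B$, ${\uparrow}n=n$. Otherwise $b=\mathrm{base}_B(n)$; for $c\in C$ define $\langle b\to c\rangle m={\uparrow}m$ if $m<b$, and $\langle b\to c\rangle m=c^{\langle b\to c\rangle e}\cdot{\uparrow}a+\langle b\to c\rangle r$ if $m\ge b$ has $b$-decomposition $m=b^ea+r$. Then ${\uparrow}n=\langle b\to c\rangle n$ where $c$ is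 the least element of $C$ with ${\uparrow}(n-1)<\langle b\to c\rangle n<S_C(c)$; ${\uparrow}n=\infty$ if none exists. $C$ is a good successor of $B$ if (1) $\min B\le\min C$; (2) ${\uparrow}_B^C n<\infty$ for all $n$; (3) for every $b\in B$ with $b>\min B$, writing $x={\uparrow}_B^C(b-1)$, no multiple of $\mathrm{base}_C(x)$ lies strictly between $x$ and $S_C(x)$. A dynamical hierarchy is a sequence $(B_i)_{i\in\mathbb N}$ of base hierarchies with each $B_{i+1}$ a good successor of $B_i$. Goodstein sequence: $\mathbb G^{\mathcal B}_0(n)=n$, $\mathbb G^{\mathcal B}_{i+1}(n)={\uparrow}_{B_i}^{B_{i+1}}\mathbb G^{\mathcal B}_i(n)-1$ if $\mathbb G^{\mathcal B}_i(n)>0$, else $0$. These notions are formalized in second-order arithmetic in the natural way. *)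

theory Defs
  imports Main
begin

section \<open>The language of second-order arithmetic\<close>

text \<open>
  Both sorts of variables are de Bruijn indices, counted separately: the argument of
  \<open>Var\<close> and the second argument of \<open>Mem\<close>. The remaining connectives are classical
  abbreviations, and equality of sets is not primitive.
\<close>

datatype tm = Var nat | Zero | One | Add tm tm | Mul tm tm

datatype fm =
    Fls
  | Eq tm tm
  | Less tm tm
  | Mem tm nat
  | Imp fm fm
  | AllN fm
  | AllS fm

abbreviation Neg :: "fm \<Rightarrow> fm" where "Neg p \<equiv> Imp p Fls"
abbreviation And :: "fm \<Rightarrow> fm \<Rightarrow> fm" where "And p q \<equiv> Neg (Imp p (Neg q))"
abbreviation Or :: "fm \<Rightarrow> fm \<Rightarrow> fm" where "Or p q \<equiv> Imp (Neg p) q"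
abbreviation Iff :: "fm \<Rightarrow> fm \<Rightarrow> fm" where "Iff p q \<equiv> And (Imp p q) (Imp q p)"
abbreviation ExN :: "fm \<Rightarrow> fm" where "ExN p \<equiv> Neg (AllN (Neg p))"
abbreviation ExS :: "fm \<Rightarrow> fm" where "ExS p \<equiv> Neg (AllS (Neg p))"

primrec subst_tm :: "(nat \<Rightarrow> tm) \<Rightarrow> tm \<Rightarrow> tm" where
  "subst_tm \<sigma> (Var n) = \<sigma> n"
| "subst_tm \<sigma> Zero = Zero"
| "subst_tm \<sigma> One = One"
| "subst_tm \<sigma> (Add s t) = Add (subst_tm \<sigma> s) (subst_tm \<sigma> t)"
| "subst_tm \<sigma> (Mul s t) = Mul (subst_tm \<sigma> s) (subst_tm \<sigma> t)"

abbreviation lift_tm :: "tm \<Rightarrow> tm" where "lift_tm \<equiv> subst_tm (\<lambda>n. Var (Suc n))"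

text \<open>Simultaneous substitution of terms for number variables and of set variables for set variables.\<close>

primrec subst :: "(nat \<Rightarrow> tm) \<Rightarrow> (nat \<Rightarrow> nat) \<Rightarrow> fm \<Rightarrow> fm" where
  "subst \<sigma> \<rho> Fls = Fls"
| "subst \<sigma> \<rho> (Eq s t) = Eq (subst_tm \<sigma> s) (subst_tm \<sigma> t)"
| "subst \<sigma> \<rho> (Less s t) = Less (subst_tm \<sigma> s) (subst_tm \<sigma> t)"
| "subst \<sigma> \<rho> (Mem t X) = Mem (subst_tm \<sigma> t) (\<rho> X)"
| "subst \<sigma> \<rho> (Imp p q) = Imp (subst \<sigma> \<rho> p) (subst \<sigma> \<rho> q)"
| "subst \<sigma> \<rho> (AllN p) = AllN (subst (case_nat (Var 0) (\<lambda>n. lift_tm (\<sigma> n))) \<rho> p)"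
| "subst \<sigma> \<rho> (AllS p) = AllS (subst \<sigma> (case_nat 0 (\<lambda>n. Suc (\<rho> n))) p)"

definition instN :: "tm \<Rightarrow> fm \<Rightarrow> fm" where
  "instN t = subst (case_nat t Var) id"

definition instS :: "nat \<Rightarrow> fm \<Rightarrow> fm" where
  "instS X = subst Var (case_nat X id)"

definition liftN :: "fm \<Rightarrow> fm" where
  "liftN = subst (\<lambda>n. Var (Suc n)) id"

definition liftS :: "fm \<Rightarrow> fm" where
  "liftS = subst Var Suc"


section \<open>Provability\<close>

text \<open>
  Two-sorted classical natural deduction with equality. Formulas of the theory \<open>T\<close> may be
  open; they are axioms in every context, hence are read as universally closed. The
  hypotheses \<open>\<Gamma>\<close>, in contrast, are lifted in the eigenvariable rules.
\<close>

inductive derives :: "fm set \<Rightarrow> fm set \<Rightarrow> fm \<Rightarrow> bool" for T :: "fm set" where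
  Axiom: "p \<in> T \<Longrightarrow> derives T \<Gamma> p"
| Hyp: "p \<in> \<Gamma> \<Longrightarrow> derives T \<Gamma> p"
| ImpI: "derives T (insert p \<Gamma>) q \<Longrightarrow> derives T \<Gamma> (Imp p q)"
| ImpE: "derives T \<Gamma> (Imp p q) \<Longrightarrow> derives T \<Gamma> p \<Longrightarrow> derives T \<Gamma> q"
| Contr: "derives T (insert (Neg p) \<Gamma>) Fls \<Longrightarrow> derives T \<Gamma> p"
| AllNI: "derives T (liftN ` \<Gamma>) p \<Longrightarrow> derives T \<Gamma> (AllN p)"
| AllNE: "derives T \<Gamma> (AllN p) \<Longrightarrow> derives T \<Gamma> (instN t p)"
| AllSI: "derives T (liftS ` \<Gamma>) p \<Longrightarrow> derives T \<Gamma> (AllS p)"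
| AllSE: "derives T \<Gamma> (AllS p) \<Longrightarrow> derives T \<Gamma> (instS X p)"
| EqI: "derives T \<Gamma> (Eq t t)"
| EqE: "derives T \<Gamma> (Eq s t) \<Longrightarrow> derives T \<Gamma> (instN s p) \<Longrightarrow> derives T \<Gamma> (instN t p)"

definition proves :: "fm set \<Rightarrow> fm \<Rightarrow> bool" (infix "\<turnstile>" 50) where
  "T \<turnstile> p \<longleftrightarrow> derives T {} p"


section \<open>The theory \<open>RCA\<^sub>0\<close>\<close>

text \<open>In the bounded quantifiers, the bound \<open>t\<close> does not depend on the quantified variable.\<close>

inductive bounded :: "fm \<Rightarrow> bool" where
  "bounded Fls"
| "bounded (Eq s t)"
| "bounded (Less s t)"
| "bounded (Mem t X)"
| "bounded p \<Longrightarrow> bounded q \<Longrightarrow> bounded (Imp p q)"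
| "bounded p \<Longrightarrow> bounded (AllN (Imp (Less (Var 0) (lift_tm t)) p))"
| "bounded p \<Longrightarrow> bounded (ExN (And (Less (Var 0) (lift_tm t)) p))"

definition Sigma01 :: "fm set" where "Sigma01 = {ExN p |p. bounded p}"
definition Pi01 :: "fm set" where "Pi01 = {AllN p |p. bounded p}"

definition basic_axioms :: "fm set" where
  "basic_axioms = (let m = Var 0; n = Var 1 in
    {Neg (Eq (Add n One) Zero),
     Imp (Eq (Add m One) (Add n One)) (Eq m n),
     Eq (Add m Zero) m,
     Eq (Add m (Add n One)) (Add (Add m n) One),
     Eq (Mul m Zero) Zero,
     Eq (Mul m (Add n One)) (Add (Mul m n) m),
     Neg (Less m Zero),
     Iff (Less m (Add n One)) (Or (Less m n) (Eq m n))})"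

definition induction :: "fm \<Rightarrow> fm" where
  "induction p =
    Imp (And (instN Zero p)
             (AllN (Imp p (subst (case_nat (Add (Var 0) One) (\<lambda>n. Var (Suc n))) id p))))
        (AllN p)"

definition comprehension :: "fm \<Rightarrow> fm \<Rightarrow> fm" where
  "comprehension p q =
    Imp (AllN (Iff p q)) (ExS (AllN (Iff (Mem (Var 0) 0) (liftS p))))"

definition RCA0 :: "fm set" where
  "RCA0 = basic_axioms \<union> {induction p |p. p \<in> Sigma01}
     \<union> {comprehension p q |p q. p \<in> Sigma01 \<and> q \<in> Pi01}"


section \<open>Notation for writing formulas\<close>

text \<open>
  To write large formulas legibly, we represent terms, set variables and formulas as
  functions of the current binding depth (for formulas: of the numbers of number and set
  quantifiers in whose scope they stand). A variable bound at depth \<open>d\<close> becomes the de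
  Bruijn index \<open>d' - Suc d\<close> when it is used at depth \<open>d'\<close>, so object-level quantifiers can be
  written as HOL binders. At depth zero the result is an ordinary formula, returned by
  \<open>sentence\<close>.
\<close>

type_synonym trm = "nat \<Rightarrow> tm"
type_synonym svar = "nat \<Rightarrow> nat"
type_synonym form = "nat \<Rightarrow> nat \<Rightarrow> fm"

definition sentence :: "form \<Rightarrow> fm" where "sentence \<phi> = \<phi> 0 0"

definition zero_t :: trm ("\<^bold>0") where "\<^bold>0 = (\<lambda>d. Zero)"
definition one_t :: trm ("\<^bold>1") where "\<^bold>1 = (\<lambda>d. One)"
definition plus_t :: "trm \<Rightarrow> trm \<Rightarrow> trm" (infixl "\<^bold>+" 65) where
  "s \<^bold>+ t = (\<lambda>d. Add (s d) (t d))"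
definition times_t :: "trm \<Rightarrow> trm \<Rightarrow> trm" (infixl "\<^bold>*" 70) where
  "s \<^bold>* t = (\<lambda>d. Mul (s d) (t d))"
abbreviation three_t :: trm ("\<^bold>3") where "\<^bold>3 \<equiv> \<^bold>1 \<^bold>+ \<^bold>1 \<^bold>+ \<^bold>1"

definition eq_f :: "trm \<Rightarrow> trm \<Rightarrow> form" (infix "\<^bold>=" 50) where
  "(s \<^bold>= t) = (\<lambda>d e. Eq (s d) (t d))"
definition less_f :: "trm \<Rightarrow> trm \<Rightarrow> form" (infix "\<^bold><" 50) where
  "(s \<^bold>< t) = (\<lambda>d e. Less (s d) (t d))"
definition mem_f :: "trm \<Rightarrow> svar \<Rightarrow> form" (infix "\<^bold>\<in>" 50) where
  "(t \<^bold>\<in> X) = (\<lambda>d e. Mem (t d) (X e))"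

definition not_f :: "form \<Rightarrow> form" ("\<^bold>\<not> _" [40] 40) where
  "(\<^bold>\<not> \<phi>) = (\<lambda>d e. Neg (\<phi> d e))"
definition and_f :: "form \<Rightarrow> form \<Rightarrow> form" (infixr "\<^bold>\<and>" 35) where
  "(\<phi> \<^bold>\<and> \<psi>) = (\<lambda>d e. And (\<phi> d e) (\<psi> d e))"
definition or_f :: "form \<Rightarrow> form \<Rightarrow> form" (infixr "\<^bold>\<or>" 30) where
  "(\<phi> \<^bold>\<or> \<psi>) = (\<lambda>d e. Or (\<phi> d e) (\<psi> d e))"
definition imp_f :: "form \<Rightarrow> form \<Rightarrow> form" (infixr "\<^bold>\<longrightarrow>" 25) where
  "(\<phi> \<^bold>\<longrightarrow> \<psi>) = (\<lambda>d e. Imp (\<phi> d e) (\<psi> d e))"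

definition all_n :: "(trm \<Rightarrow> form) \<Rightarrow> form" (binder "\<^bold>\<forall>" 10) where
  "all_n \<Phi> = (\<lambda>d e. AllN (\<Phi> (\<lambda>d'. Var (d' - Suc d)) (Suc d) e))"
definition ex_n :: "(trm \<Rightarrow> form) \<Rightarrow> form" (binder "\<^bold>\<exists>" 10) where
  "ex_n \<Phi> = (\<lambda>d e. ExN (\<Phi> (\<lambda>d'. Var (d' - Suc d)) (Suc d) e))"
definition all_s :: "(svar \<Rightarrow> form) \<Rightarrow> form" (binder "\<^bold>\<forall>\<^sub>S" 10) where
  "all_s \<Phi> = (\<lambda>d e. AllS (\<Phi> (\<lambda>e'. e' - Suc e) d (Suc e)))"
definition ex_s :: "(svar \<Rightarrow> form) \<Rightarrow> form" (binder "\<^bold>\<exists>\<^sub>S" 10) where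
  "ex_s \<Phi> = (\<lambda>d e. ExS (\<Phi> (\<lambda>e'. e' - Suc e) d (Suc e)))"

definition leq_f :: "trm \<Rightarrow> trm \<Rightarrow> form" (infix "\<^bold>\<le>" 50) where
  "(s \<^bold>\<le> t) = (s \<^bold>< t \<^bold>\<or> s \<^bold>= t)"
definition dvd_f :: "trm \<Rightarrow> trm \<Rightarrow> form" (infix "\<^bold>dvd" 50) where
  "(s \<^bold>dvd t) = (\<^bold>\<exists>z. t \<^bold>= s \<^bold>* z)"

text \<open>There are exactly \<open>k\<close> numbers \<open>x\<close> with \<open>\<Phi> x\<close>, for a metatheoretic \<open>k\<close>.\<close>

primrec exactly :: "nat \<Rightarrow> (trm \<Rightarrow> form) \<Rightarrow> form" where
  "exactly 0 \<Phi> = (\<^bold>\<forall>x. \<^bold>\<not> \<Phi> x)"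
| "exactly (Suc k) \<Phi> = (\<^bold>\<exists>x. \<Phi> x \<^bold>\<and> exactly k (\<lambda>y. \<Phi> y \<^bold>\<and> \<^bold>\<not> y \<^bold>= x))"

text \<open>
  The usual pairing function of second-order arithmetic. Functions are coded as sets of pairs,
  and sequences of sets as sets: the \<open>i\<close>-th entry of \<open>X\<close> is \<open>{x. \<langle>i, x\<rangle> \<in> X}\<close>. Such entries are
  represented as predicates.
\<close>

definition pair :: "trm \<Rightarrow> trm \<Rightarrow> trm" where
  "pair s t = (s \<^bold>+ t) \<^bold>* (s \<^bold>+ t) \<^bold>+ s"

type_synonym pred = "trm \<Rightarrow> form"

definition entry :: "svar \<Rightarrow> trm \<Rightarrow> pred" where
  "entry X i = (\<lambda>x. pair i x \<^bold>\<in> X)"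

definition maps :: "svar \<Rightarrow> trm \<Rightarrow> trm \<Rightarrow> form" where
  "maps F x y = (pair x y \<^bold>\<in> F)"

definition is_function :: "svar \<Rightarrow> form" where
  "is_function F =
    ((\<^bold>\<forall>z. z \<^bold>\<in> F \<^bold>\<longrightarrow> (\<^bold>\<exists>x. \<^bold>\<exists>y. z \<^bold>= pair x y)) \<^bold>\<and>
     (\<^bold>\<forall>x. \<^bold>\<exists>y. maps F x y \<^bold>\<and> (\<^bold>\<forall>z. maps F x z \<^bold>\<longrightarrow> z \<^bold>= y)))"

text \<open>\<open>is_power b e p\<close>: \<open>p = b\<^sup>e\<close>, by primitive recursion.\<close>

definition is_power :: "trm \<Rightarrow> trm \<Rightarrow> trm \<Rightarrow> form" where
  "is_power b e p =
    (\<^bold>\<exists>\<^sub>S F. is_function F \<^bold>\<and> maps F \<^bold>0 \<^bold>1 \<^bold>\<and>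
       (\<^bold>\<forall>i. \<^bold>\<forall>y. maps F i y \<^bold>\<longrightarrow> maps F (i \<^bold>+ \<^bold>1) (y \<^bold>* b)) \<^bold>\<and> maps F e p)"


section \<open>Base hierarchies\<close>

definition is_min :: "pred \<Rightarrow> trm \<Rightarrow> form" where
  "is_min B m = (B m \<^bold>\<and> (\<^bold>\<forall>x. B x \<^bold>\<longrightarrow> m \<^bold>\<le> x))"

text \<open>\<open>b = base\<^sub>B(n)\<close>\<close>

definition is_base :: "pred \<Rightarrow> trm \<Rightarrow> trm \<Rightarrow> form" where
  "is_base B n b =
    (\<^bold>\<exists>m. is_min B m \<^bold>\<and>
       ((m \<^bold>\<le> n \<^bold>\<and> B b \<^bold>\<and> b \<^bold>\<le> n \<^bold>\<and> (\<^bold>\<forall>x. B x \<^bold>\<and> x \<^bold>\<le> n \<^bold>\<longrightarrow> x \<^bold>\<le> b)) \<^bold>\<or>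
        (n \<^bold>< m \<^bold>\<and> b \<^bold>= m)))"

text \<open>
  \<open>is_S B n s\<close>: \<open>S\<^sub>B(n) = s\<close> for a number \<open>s\<close>; no such \<open>s\<close> exists iff \<open>S\<^sub>B(n) = \<infinity>\<close>.
  Accordingly, \<open>less_S B v n\<close>, i.e. \<open>v < S\<^sub>B(n)\<close>, and the divisibility of \<open>S\<^sub>B(b)\<close> by \<open>b\<close> are
  vacuously true in the latter case.
\<close>

definition is_S :: "pred \<Rightarrow> trm \<Rightarrow> trm \<Rightarrow> form" where
  "is_S B n s = (B s \<^bold>\<and> n \<^bold>< s \<^bold>\<and> (\<^bold>\<forall>x. B x \<^bold>\<and> n \<^bold>< x \<^bold>\<longrightarrow> s \<^bold>\<le> x))"

definition less_S :: "pred \<Rightarrow> trm \<Rightarrow> trm \<Rightarrow> form" where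
  "less_S B v n = (\<^bold>\<forall>s. is_S B n s \<^bold>\<longrightarrow> v \<^bold>< s)"

definition base_hierarchy :: "pred \<Rightarrow> form" where
  "base_hierarchy B =
    ((\<^bold>\<exists>x. B x) \<^bold>\<and>
     (\<^bold>\<forall>b. B b \<^bold>\<longrightarrow> \<^bold>1 \<^bold>< b \<^bold>\<and> (\<^bold>\<forall>s. is_S B b s \<^bold>\<longrightarrow> b \<^bold>dvd s)))"

text \<open>\<open>n = b\<^sup>e * a + r\<close> is the \<open>b\<close>-decomposition of \<open>n\<close>.\<close>

definition decomposition :: "trm \<Rightarrow> trm \<Rightarrow> trm \<Rightarrow> trm \<Rightarrow> trm \<Rightarrow> form" where
  "decomposition b n e a r =
    (\<^bold>\<exists>p. \<^bold>\<exists>q. is_power b e p \<^bold>\<and> is_power b (e \<^bold>+ \<^bold>1) q \<^bold>\<and>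
       p \<^bold>\<le> n \<^bold>\<and> n \<^bold>< q \<^bold>\<and> \<^bold>0 \<^bold>< a \<^bold>\<and> a \<^bold>< b \<^bold>\<and> r \<^bold>< p \<^bold>\<and>
       n \<^bold>= p \<^bold>* a \<^bold>+ r)"


section \<open>The upgrade operation\<close>

text \<open>
  \<open>is_subst U b c m v\<close>: \<open>\<langle>b \<rightarrow> c\<rangle>m = v\<close>, where the function \<open>U\<close> provides the values \<open>\<up>j\<close> for
  \<open>j < b\<close>, which are the only ones used. The function \<open>V\<close> is \<open>m \<mapsto> \<langle>b \<rightarrow> c\<rangle>m\<close>.
\<close>

definition is_subst :: "svar \<Rightarrow> trm \<Rightarrow> trm \<Rightarrow> trm \<Rightarrow> trm \<Rightarrow> form" where
  "is_subst U b c m v =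
    (\<^bold>\<exists>\<^sub>S V. is_function V \<^bold>\<and>
       (\<^bold>\<forall>x. (x \<^bold>< b \<^bold>\<longrightarrow> (\<^bold>\<exists>y. maps U x y \<^bold>\<and> maps V x y)) \<^bold>\<and>
            (b \<^bold>\<le> x \<^bold>\<longrightarrow>
              (\<^bold>\<exists>e. \<^bold>\<exists>a. \<^bold>\<exists>r. decomposition b x e a r \<^bold>\<and>
                (\<^bold>\<exists>e'. \<^bold>\<exists>a'. \<^bold>\<exists>r'. \<^bold>\<exists>p.
                   maps V e e' \<^bold>\<and> maps U a a' \<^bold>\<and> maps V r r' \<^bold>\<and>
                   is_power c e' p \<^bold>\<and> maps V x (p \<^bold>* a' \<^bold>+ r'))))) \<^bold>\<and>
       maps V m v)"

text \<open>
  \<open>c \<in> C\<close> satisfies \<open>\<up>(n - 1) < \<langle>b \<rightarrow> c\<rangle>n < S\<^sub>C(c)\<close>.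
\<close>

definition admissible :: "pred \<Rightarrow> svar \<Rightarrow> trm \<Rightarrow> trm \<Rightarrow> trm \<Rightarrow> form" where
  "admissible C U n b c =
    (C c \<^bold>\<and> (\<^bold>\<exists>i. \<^bold>\<exists>u. \<^bold>\<exists>v. n \<^bold>= i \<^bold>+ \<^bold>1 \<^bold>\<and> maps U i u \<^bold>\<and> is_subst U b c n v \<^bold>\<and>
       u \<^bold>< v \<^bold>\<and> less_S C v c))"

text \<open>
  \<open>is_upgrade B C n v\<close>: \<open>\<up>n = v\<close> for a number \<open>v\<close>; no such \<open>v\<close> exists iff \<open>\<up>n = \<infinity>\<close>. Note that
  \<open>\<up>n = \<infinity>\<close> entails \<open>\<up>j = \<infinity>\<close> for all \<open>j \<ge> n\<close>, so that \<open>\<up>n < \<infinity>\<close> holds iff the recursion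
  yields numbers up to \<open>n\<close>. These are the values \<open>U(j)\<close> for \<open>j \<le> n\<close>; the later values of
  the function \<open>U\<close> are arbitrary.
\<close>

definition is_upgrade :: "pred \<Rightarrow> pred \<Rightarrow> trm \<Rightarrow> trm \<Rightarrow> form" where
  "is_upgrade B C n v =
    (\<^bold>\<exists>\<^sub>S U. is_function U \<^bold>\<and>
       (\<^bold>\<exists>m. is_min B m \<^bold>\<and>
         (\<^bold>\<forall>j. j \<^bold>\<le> n \<^bold>\<longrightarrow>
           (j \<^bold>< m \<^bold>\<longrightarrow> maps U j j) \<^bold>\<and>
           (m \<^bold>\<le> j \<^bold>\<longrightarrow>
             (\<^bold>\<exists>b. \<^bold>\<exists>c. \<^bold>\<exists>y. is_base B j b \<^bold>\<and>
                admissible C U j b c \<^bold>\<and>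
                (\<^bold>\<forall>c'. c' \<^bold>< c \<^bold>\<longrightarrow> \<^bold>\<not> admissible C U j b c') \<^bold>\<and>
                is_subst U b c j y \<^bold>\<and> maps U j y)))) \<^bold>\<and>
       maps U n v)"


section \<open>Dynamical hierarchies and Goodstein sequences\<close>

text \<open>In the third clause, \<open>b\<close> is written as \<open>i + 1\<close>.\<close>

definition good_successor :: "pred \<Rightarrow> pred \<Rightarrow> form" where
  "good_successor B C =
    ((\<^bold>\<exists>m. \<^bold>\<exists>m'. is_min B m \<^bold>\<and> is_min C m' \<^bold>\<and> m \<^bold>\<le> m') \<^bold>\<and>
     (\<^bold>\<forall>n. \<^bold>\<exists>v. is_upgrade B C n v) \<^bold>\<and>
     (\<^bold>\<forall>i. \<^bold>\<forall>m. \<^bold>\<forall>x. \<^bold>\<forall>d.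
        B (i \<^bold>+ \<^bold>1) \<^bold>\<and> is_min B m \<^bold>\<and> m \<^bold>< i \<^bold>+ \<^bold>1 \<^bold>\<and>
        is_upgrade B C i x \<^bold>\<and> is_base C x d \<^bold>\<longrightarrow>
        \<^bold>\<not> (\<^bold>\<exists>y. d \<^bold>dvd y \<^bold>\<and> x \<^bold>< y \<^bold>\<and> less_S C y x)))"

definition dynamical_hierarchy :: "svar \<Rightarrow> form" where
  "dynamical_hierarchy \<B> =
    (\<^bold>\<forall>i. base_hierarchy (entry \<B> i) \<^bold>\<and>
         good_successor (entry \<B> i) (entry \<B> (i \<^bold>+ \<^bold>1)))"

text \<open>
  \<open>is_goodstein \<B> i n v\<close>: the \<open>i\<close>-th member of the Goodstein sequence for \<open>\<B>\<close> and \<open>n\<close> is \<open>v\<close>.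
  That \<open>y = \<up>x - 1\<close> is expressed by \<open>\<up>x = y + 1\<close>, which is no restriction as \<open>\<up>x > 0\<close> for \<open>x > 0\<close>.
\<close>

definition is_goodstein :: "svar \<Rightarrow> trm \<Rightarrow> trm \<Rightarrow> trm \<Rightarrow> form" where
  "is_goodstein \<B> i n v =
    (\<^bold>\<exists>\<^sub>S G. is_function G \<^bold>\<and> maps G \<^bold>0 n \<^bold>\<and>
       (\<^bold>\<forall>j. \<^bold>\<forall>x. \<^bold>\<forall>y. maps G j x \<^bold>\<and> maps G (j \<^bold>+ \<^bold>1) y \<^bold>\<longrightarrow>
          (\<^bold>0 \<^bold>< x \<^bold>\<longrightarrow> is_upgrade (entry \<B> j) (entry \<B> (j \<^bold>+ \<^bold>1)) x (y \<^bold>+ \<^bold>1)) \<^bold>\<and>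
          (x \<^bold>= \<^bold>0 \<^bold>\<longrightarrow> y \<^bold>= \<^bold>0)) \<^bold>\<and>
       maps G i v)"

end

theory Submission
  imports Defs "HOL-Library.Countable_Set"
begin

text \<open>
  By completeness it suffices to prove the sentence in an arbitrary countable model of
  \<open>RCA\<^sub>0\<close>. The hypotheses on \<open>B\<^sub>0\<close> say that the next base after \<open>b\<close> is \<open>2 b\<close>, or \<open>3 b\<close> with all
  bases at least \<open>3\<close>; call such a hierarchy regular. Then the leading digit of every number
  \<open>j = b a + r\<close> with base \<open>b\<close> is \<open>a = 1\<close> or \<open>a = 2\<close>, with exponent \<open>1\<close>, and upgrading becomes
  additive: \<open>\<up>(b a + r) = c a + \<up>r\<close>. It follows that good successors of regular hierarchies are
  regular, and that the places where the quotient of successive bases is \<open>3\<close> correspond to each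
  other along the sequence, so that each \<open>B\<^sub>i\<close> has exactly \<open>k\<close> of them. Between these places
  upgrading is linear, so a Goodstein sequence is governed by the digits obtained from division at
  these places. There are at most \<open>2 k + 1\<close> of them and they decrease lexicographically, so a number
  of applications of the least number principle for \<open>\<Sigma>\<^sub>1\<close> formulas that depends only on \<open>k\<close> suffices.
\<close>

section \<open>Substitution\<close>

text \<open>The obstacle is that only \<open>\<Sigma>\<^sub>1\<close> induction is available, while
  the upgrade is given through quantifiers over sets. It has to be shown to have a
  \<open>\<Sigma>\<^sub>1\<close> graph in both arguments before the Goodstein sequence is known to
  exist at all. The two bounds on S(b) do different work: 3 b limits the leading digit to 2, and b *
  min B keeps that digit below min B, so that upgrading leaves it fixed. Clause (3) of a good
  successor keeps the quotients small in the next hierarchy: a multiple of the current base beyond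
  the upgrade of b - 1 forces a new base no later than there. At a base b with quotient 3 the
  upgrade is not linear: b + r goes to U b + U r, but 2 b + r to 2 c + U r, where c may exceed U b.
  Hence each such place costs two divisions, by 3 t and by 2 t, and the last division, by min B,
  accounts for the 1 in 2 k + 1. The number k must be fixed outside the theory, since each
  application of the least number principle concerns a sequence that the previous one
  produced.\<close>

abbreviation upN :: "(nat \<Rightarrow> tm) \<Rightarrow> nat \<Rightarrow> tm" where
  "upN \<sigma> \<equiv> case_nat (Var 0) (\<lambda>n. lift_tm (\<sigma> n))"

abbreviation upS :: "(nat \<Rightarrow> nat) \<Rightarrow> nat \<Rightarrow> nat" where
  "upS \<rho> \<equiv> case_nat 0 (\<lambda>n. Suc (\<rho> n))"

lemma subst_tm_comp: "subst_tm \<sigma> (subst_tm \<tau> t) = subst_tm (\<lambda>n. subst_tm \<sigma> (\<tau> n)) t"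
  by (induction t) auto

lemma subst_tm_Var [simp]: "subst_tm Var t = t"
  by (induction t) auto

lemma upN_comp: "(\<lambda>n. subst_tm (upN \<sigma>) (upN \<tau> n)) = upN (\<lambda>n. subst_tm \<sigma> (\<tau> n))"
  by (rule ext) (simp add: subst_tm_comp split: nat.split)

lemma upS_comp: "(\<lambda>n. upS \<rho> (upS \<kappa> n)) = upS (\<lambda>n. \<rho> (\<kappa> n))"
  by (rule ext) (simp split: nat.split)

lemma subst_comp:
  "subst \<sigma> \<rho> (subst \<tau> \<kappa> p) = subst (\<lambda>n. subst_tm \<sigma> (\<tau> n)) (\<lambda>n. \<rho> (\<kappa> n)) p"
  by (induction p arbitrary: \<sigma> \<rho> \<tau> \<kappa>) (simp_all add: subst_tm_comp upN_comp upS_comp)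

lemma upN_Var [simp]: "case_nat (Var 0) (\<lambda>n. Var (Suc n)) = Var"
  by (rule ext) (simp split: nat.split)

lemma upS_id [simp]: "case_nat 0 Suc = id"
  by (rule ext) (simp split: nat.split)

lemma subst_Var [simp]: "subst Var id p = p" "subst Var (\<lambda>n. n) p = p"
proof -
  show "subst Var id p = p" by (induction p) (simp_all add: id_def[symmetric])
  then show "subst Var (\<lambda>n. n) p = p" by (simp add: id_def)
qed

lemma subst_cong_fun: "\<sigma> = \<tau> \<Longrightarrow> \<rho> = \<kappa> \<Longrightarrow> subst \<sigma> \<rho> p = subst \<tau> \<kappa> p"
  by simp

lemma subst_liftN: "subst (upN \<sigma>) \<rho> (liftN p) = liftN (subst \<sigma> \<rho> p)"
  unfolding liftN_def subst_comp by (rule subst_cong_fun) (auto simp: fun_eq_iff)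

lemma subst_liftS: "subst \<sigma> (upS \<rho>) (liftS p) = liftS (subst \<sigma> \<rho> p)"
  unfolding liftS_def subst_comp by (rule subst_cong_fun) (auto simp: fun_eq_iff)

lemma subst_instN: "subst \<sigma> \<rho> (instN t p) = instN (subst_tm \<sigma> t) (subst (upN \<sigma>) \<rho> p)"
  unfolding instN_def subst_comp
  by (rule subst_cong_fun) (auto simp: fun_eq_iff subst_tm_comp split: nat.split)

lemma subst_instS: "subst \<sigma> \<rho> (instS X p) = instS (\<rho> X) (subst \<sigma> (upS \<rho>) p)"
  unfolding instS_def subst_comp
  by (rule subst_cong_fun) (auto simp: fun_eq_iff split: nat.split)

text \<open>Instantiating under a lifted substitution only extends the substitution. Truth for
  simultaneous substitutions can therefore be proved by induction on the formula, the quantifier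
  case using the extended substitution.\<close>

lemma instN_subst_upN: "instN t (subst (upN \<sigma>) \<rho> p) = subst (case_nat t \<sigma>) \<rho> p"
  unfolding instN_def subst_comp
  by (rule subst_cong_fun) (auto simp: fun_eq_iff subst_tm_comp split: nat.split)

lemma instS_subst_upS: "instS X (subst \<sigma> (upS \<rho>) p) = subst \<sigma> (case_nat X \<rho>) p"
  unfolding instS_def subst_comp
  by (rule subst_cong_fun) (auto simp: fun_eq_iff split: nat.split)

primrec bound_tm :: "tm \<Rightarrow> nat" where
  "bound_tm (Var n) = Suc n"
| "bound_tm Zero = 0"
| "bound_tm One = 0"
| "bound_tm (Add s t) = max (bound_tm s) (bound_tm t)"
| "bound_tm (Mul s t) = max (bound_tm s) (bound_tm t)"

text \<open>A crude bound: bound variables are counted and indices are not decreased under a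
  quantifier. All that matters is that variables from the bound on do not occur free, as
  \<open>subst_cong\<close> confirms.\<close>

primrec boundN :: "fm \<Rightarrow> nat" where
  "boundN Fls = 0"
| "boundN (Eq s t) = max (bound_tm s) (bound_tm t)"
| "boundN (Less s t) = max (bound_tm s) (bound_tm t)"
| "boundN (Mem t X) = bound_tm t"
| "boundN (Imp p q) = max (boundN p) (boundN q)"
| "boundN (AllN p) = boundN p"
| "boundN (AllS p) = boundN p"

primrec boundS :: "fm \<Rightarrow> nat" where
  "boundS Fls = 0"
| "boundS (Eq s t) = 0"
| "boundS (Less s t) = 0"
| "boundS (Mem t X) = Suc X"
| "boundS (Imp p q) = max (boundS p) (boundS q)"
| "boundS (AllN p) = boundS p"
| "boundS (AllS p) = boundS p"

lemma subst_tm_cong: "(\<And>n. n < bound_tm t \<Longrightarrow> \<sigma> n = \<tau> n) \<Longrightarrow> subst_tm \<sigma> t = subst_tm \<tau> t"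
  by (induction t) auto

lemma subst_cong:
  "(\<And>n. n < boundN p \<Longrightarrow> \<sigma> n = \<tau> n) \<Longrightarrow> (\<And>n. n < boundS p \<Longrightarrow> \<rho> n = \<kappa> n) \<Longrightarrow>
    subst \<sigma> \<rho> p = subst \<tau> \<kappa> p"
proof (induction p arbitrary: \<sigma> \<tau> \<rho> \<kappa>)
  case (Imp p q)
  show ?case
    using Imp.IH(1)[of \<sigma> \<tau> \<rho> \<kappa>] Imp.IH(2)[of \<sigma> \<tau> \<rho> \<kappa>] Imp.prems by simp
next
  case (AllN p)
  show ?case by simp (rule AllN.IH, use AllN.prems in \<open>auto split: nat.split\<close>)
next
  case (AllS p)
  show ?case by simp (rule AllS.IH, use AllS.prems in \<open>auto split: nat.split\<close>)
qed (auto intro!: subst_tm_cong)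

section \<open>Derivations\<close>

lemma derives_weaken: "derives T \<Gamma> p \<Longrightarrow> \<Gamma> \<subseteq> \<Delta> \<Longrightarrow> derives T \<Delta> p"
proof (induction arbitrary: \<Delta> rule: derives.induct)
  case (ImpI p \<Gamma> q)
  then show ?case by (meson derives.ImpI insert_mono)
next
  case (Contr p \<Gamma>)
  then show ?case by (meson derives.Contr insert_mono)
next
  case (AllNI \<Gamma> p)
  then show ?case by (meson derives.AllNI image_mono)
next
  case (AllSI \<Gamma> p)
  then show ?case by (meson derives.AllSI image_mono)
next
  case (EqE \<Gamma> s t p)
  then show ?case by (blast intro: derives.EqE)
next
  case (ImpE \<Gamma> p q)
  then show ?case by (blast intro: derives.ImpE)
qed (simp_all add: derives.Axiom derives.Hyp derives.AllNE derives.AllSE derives.EqI subset_iff)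

lemma derives_finite: "derives T \<Gamma> p \<Longrightarrow> \<exists>\<Delta>. finite \<Delta> \<and> \<Delta> \<subseteq> \<Gamma> \<and> derives T \<Delta> p"
proof (induction rule: derives.induct)
  case (Axiom p \<Gamma>)
  then show ?case by (intro exI[of _ "{}"]) (simp add: derives.Axiom)
next
  case (Hyp p \<Gamma>)
  then show ?case by (intro exI[of _ "{p}"]) (simp add: derives.Hyp)
next
  case (ImpI p \<Gamma> q)
  then obtain \<Delta> where "finite \<Delta>" "\<Delta> \<subseteq> insert p \<Gamma>" "derives T \<Delta> q" by blast
  then show ?case
    by (intro exI[of _ "\<Delta> - {p}"]) (auto intro!: derives.ImpI elim: derives_weaken)
next
  case (ImpE \<Gamma> p q)
  then obtain \<Delta> \<Delta>' where "finite \<Delta>" "\<Delta> \<subseteq> \<Gamma>" "derives T \<Delta> (Imp p q)"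
    "finite \<Delta>'" "\<Delta>' \<subseteq> \<Gamma>" "derives T \<Delta>' p" by blast
  then show ?case
    by (intro exI[of _ "\<Delta> \<union> \<Delta>'"])
      (auto intro!: derives.ImpE[of _ _ p q] elim: derives_weaken)
next
  case (Contr p \<Gamma>)
  then obtain \<Delta> where "finite \<Delta>" "\<Delta> \<subseteq> insert (Neg p) \<Gamma>" "derives T \<Delta> Fls" by blast
  then show ?case
    by (intro exI[of _ "\<Delta> - {Neg p}"]) (auto intro!: derives.Contr[of _ p] elim: derives_weaken)
next
  case (AllNI \<Gamma> p)
  then obtain \<Delta> where "finite \<Delta>" "\<Delta> \<subseteq> liftN ` \<Gamma>" "derives T \<Delta> p" by blast
  then show ?case by (metis derives.AllNI finite_subset_image)
next
  case (AllNE \<Gamma> p t)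
  then show ?case by (blast intro: derives.AllNE)
next
  case (AllSI \<Gamma> p)
  then obtain \<Delta> where "finite \<Delta>" "\<Delta> \<subseteq> liftS ` \<Gamma>" "derives T \<Delta> p" by blast
  then show ?case by (metis derives.AllSI finite_subset_image)
next
  case (AllSE \<Gamma> p X)
  then show ?case by (blast intro: derives.AllSE)
next
  case (EqI \<Gamma> t)
  then show ?case by (intro exI[of _ "{}"]) (simp add: derives.EqI)
next
  case (EqE \<Gamma> s t p)
  then obtain \<Delta> \<Delta>' where "finite \<Delta>" "\<Delta> \<subseteq> \<Gamma>" "derives T \<Delta> (Eq s t)"
    "finite \<Delta>'" "\<Delta>' \<subseteq> \<Gamma>" "derives T \<Delta>' (instN s p)" by blast
  then have "derives T (\<Delta> \<union> \<Delta>') (Eq s t)" "derives T (\<Delta> \<union> \<Delta>') (instN s p)"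
    by (auto intro: derives_weaken)
  then have "derives T (\<Delta> \<union> \<Delta>') (instN t p)" by (rule derives.EqE)
  with \<open>finite \<Delta>\<close> \<open>\<Delta> \<subseteq> \<Gamma>\<close> \<open>finite \<Delta>'\<close> \<open>\<Delta>' \<subseteq> \<Gamma>\<close> show ?case
    by (intro exI[of _ "\<Delta> \<union> \<Delta>'"]) auto
qed

text \<open>Axioms are usable in every context without being lifted, so renaming variables in a
  derivation produces instances of axioms. These have to be derivable again.\<close>

definition subst_closed :: "fm set \<Rightarrow> bool" where
  "subst_closed T \<longleftrightarrow> (\<forall>p\<in>T. \<forall>\<sigma> \<rho> \<Gamma>. derives T \<Gamma> (subst \<sigma> \<rho> p))"

lemma derives_subst:
  assumes "subst_closed T"
  shows "derives T \<Gamma> p \<Longrightarrow> derives T (subst \<sigma> \<rho> ` \<Gamma>) (subst \<sigma> \<rho> p)"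
proof (induction arbitrary: \<sigma> \<rho> rule: derives.induct)
  case (Axiom p \<Gamma>)
  then show ?case using assms by (auto simp: subst_closed_def)
next
  case (Hyp p \<Gamma>)
  then show ?case by (simp add: derives.Hyp)
next
  case (ImpI p \<Gamma> q)
  from ImpI.IH[of \<sigma> \<rho>] show ?case by (simp add: derives.ImpI)
next
  case (ImpE \<Gamma> p q)
  from derives.ImpE[OF ImpE.IH(1)[of \<sigma> \<rho>, simplified] ImpE.IH(2)] show ?case .
next
  case (Contr p \<Gamma>)
  from Contr.IH[of \<sigma> \<rho>] show ?case by (simp add: derives.Contr[where p = "subst \<sigma> \<rho> p"])
next
  case (AllNI \<Gamma> p)
  from AllNI.IH[of "upN \<sigma>" \<rho>] show ?case
    by (auto intro!: derives.AllNI simp: image_image subst_liftN)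
next
  case (AllNE \<Gamma> p t)
  from derives.AllNE[OF AllNE.IH[of \<sigma> \<rho>, simplified]] show ?case
    by (simp add: subst_instN)
next
  case (AllSI \<Gamma> p)
  from AllSI.IH[of \<sigma> "upS \<rho>"] show ?case
    by (auto intro!: derives.AllSI simp: image_image subst_liftS)
next
  case (AllSE \<Gamma> p X)
  from derives.AllSE[OF AllSE.IH[of \<sigma> \<rho>, simplified]] show ?case
    by (simp add: subst_instS)
next
  case (EqI \<Gamma> t)
  show ?case by (simp add: derives.EqI)
next
  case (EqE \<Gamma> s t p)
  from derives.EqE[OF EqE.IH(1)[of \<sigma> \<rho>, simplified] EqE.IH(2)[of \<sigma> \<rho>, unfolded subst_instN]]
  show ?case by (simp add: subst_instN)
qed

text \<open>The variable \<open>y\<close> may be generalised since renaming it to \<open>0\<close> and lifting the others turns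
  the eigenvariable condition into the one of the rule \<open>AllNI\<close>.\<close>

lemma generalize_num:
  assumes T: "subst_closed T" and d: "derives T \<Gamma> (instN (Var y) p)"
    and y: "\<forall>q\<in>insert p \<Gamma>. boundN q \<le> y"
  shows "derives T \<Gamma> (AllN p)"
proof -
  define \<sigma> where "\<sigma> n = (if n = y then Var 0 else Var (Suc n))" for n
  have "subst \<sigma> id ` \<Gamma> = liftN ` \<Gamma>"
    unfolding liftN_def
    by (intro image_cong refl subst_cong) (use y in \<open>auto simp: \<sigma>_def dest!: bspec\<close>)
  moreover have "subst \<sigma> id (instN (Var y) p) = subst Var id p"
    unfolding instN_def subst_comp
    by (rule subst_cong) (use y in \<open>auto simp: \<sigma>_def split: nat.split\<close>)
  ultimately show ?thesis using derives_subst[OF T d, of \<sigma> id] by (auto intro: derives.AllNI)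
qed

lemma generalize_set:
  assumes T: "subst_closed T" and d: "derives T \<Gamma> (instS Y p)"
    and y: "\<forall>q\<in>insert p \<Gamma>. boundS q \<le> Y"
  shows "derives T \<Gamma> (AllS p)"
proof -
  define \<rho> where "\<rho> n = (if n = Y then 0 else Suc n)" for n
  have "subst Var \<rho> ` \<Gamma> = liftS ` \<Gamma>"
    unfolding liftS_def
    by (intro image_cong refl subst_cong) (use y in \<open>auto simp: \<rho>_def dest!: bspec\<close>)
  moreover have "subst Var \<rho> (instS Y p) = subst Var id p"
    unfolding instS_def subst_comp
    by (rule subst_cong) (use y in \<open>auto simp: \<rho>_def split: nat.split\<close>)
  ultimately show ?thesis using derives_subst[OF T d, of Var \<rho>] by (auto intro: derives.AllSI)
qed

subsection \<open>\<open>RCA\<^sub>0\<close> is closed under substitution\<close>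

text \<open>An axiom is derivable in any context, so both of its variables can be generalised. The
  outer quantifier then binds variable 1, which is why \<open>\<sigma> (Suc 0)\<close> is
  instantiated before \<open>\<sigma> 0\<close>.\<close>

lemma derives_subst2:
  assumes "p \<in> T" "boundN p \<le> 2" "boundS p = 0"
  shows "derives T \<Gamma> (subst \<sigma> \<rho> p)"
proof -
  have "derives T \<Gamma> (AllN (AllN p))"
    using assms by (intro derives.AllNI derives.Axiom)
  from derives.AllNE[OF this, of "\<sigma> (Suc 0)"]
  have "derives T \<Gamma> (AllN (subst (upN (case_nat (\<sigma> (Suc 0)) Var)) id p))"
    by (simp add: instN_def)
  from derives.AllNE[OF this, of "\<sigma> 0"]
  have "derives T \<Gamma> (subst (case_nat (\<sigma> 0) (case_nat (\<sigma> (Suc 0)) Var)) id p)"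
    by (simp add: instN_subst_upN)
  moreover have "subst (case_nat (\<sigma> 0) (case_nat (\<sigma> (Suc 0)) Var)) id p = subst \<sigma> \<rho> p"
    by (rule subst_cong) (use assms in \<open>auto split: nat.split simp: numeral_2_eq_2 less_Suc_eq\<close>)
  ultimately show ?thesis by simp
qed

lemma bounded_subst: "bounded p \<Longrightarrow> bounded (subst \<sigma> \<rho> p)"
proof (induction arbitrary: \<sigma> \<rho> rule: bounded.induct)
  case (6 p t)
  have "subst_tm (upN \<sigma>) (lift_tm t) = lift_tm (subst_tm \<sigma> t)" by (simp add: subst_tm_comp)
  then show ?case using 6 by (simp add: bounded.intros(6))
next
  case (7 p t)
  have "subst_tm (upN \<sigma>) (lift_tm t) = lift_tm (subst_tm \<sigma> t)" by (simp add: subst_tm_comp)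
  then show ?case using 7 by (simp add: bounded.intros(7))
qed (auto intro: bounded.intros)

lemma Sigma01_subst: "p \<in> Sigma01 \<Longrightarrow> subst \<sigma> \<rho> p \<in> Sigma01"
  unfolding Sigma01_def by (auto intro: bounded_subst)

lemma Pi01_subst: "p \<in> Pi01 \<Longrightarrow> subst \<sigma> \<rho> p \<in> Pi01"
  unfolding Pi01_def by (auto intro: bounded_subst)

lemma subst_induction: "subst \<sigma> \<rho> (induction p) = induction (subst (upN \<sigma>) \<rho> p)"
proof -
  have "subst (upN \<sigma>) \<rho> (subst (case_nat (Add (Var 0) One) (\<lambda>n. Var (Suc n))) id p)
    = subst (case_nat (Add (Var 0) One) (\<lambda>n. Var (Suc n))) id (subst (upN \<sigma>) \<rho> p)"
    unfolding subst_comp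
    by (rule subst_cong_fun) (auto simp: fun_eq_iff subst_tm_comp split: nat.split)
  then show ?thesis by (simp add: induction_def subst_instN)
qed

lemma subst_comprehension:
  "subst \<sigma> \<rho> (comprehension p q) = comprehension (subst (upN \<sigma>) \<rho> p) (subst (upN \<sigma>) \<rho> q)"
  by (simp add: comprehension_def subst_liftS)

text \<open>Substitution maps instances of the two schemes to instances of the same scheme. The
  finite list of basic axioms is not closed in this sense and goes through universal
  closures.\<close>

lemma subst_closed_RCA0: "subst_closed RCA0"
  unfolding subst_closed_def
proof (intro ballI allI)
  fix p \<sigma> \<rho> \<Gamma>
  assume p: "p \<in> RCA0"
  consider "p \<in> basic_axioms" | q where "p = induction q" "q \<in> Sigma01"
    | q r where "p = comprehension q r" "q \<in> Sigma01" "r \<in> Pi01"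
    using p unfolding RCA0_def by blast
  then show "derives RCA0 \<Gamma> (subst \<sigma> \<rho> p)"
  proof cases
    case 1
    then have "boundN p \<le> 2" "boundS p = 0" by (auto simp: basic_axioms_def Let_def)
    with p show ?thesis by (rule derives_subst2)
  next
    case 2
    then have "subst \<sigma> \<rho> p \<in> RCA0"
      by (auto simp: subst_induction RCA0_def intro: Sigma01_subst)
    then show ?thesis by (rule derives.Axiom)
  next
    case 3
    then have "subst \<sigma> \<rho> p \<in> RCA0"
      unfolding RCA0_def subst_comprehension[of \<sigma> \<rho> q r, folded 3(1)]
      using Sigma01_subst Pi01_subst by blast
    then show ?thesis by (rule derives.Axiom)
  qed
qed

section \<open>Completeness\<close>

instance tm :: countable by countable_datatype
instance fm :: countable by countable_datatype

definition con :: "fm set \<Rightarrow> fm set \<Rightarrow> bool" where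
  "con T \<Gamma> \<longleftrightarrow> \<not> derives T \<Gamma> Fls"

lemma con_mono: "con T \<Delta> \<Longrightarrow> \<Gamma> \<subseteq> \<Delta> \<Longrightarrow> con T \<Gamma>"
  unfolding con_def using derives_weaken by blast

definition freshN :: "fm set \<Rightarrow> nat" where "freshN \<Gamma> = Max (insert 0 (boundN ` \<Gamma>))"
definition freshS :: "fm set \<Rightarrow> nat" where "freshS \<Gamma> = Max (insert 0 (boundS ` \<Gamma>))"

lemma freshN: "finite \<Gamma> \<Longrightarrow> p \<in> \<Gamma> \<Longrightarrow> boundN p \<le> freshN \<Gamma>"
  unfolding freshN_def by (intro Max_ge) auto

lemma freshS: "finite \<Gamma> \<Longrightarrow> p \<in> \<Gamma> \<Longrightarrow> boundS p \<le> freshS \<Gamma>"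
  unfolding freshS_def by (intro Max_ge) auto

text \<open>Fresh variables take the role of Henkin constants, so the language need not be extended.
  This requires every stage of the construction to be finite.\<close>

definition witness :: "fm set \<Rightarrow> fm \<Rightarrow> fm set" where
  "witness \<Gamma> p = {Neg (instN (Var (freshN \<Gamma>)) q) |q. p = Neg (AllN q)}
     \<union> {Neg (instS (freshS \<Gamma>) q) |q. p = Neg (AllS q)}"

lemma finite_witness: "finite (witness \<Gamma> p)"
proof -
  have "witness \<Gamma> p \<subseteq> (case p of Imp (AllN q) r \<Rightarrow> {Neg (instN (Var (freshN \<Gamma>)) q)}
     | Imp (AllS q) r \<Rightarrow> {Neg (instS (freshS \<Gamma>) q)} | _ \<Rightarrow> {})"
    by (auto simp: witness_def)
  then show ?thesis by (rule finite_subset) (auto split: fm.split)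
qed

lemma con_witness:
  assumes T: "subst_closed T" and \<Gamma>: "finite \<Gamma>" "con T \<Gamma>" "p \<in> \<Gamma>"
  shows "con T (\<Gamma> \<union> witness \<Gamma> p)"
proof -
  consider q where "p = Neg (AllN q)" | q where "p = Neg (AllS q)" | "witness \<Gamma> p = {}"
    unfolding witness_def by blast
  then show ?thesis
  proof cases
    case 1
    then have w: "witness \<Gamma> p = {Neg (instN (Var (freshN \<Gamma>)) q)}" by (auto simp: witness_def)
    have "derives T \<Gamma> Fls" if "derives T (\<Gamma> \<union> witness \<Gamma> p) Fls"
    proof -
      have "derives T \<Gamma> (instN (Var (freshN \<Gamma>)) q)" using that w by (auto intro: derives.Contr)
      moreover have "\<forall>r\<in>insert q \<Gamma>. boundN r \<le> freshN \<Gamma>"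
        using freshN[OF \<Gamma>(1)] \<Gamma>(3) 1 by fastforce
      ultimately have "derives T \<Gamma> (AllN q)" using generalize_num[OF T] by blast
      moreover have "derives T \<Gamma> (Neg (AllN q))" using 1 \<Gamma>(3) by (auto intro: derives.Hyp)
      ultimately show ?thesis by (blast intro: derives.ImpE)
    qed
    with \<Gamma>(2) show ?thesis by (auto simp: con_def)
  next
    case 2
    then have w: "witness \<Gamma> p = {Neg (instS (freshS \<Gamma>) q)}" by (auto simp: witness_def)
    have "derives T \<Gamma> Fls" if "derives T (\<Gamma> \<union> witness \<Gamma> p) Fls"
    proof -
      have "derives T \<Gamma> (instS (freshS \<Gamma>) q)" using that w by (auto intro: derives.Contr)
      moreover have "\<forall>r\<in>insert q \<Gamma>. boundS r \<le> freshS \<Gamma>"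
        using freshS[OF \<Gamma>(1)] \<Gamma>(3) 2 by fastforce
      ultimately have "derives T \<Gamma> (AllS q)" using generalize_set[OF T] by blast
      moreover have "derives T \<Gamma> (Neg (AllS q))" using 2 \<Gamma>(3) by (auto intro: derives.Hyp)
      ultimately show ?thesis by (blast intro: derives.ImpE)
    qed
    with \<Gamma>(2) show ?thesis by (auto simp: con_def)
  next
    case 3
    with \<Gamma>(2) show ?thesis by simp
  qed
qed

primrec stage :: "fm set \<Rightarrow> fm set \<Rightarrow> nat \<Rightarrow> fm set" where
  "stage T \<Gamma> 0 = \<Gamma>"
| "stage T \<Gamma> (Suc n) =
    (let \<Delta> = insert (from_nat n) (stage T \<Gamma> n)
     in if con T \<Delta> then \<Delta> \<union> witness \<Delta> (from_nat n) else stage T \<Gamma> n)"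

definition henkin :: "fm set \<Rightarrow> fm set \<Rightarrow> fm set" where
  "henkin T \<Gamma> = (\<Union>n. stage T \<Gamma> n)"

lemma stage_finite_con:
  assumes "subst_closed T" "finite \<Gamma>" "con T \<Gamma>"
  shows "finite (stage T \<Gamma> n) \<and> con T (stage T \<Gamma> n)"
proof (induction n)
  case (Suc n)
  then show ?case
    using con_witness[OF assms(1), of "insert (from_nat n) (stage T \<Gamma> n)" "from_nat n"]
    by (simp add: Let_def finite_witness del: Un_insert_left)
qed (simp add: assms)

lemma stage_mono: "m \<le> n \<Longrightarrow> stage T \<Gamma> m \<subseteq> stage T \<Gamma> n"
  by (rule lift_Suc_mono_le[of "stage T \<Gamma>"]) (auto simp: Let_def)

lemma finite_subset_stage:
  assumes "finite \<Delta>" "\<Delta> \<subseteq> henkin T \<Gamma>" shows "\<exists>n. \<Delta> \<subseteq> stage T \<Gamma> n"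
  using assms
proof (induction rule: finite_induct)
  case (insert p \<Delta>)
  then obtain m n where "\<Delta> \<subseteq> stage T \<Gamma> n" "p \<in> stage T \<Gamma> m" by (auto simp: henkin_def)
  then have "insert p \<Delta> \<subseteq> stage T \<Gamma> (max m n)"
    using stage_mono[of m "max m n" T \<Gamma>] stage_mono[of n "max m n" T \<Gamma>] by auto
  then show ?case ..
qed simp

locale henkin_set =
  fixes T H :: "fm set"
  assumes con_H: "con T H"
    and H_max: "con T (insert p H) \<Longrightarrow> p \<in> H"
    and H_num: "Neg (AllN q) \<in> H \<Longrightarrow> \<exists>t. Neg (instN t q) \<in> H"
    and H_set: "Neg (AllS q) \<in> H \<Longrightarrow> \<exists>X. Neg (instS X q) \<in> H"
begin

lemma H_closed: assumes "derives T H p" shows "p \<in> H"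
proof (rule H_max, unfold con_def, rule notI)
  assume "derives T (insert p H) Fls"
  then have "derives T H (Imp p Fls)" by (rule derives.ImpI)
  from derives.ImpE[OF this assms] con_H show False by (simp add: con_def)
qed

lemma H_iff: "p \<in> H \<longleftrightarrow> derives T H p"
  using H_closed derives.Hyp by blast

lemma Fls_H [simp]: "Fls \<notin> H"
  using con_H derives.Hyp unfolding con_def by blast

lemma Neg_H: "Neg p \<in> H \<longleftrightarrow> p \<notin> H"
proof
  assume "Neg p \<in> H" then show "p \<notin> H" using Fls_H H_iff derives.ImpE by metis
next
  assume "p \<notin> H"
  then have "derives T (insert p H) Fls" using H_max unfolding con_def by blast
  then show "Neg p \<in> H" using H_iff derives.ImpI by metis
qed

lemma Imp_H [simp]: "Imp p q \<in> H \<longleftrightarrow> (p \<in> H \<longrightarrow> q \<in> H)"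
proof
  assume "Imp p q \<in> H" then show "p \<in> H \<longrightarrow> q \<in> H" using H_iff derives.ImpE by metis
next
  assume a: "p \<in> H \<longrightarrow> q \<in> H"
  show "Imp p q \<in> H"
  proof (cases "p \<in> H")
    case True
    with a have "derives T (insert p H) q" by (auto intro: derives.Hyp)
    then show ?thesis using H_iff derives.ImpI by metis
  next
    case False
    then have "Neg p \<in> H" by (simp add: Neg_H)
    have "derives T (insert p H) (Neg p)" "derives T (insert p H) p"
      using \<open>Neg p \<in> H\<close> by (auto intro: derives.Hyp)
    then have "derives T (insert p H) Fls" by (rule derives.ImpE)
    then have "derives T (insert (Neg q) (insert p H)) Fls" by (rule derives_weaken) auto
    then have "derives T H (Imp p q)" by (metis derives.ImpI derives.Contr)
    then show ?thesis by (rule H_closed)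
  qed
qed

lemma AllN_H: "AllN p \<in> H \<longleftrightarrow> (\<forall>t. instN t p \<in> H)"
proof
  assume "AllN p \<in> H"
  then show "\<forall>t. instN t p \<in> H" by (blast intro: H_closed derives.AllNE derives.Hyp)
next
  assume "\<forall>t. instN t p \<in> H"
  then show "AllN p \<in> H" using H_num[of p] by (auto simp: Neg_H)
qed

lemma AllS_H: "AllS p \<in> H \<longleftrightarrow> (\<forall>X. instS X p \<in> H)"
proof
  assume "AllS p \<in> H"
  then show "\<forall>X. instS X p \<in> H" by (blast intro: H_closed derives.AllSE derives.Hyp)
next
  assume "\<forall>X. instS X p \<in> H"
  then show "AllS p \<in> H" using H_set[of p] by (auto simp: Neg_H)
qed

lemma Eq_refl_H [simp]: "Eq t t \<in> H"
  by (simp add: H_closed derives.EqI)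

lemma Eq_H: "Eq s t \<in> H \<Longrightarrow> instN s p \<in> H \<Longrightarrow> instN t p \<in> H"
  by (rule H_closed, rule derives.EqE[of _ _ s]) (simp_all add: derives.Hyp)

end

lemma henkin_set_henkin:
  assumes T: "subst_closed T" and \<Gamma>: "finite \<Gamma>" "con T \<Gamma>"
  shows "henkin_set T (henkin T \<Gamma>)"
proof -
  let ?H = "henkin T \<Gamma>"
  have con: "con T ?H"
    unfolding con_def
  proof
    assume "derives T ?H Fls"
    from derives_finite[OF this]
    obtain \<Delta> where "finite \<Delta>" "\<Delta> \<subseteq> ?H" "derives T \<Delta> Fls" by blast
    moreover from this(1,2) obtain n where "\<Delta> \<subseteq> stage T \<Gamma> n" using finite_subset_stage by blast
    ultimately show False
      using stage_finite_con[OF T \<Gamma>, of n] derives_weaken unfolding con_def by blast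
  qed
  \<comment> \<open>The formula \<open>p\<close> is decided at stage \<open>to_nat p\<close>;
    consistency with the limit implies consistency with that stage, so \<open>p\<close> was added
    there together with its witness.\<close>
  have step: "insert p (witness (insert p (stage T \<Gamma> (to_nat p))) p) \<subseteq> ?H"
    if "con T (insert p ?H)" for p
  proof -
    have "con T (insert p (stage T \<Gamma> (to_nat p)))"
      using that by (rule con_mono) (auto simp: henkin_def)
    then have "insert p (witness (insert p (stage T \<Gamma> (to_nat p))) p) \<subseteq> stage T \<Gamma> (Suc (to_nat p))"
      by (auto simp: Let_def)
    then show ?thesis unfolding henkin_def by blast
  qed
  show ?thesis
  proof
    show "con T ?H" by (rule con)
    show "p \<in> ?H" if "con T (insert p ?H)" for p using step[OF that] by blast
    fix q
    show "\<exists>t. Neg (instN t q) \<in> ?H" if "Neg (AllN q) \<in> ?H"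
      using step[of "Neg (AllN q)"] con that by (auto simp: insert_absorb witness_def)
    show "\<exists>X. Neg (instS X q) \<in> ?H" if "Neg (AllS q) \<in> ?H"
      using step[of "Neg (AllS q)"] con that by (auto simp: insert_absorb witness_def)
  qed
qed

section \<open>Structures\<close>

text \<open>Henkin semantics: set quantifiers range over \<open>Sets\<close> and not over all
  subsets, as completeness requires.\<close>

locale struct =
  fixes Z I :: 'm and A M :: "'m \<Rightarrow> 'm \<Rightarrow> 'm" and L :: "'m \<Rightarrow> 'm \<Rightarrow> bool" and Sets :: "'m set set"
begin

primrec eval :: "(nat \<Rightarrow> 'm) \<Rightarrow> tm \<Rightarrow> 'm" where
  "eval e (Var n) = e n"
| "eval e Zero = Z"
| "eval e One = I"
| "eval e (Add s t) = A (eval e s) (eval e t)"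
| "eval e (Mul s t) = M (eval e s) (eval e t)"

primrec sat :: "(nat \<Rightarrow> 'm) \<Rightarrow> (nat \<Rightarrow> 'm set) \<Rightarrow> fm \<Rightarrow> bool" where
  "sat e f Fls \<longleftrightarrow> False"
| "sat e f (Eq s t) \<longleftrightarrow> eval e s = eval e t"
| "sat e f (Less s t) \<longleftrightarrow> L (eval e s) (eval e t)"
| "sat e f (Mem t X) \<longleftrightarrow> eval e t \<in> f X"
| "sat e f (Imp p q) \<longleftrightarrow> (sat e f p \<longrightarrow> sat e f q)"
| "sat e f (AllN p) \<longleftrightarrow> (\<forall>m. sat (case_nat m e) f p)"
| "sat e f (AllS p) \<longleftrightarrow> (\<forall>X\<in>Sets. sat e (case_nat X f) p)"

lemma eval_subst: "eval e (subst_tm \<sigma> t) = eval (\<lambda>n. eval e (\<sigma> n)) t"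
  by (induction t) auto

lemma eval_upN: "(\<lambda>n. eval (case_nat m e) (upN \<sigma> n)) = case_nat m (\<lambda>n. eval e (\<sigma> n))"
  by (rule ext) (simp add: eval_subst split: nat.split)

lemma case_nat_comp: "(\<lambda>n. case_nat X f (upS \<rho> n)) = case_nat X (\<lambda>n. f (\<rho> n))"
  by (rule ext) (simp split: nat.split)

lemma sat_subst: "sat e f (subst \<sigma> \<rho> p) \<longleftrightarrow> sat (\<lambda>n. eval e (\<sigma> n)) (\<lambda>n. f (\<rho> n)) p"
  by (induction p arbitrary: e f \<sigma> \<rho>) (simp_all add: eval_subst eval_upN case_nat_comp)

lemma sat_instN: "sat e f (instN t p) \<longleftrightarrow> sat (case_nat (eval e t) e) f p"
proof -
  have "(\<lambda>n. eval e (case_nat t Var n)) = case_nat (eval e t) e"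
    by (rule ext) (simp split: nat.split)
  then show ?thesis by (simp add: instN_def sat_subst)
qed

lemma sat_liftS: "sat e (case_nat X f) (liftS p) \<longleftrightarrow> sat e f p"
  by (simp add: liftS_def sat_subst)

end

text \<open>The terms modulo provable equality form a countably infinite set, which can be
  transported along a bijection to any prescribed countably infinite type. Later this type is
  \<open>hm\<close>.\<close>

lemma (in henkin_set) ex_valuation:
  assumes T: "basic_axioms \<subseteq> T" "subst_closed T" and inf: "infinite (UNIV :: 'm::countable set)"
  obtains v :: "tm \<Rightarrow> 'm::countable" where "\<And>t u. v t = v u \<longleftrightarrow> Eq t u \<in> H" "surj v"
proof -
  have Eq_sym: "Eq t s \<in> H" if "Eq s t \<in> H" for s t
    using Eq_H[OF that, of "Eq (Var 0) (lift_tm s)"] by (simp add: instN_def subst_tm_comp)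
  have Eq_trans: "Eq s u \<in> H" if "Eq s t \<in> H" "Eq t u \<in> H" for s t u
    using Eq_H[OF that(2), of "Eq (lift_tm s) (Var 0)"] that(1) by (simp add: instN_def subst_tm_comp)
  define cl where "cl t = {u. Eq t u \<in> H}" for t
  have cl_eq: "cl t = cl u \<longleftrightarrow> Eq t u \<in> H" for t u
  proof
    assume "cl t = cl u"
    moreover have "u \<in> cl u" by (simp add: cl_def)
    ultimately have "u \<in> cl t" by simp
    then show "Eq t u \<in> H" by (simp add: cl_def)
  next
    assume "Eq t u \<in> H"
    then show "cl t = cl u" using Eq_sym[of t u] Eq_trans[of t u] Eq_trans[of u t] by (auto simp: cl_def)
  qed
  have axH: "subst \<sigma> id p \<in> H" if "p \<in> basic_axioms" for p \<sigma>
    using T that unfolding subst_closed_def by (intro H_closed) blast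
  \<comment> \<open>On a finite set the injective successor would be surjective, and
    \<open>Zero\<close> would be a successor.\<close>
  have "infinite (range cl)"
  proof
    assume fin: "finite (range cl)"
    define sc where "sc c = cl (Add (SOME t. cl t = c) One)" for c
    have sc: "sc (cl t) = cl (Add t One)" for t
    proof -
      have "cl (SOME u. cl u = cl t) = cl t" by (rule someI) simp
      then have "Eq (SOME u. cl u = cl t) t \<in> H" by (simp add: cl_eq)
      then have "Eq (Add (SOME u. cl u = cl t) One) (Add t One) \<in> H"
        using Eq_H[of "SOME u. cl u = cl t" t "Eq (Add (lift_tm (SOME u. cl u = cl t)) One) (Add (Var 0) One)"]
        by (simp add: instN_def subst_tm_comp)
      then show ?thesis by (simp add: sc_def cl_eq)
    qed
    have "inj_on sc (range cl)"
    proof (rule inj_onI, clarsimp simp: sc)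
      fix t u assume "cl (Add t One) = cl (Add u One)"
      moreover have "Imp (Eq (Add t One) (Add u One)) (Eq t u) \<in> H"
        using axH[of "Imp (Eq (Add (Var 0) One) (Add (Var 1) One)) (Eq (Var 0) (Var 1))"
            "case_nat t (\<lambda>_. u)"]
        by (simp add: basic_axioms_def Let_def)
      ultimately show "cl t = cl u" by (simp add: cl_eq)
    qed
    moreover have "sc ` range cl \<subseteq> range cl" using sc by auto
    ultimately have "sc ` range cl = range cl" using fin by (simp add: endo_inj_surj)
    then have "cl Zero \<in> sc ` range cl" by blast
    then obtain t where "cl Zero = cl (Add t One)" by (auto simp: sc)
    then have "Eq (Add t One) Zero \<in> H" by (simp add: Eq_sym cl_eq)
    moreover have "Neg (Eq (Add t One) Zero) \<in> H"
      using axH[of "Neg (Eq (Add (Var 1) One) Zero)" "\<lambda>_. t"]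
      by (simp add: basic_axioms_def Let_def)
    ultimately show False by simp
  qed
  moreover have "countable (range cl)" by simp
  ultimately have "bij_betw (to_nat_on (range cl)) (range cl) UNIV"
    by (rule to_nat_on_infinite[rotated])
  moreover have "bij_betw (from_nat_into (UNIV :: 'm set)) UNIV UNIV"
    using inf by (intro bij_betw_from_nat_into) auto
  ultimately obtain g where g: "bij_betw g (range cl) (UNIV :: 'm set)"
    using bij_betw_trans by blast
  define v :: "tm \<Rightarrow> 'm" where "v t = g (cl t)" for t
  have "v t = v u \<longleftrightarrow> Eq t u \<in> H" for t u
    unfolding v_def using bij_betw_imp_inj_on[OF g] by (simp add: inj_on_eq_iff cl_eq[symmetric])
  moreover have "surj v"
    using bij_betw_imp_surj_on[OF g] unfolding v_def by (simp add: image_image[symmetric])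
  ultimately show ?thesis by (rule that)
qed

text \<open>The sets of the term model are those named by set variables, so they are the range of a
  single assignment \<open>f\<close>. Truth under all \<open>e\<close> and \<open>\<rho>\<close>
  expresses that open axioms are read as universally closed.\<close>

theorem completeness:
  assumes T: "basic_axioms \<subseteq> T" "subst_closed T" and inf: "infinite (UNIV :: 'm::countable set)"
    and \<phi>: "\<not> T \<turnstile> \<phi>"
  shows "\<exists>Z I A M L (f :: nat \<Rightarrow> 'm::countable set) e.
    (\<forall>p\<in>T. \<forall>e \<rho>. struct.sat Z I A M L (range f) e (\<lambda>n. f (\<rho> n)) p) \<and>
    \<not> struct.sat Z I A M L (range f) e f \<phi>"
proof -
  define \<Gamma> where "\<Gamma> = {Neg \<phi>}"
  have \<Gamma>: "con T \<Gamma>"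
    unfolding con_def \<Gamma>_def using \<phi> derives.Contr[of T \<phi> "{}"] by (auto simp: proves_def)
  have fin: "finite \<Gamma>" by (simp add: \<Gamma>_def)
  define H where "H = henkin T \<Gamma>"
  interpret henkin_set T H
    unfolding H_def by (rule henkin_set_henkin[OF T(2) fin \<Gamma>])
  have "Neg \<phi> \<in> stage T \<Gamma> 0" by (simp add: \<Gamma>_def)
  then have \<phi>H: "\<phi> \<notin> H" unfolding Neg_H[symmetric] by (auto simp: H_def henkin_def simp del: stage.simps)
  obtain v :: "tm \<Rightarrow> 'm" where v: "\<And>t u. v t = v u \<longleftrightarrow> Eq t u \<in> H" "surj v"
    using ex_valuation[OF T inf] by blast
  define r where "r x = (SOME t. v t = x)" for x
  have vr: "v (r x) = x" for x
    unfolding r_def using v(2) by (metis (mono_tags) someI_ex surjD)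
  have Eqr: "Eq t (r (v t)) \<in> H" "Eq (r (v t)) t \<in> H" for t
    unfolding v(1)[symmetric] by (simp_all add: vr)
  have Hcong: "instN t p \<in> H \<longleftrightarrow> instN (r (v t)) p \<in> H" for t p
    using Eq_H Eqr by blast
  define A where "A x y = v (Add (r x) (r y))" for x y
  define M where "M x y = v (Mul (r x) (r y))" for x y
  define L where "L x y \<longleftrightarrow> Less (r x) (r y) \<in> H" for x y
  define f where "f X = {x. Mem (r x) X \<in> H}" for X
  have inst1: "subst_tm (case_nat s Var) (lift_tm t) = t" for s t
    by (simp add: subst_tm_comp)
  \<comment> \<open>Replaces both arguments of a binary symbol by the chosen representatives of
    their classes, one at a time; \<open>sw\<close> exchanges the order of the two
    instantiations.\<close>
  have bin: "instN (r (v u)) (instN (lift_tm (r (v t))) p) \<in> H \<longleftrightarrow> instN u (instN (lift_tm t) p) \<in> H" for p t u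
  proof -
    have sw: "instN a (instN (lift_tm b) p) =
      instN b (subst (case_nat (Var 0) (case_nat (lift_tm a) (\<lambda>n. Var (Suc n)))) id p)" for a b
      unfolding instN_def subst_comp
      by (rule subst_cong_fun) (auto simp: fun_eq_iff subst_tm_comp split: nat.split)
    have "instN (r (v u)) (instN (lift_tm (r (v t))) p) \<in> H \<longleftrightarrow> instN u (instN (lift_tm (r (v t))) p) \<in> H"
      by (rule Hcong[symmetric])
    also have "\<dots> \<longleftrightarrow> instN u (instN (lift_tm t) p) \<in> H"
      unfolding sw by (rule Hcong[symmetric])
    finally show ?thesis .
  qed
  have vA: "A (v t) (v u) = v (Add t u)" for t u
    using bin[of u t "Eq (Add (Var 0) (Var 1)) (lift_tm (lift_tm (Add t u)))"]
    by (simp add: A_def v(1) instN_def subst_tm_comp)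
  have vM: "M (v t) (v u) = v (Mul t u)" for t u
    using bin[of u t "Eq (Mul (Var 0) (Var 1)) (lift_tm (lift_tm (Mul t u)))"]
    by (simp add: M_def v(1) instN_def subst_tm_comp)
  have vL: "L (v t) (v u) \<longleftrightarrow> Less t u \<in> H" for t u
    using bin[of u t "Less (Var 0) (Var 1)"] by (simp add: L_def instN_def subst_tm_comp)
  have vf: "v t \<in> f X \<longleftrightarrow> Mem t X \<in> H" for t X
    using Hcong[of t "Mem (Var 0) X"] by (simp add: f_def instN_def)
  interpret struct "v Zero" "v One" A M L "range f" .
  have eval: "eval (\<lambda>n. v (\<sigma> n)) t = v (subst_tm \<sigma> t)" for \<sigma> t
    by (induction t) (simp_all add: vA vM)
  have truth: "sat (\<lambda>n. v (\<sigma> n)) (\<lambda>n. f (\<rho> n)) p \<longleftrightarrow> subst \<sigma> \<rho> p \<in> H" for \<sigma> \<rho> p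
  proof (induction p arbitrary: \<sigma> \<rho>)
    case (AllN p)
    have cn: "case_nat (v t) (\<lambda>n. v (\<sigma> n)) = (\<lambda>n. v (case_nat t \<sigma> n))" for t
      by (rule ext) (simp split: nat.split)
    have "sat (\<lambda>n. v (\<sigma> n)) (\<lambda>n. f (\<rho> n)) (AllN p) \<longleftrightarrow>
      (\<forall>t. sat (case_nat (v t) (\<lambda>n. v (\<sigma> n))) (\<lambda>n. f (\<rho> n)) p)"
      using v(2) by simp (metis surjD)
    also have "\<dots> \<longleftrightarrow> (\<forall>t. subst (case_nat t \<sigma>) \<rho> p \<in> H)"
      unfolding cn using AllN by simp
    finally show ?case by (simp add: AllN_H instN_subst_upN)
  next
    case (AllS p)
    have cn: "case_nat (f X) (\<lambda>n. f (\<rho> n)) = (\<lambda>n. f (case_nat X \<rho> n))" for X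
      by (rule ext) (simp split: nat.split)
    show ?case using AllS by (simp add: AllS_H instS_subst_upS cn)
  qed (simp_all add: eval v(1) vL vf)
  \<comment> \<open>Every assignment of numbers is given by terms, namely the representatives
    \<open>r (e n)\<close>, so the truth lemma applies to the corresponding substitution instance of
    the axiom.\<close>
  have "sat e (\<lambda>n. f (\<rho> n)) p" if "p \<in> T" for e \<rho> p
  proof -
    have "subst (\<lambda>n. r (e n)) \<rho> p \<in> H"
      using T(2) that unfolding subst_closed_def by (intro H_closed) blast
    then show ?thesis by (simp add: truth[symmetric] vr)
  qed
  moreover have "\<not> sat (\<lambda>n. v (Var n)) f \<phi>" using truth[of Var "\<lambda>n. n"] \<phi>H by simp
  ultimately show ?thesis by blast
qed

section \<open>Definability in models of \<open>RCA\<^sub>0\<close>\<close>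

locale rca_struct = struct Z I A M L "range f"
  for Z I :: "'m::countable" and A M L and f :: "nat \<Rightarrow> 'm set" +
  assumes ax: "p \<in> RCA0 \<Longrightarrow> sat e (\<lambda>n. f (\<rho> n)) p"
begin

text \<open>
  Predicates and terms with the number variables \<open>0, \<dots>, n - 1\<close> are functions of an
  assignment; every element of the structure may serve as a parameter, as all of them are
  assigned to further variables.
\<close>

definition env :: "nat \<Rightarrow> (nat \<Rightarrow> 'm) \<Rightarrow> nat \<Rightarrow> 'm" where
  "env n e = (\<lambda>i. if i < n then e i else from_nat (i - n))"

lemma env_Suc: "env (Suc n) (case_nat x e) = case_nat x (env n e)"
  by (rule ext) (simp add: env_def split: nat.split)

definition T :: "nat \<Rightarrow> ((nat \<Rightarrow> 'm) \<Rightarrow> 'm) \<Rightarrow> bool" where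
  "T n g \<longleftrightarrow> (\<exists>t. \<forall>e. g e = eval (env n e) t)"

text \<open>Set variables are evaluated by \<open>f\<close> itself, so every member of
  \<open>range f\<close> may serve as a parameter. Definability of a HOL predicate can then be
  checked by introduction rules that follow its shape.\<close>

definition D :: "nat \<Rightarrow> ((nat \<Rightarrow> 'm) \<Rightarrow> bool) \<Rightarrow> bool" where
  "D n P \<longleftrightarrow> (\<exists>p. bounded p \<and> (\<forall>e. P e \<longleftrightarrow> sat (env n e) f p))"

definition S1 :: "nat \<Rightarrow> ((nat \<Rightarrow> 'm) \<Rightarrow> bool) \<Rightarrow> bool" where
  "S1 n P \<longleftrightarrow> (\<exists>Q. D (Suc n) Q \<and> (\<forall>e. P e \<longleftrightarrow> (\<exists>x. Q (case_nat x e))))"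

lemma T_var: "i < n \<Longrightarrow> T n (\<lambda>e. e i)"
  unfolding T_def by (rule exI[of _ "Var i"]) (simp add: env_def)

lemma T_const: "T n (\<lambda>e. c)"
  unfolding T_def by (rule exI[of _ "Var (n + to_nat c)"]) (simp add: env_def)

lemma T_add: "T n g \<Longrightarrow> T n h \<Longrightarrow> T n (\<lambda>e. A (g e) (h e))"
  unfolding T_def by (metis eval.simps(4))

lemma T_mul: "T n g \<Longrightarrow> T n h \<Longrightarrow> T n (\<lambda>e. M (g e) (h e))"
  unfolding T_def by (metis eval.simps(5))

lemma D_eq: "T n g \<Longrightarrow> T n h \<Longrightarrow> D n (\<lambda>e. g e = h e)"
  unfolding T_def D_def by (metis sat.simps(2) bounded.intros(2))

lemma D_less: "T n g \<Longrightarrow> T n h \<Longrightarrow> D n (\<lambda>e. L (g e) (h e))"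
  unfolding T_def D_def by (metis sat.simps(3) bounded.intros(3))

lemma D_mem: "X \<in> range f \<Longrightarrow> T n g \<Longrightarrow> D n (\<lambda>e. g e \<in> X)"
  unfolding T_def D_def by (metis sat.simps(4) bounded.intros(4) imageE)

lemma D_imp: "D n P \<Longrightarrow> D n Q \<Longrightarrow> D n (\<lambda>e. P e \<longrightarrow> Q e)"
  unfolding D_def by (metis sat.simps(5) bounded.intros(5))

lemma D_const: "D n (\<lambda>e. b)"
  unfolding D_def
proof (cases b)
  case True
  then show "\<exists>p. bounded p \<and> (\<forall>e. b \<longleftrightarrow> sat (env n e) f p)"
    by (intro exI[of _ "Imp Fls Fls"]) (auto intro: bounded.intros)
next
  case False
  then show "\<exists>p. bounded p \<and> (\<forall>e. b \<longleftrightarrow> sat (env n e) f p)"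
    by (intro exI[of _ Fls]) (auto intro: bounded.intros)
qed

lemma D_not: "D n P \<Longrightarrow> D n (\<lambda>e. \<not> P e)"
  using D_imp[OF _ D_const[of n False], of P] by simp

lemma D_or: "D n P \<Longrightarrow> D n Q \<Longrightarrow> D n (\<lambda>e. P e \<or> Q e)"
  using D_imp[OF D_not[of n P], of Q] by (simp add: disj_imp)

lemma D_and: "D n P \<Longrightarrow> D n Q \<Longrightarrow> D n (\<lambda>e. P e \<and> Q e)"
  using D_not[OF D_imp[OF _ D_not[of n Q], of P]] by simp

lemma D_all:
  assumes "T n g" "D (Suc n) (\<lambda>e. P (e 0) (\<lambda>i. e (Suc i)))"
  shows "D n (\<lambda>e. \<forall>x. L x (g e) \<longrightarrow> P x e)"
proof -
  from assms(1) obtain t where t: "\<And>e. g e = eval (env n e) t" unfolding T_def by blast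
  from assms(2) obtain p where p: "bounded p" "\<And>e. P (e 0) (\<lambda>i. e (Suc i)) \<longleftrightarrow> sat (env (Suc n) e) f p"
    unfolding D_def by blast
  have "P x e \<longleftrightarrow> sat (case_nat x (env n e)) f p" for x e
    using p(2)[of "case_nat x e"] by (simp add: env_Suc)
  then show ?thesis
    unfolding D_def using t p(1)
    by (intro exI[of _ "AllN (Imp (Less (Var 0) (lift_tm t)) p)"])
      (auto simp: eval_subst intro: bounded.intros)
qed

lemma D_S1:
  assumes "D n P" shows "S1 n P"
proof -
  from assms obtain p where p: "bounded p" "\<And>e. P e \<longleftrightarrow> sat (env n e) f p" unfolding D_def by blast
  have "D (Suc n) (\<lambda>e. P (\<lambda>i. e (Suc i)))"
    unfolding D_def
  proof (intro exI conjI allI)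
    fix e
    have "sat (env (Suc n) e) f (liftN p) = sat (\<lambda>i. env (Suc n) e (Suc i)) f p"
      by (simp add: liftN_def sat_subst)
    also have "(\<lambda>i. env (Suc n) e (Suc i)) = env n (\<lambda>i. e (Suc i))" by (simp add: env_def fun_eq_iff)
    finally show "P (\<lambda>i. e (Suc i)) \<longleftrightarrow> sat (env (Suc n) e) f (liftN p)" by (simp add: p)
  qed (simp add: liftN_def bounded_subst p(1))
  then show ?thesis unfolding S1_def by (intro exI[of _ "\<lambda>e. P (\<lambda>i. e (Suc i))"]) simp
qed

lemma S1_exD:
  "D (Suc n) (\<lambda>e. P (e 0) (\<lambda>i. e (Suc i))) \<Longrightarrow> S1 n (\<lambda>e. \<exists>x. P x e)"
  unfolding S1_def by (intro exI[of _ "\<lambda>e. P (e 0) (\<lambda>i. e (Suc i))"]) simp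

lemma S1_formula:
  assumes "S1 1 (\<lambda>e. P (e 0))"
  obtains q where "bounded q" "\<And>x. P x \<longleftrightarrow> (\<exists>y. sat (case_nat y (case_nat x from_nat)) f q)"
proof -
  from assms obtain Q where Q: "D 2 Q" "\<And>e. P (e 0) \<longleftrightarrow> (\<exists>x. Q (case_nat x e))"
    unfolding S1_def by (auto simp: numeral_2_eq_2)
  from Q(1) obtain q where q: "bounded q" "\<And>e. Q e \<longleftrightarrow> sat (env 2 e) f q" unfolding D_def by blast
  have "P x \<longleftrightarrow> (\<exists>y. sat (case_nat y (case_nat x from_nat)) f q)" for x
  proof -
    have "env 2 (case_nat y (\<lambda>_. x)) = case_nat y (case_nat x from_nat)" for y
      by (rule ext) (simp add: env_def numeral_2_eq_2 split: nat.split)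
    then show ?thesis using Q(2)[of "\<lambda>_. x"] by (simp add: q(2))
  qed
  with q(1) show ?thesis by (rule that)
qed

lemma S1_induct:
  assumes P: "S1 1 (\<lambda>e. P (e 0))" and "P Z" and "\<And>x. P x \<Longrightarrow> P (A x I)"
  shows "P x"
proof -
  obtain q where q: "bounded q" "\<And>x. P x \<longleftrightarrow> (\<exists>y. sat (case_nat y (case_nat x from_nat)) f q)"
    using S1_formula[OF P] by blast
  have "induction (ExN q) \<in> RCA0" using q(1) by (auto simp: RCA0_def Sigma01_def)
  from ax[OF this, of from_nat "\<lambda>n. n"] have
    "sat from_nat f (instN Zero (ExN q)) \<Longrightarrow>
     (\<And>x. sat (case_nat x from_nat) f (ExN q) \<Longrightarrow>
       sat (case_nat x from_nat) f (subst (case_nat (Add (Var 0) One) (\<lambda>n. Var (Suc n))) id (ExN q))) \<Longrightarrow>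
     sat (case_nat x from_nat) f (ExN q)"
    unfolding induction_def by (simp del: subst.simps)
  moreover have "(\<lambda>n. eval (case_nat x from_nat) (case_nat (Add (Var 0) One) (\<lambda>n. Var (Suc n)) n))
    = case_nat (A x I) from_nat" for x
    by (rule ext) (simp split: nat.split)
  ultimately show ?thesis using assms(2,3) by (simp add: sat_instN sat_subst q(2) del: subst.simps)
qed

lemma comprehension:
  assumes P: "S1 1 (\<lambda>e. P (e 0))" and nP: "S1 1 (\<lambda>e. \<not> P (e 0))"
  shows "{x. P x} \<in> range f"
proof -
  obtain p where p: "bounded p" "\<And>x. P x \<longleftrightarrow> (\<exists>y. sat (case_nat y (case_nat x from_nat)) f p)"
    using S1_formula[OF P] by blast
  obtain q where q: "bounded q" "\<And>x. \<not> P x \<longleftrightarrow> (\<exists>y. sat (case_nat y (case_nat x from_nat)) f q)"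
    using S1_formula[OF nP] by blast
  have "ExN p \<in> Sigma01" unfolding Sigma01_def using p(1) by blast
  \<comment> \<open>The required \<open>\<Pi>\<^sub>1\<close> form of \<open>P\<close> is the
    negation of the \<open>\<Sigma>\<^sub>1\<close> form of its complement.\<close>
  moreover have "AllN (Neg q) \<in> Pi01"
    unfolding Pi01_def using bounded.intros(5)[OF q(1) bounded.intros(1)] by blast
  ultimately have "comprehension (ExN p) (AllN (Neg q)) \<in> RCA0" unfolding RCA0_def by blast
  from ax[OF this, of from_nat "\<lambda>n. n"]
  moreover have "(\<forall>y. \<not> sat (case_nat y (case_nat x from_nat)) f q) \<longleftrightarrow> P x" for x
    using q(2)[of x] by blast
  ultimately have "\<exists>X\<in>range f. \<forall>x. x \<in> X \<longleftrightarrow> P x"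
    unfolding comprehension_def by (simp add: sat_liftS p(2)[symmetric] iff_conv_conj_imp)
  then show ?thesis by (metis Collect_mem_eq Collect_cong)
qed

lemmas D_intros = D_const D_and D_or D_not D_imp D_all D_eq D_less D_mem T_const T_var T_add T_mul

lemma D_induct: "D 1 (\<lambda>e. P (e 0)) \<Longrightarrow> P Z \<Longrightarrow> (\<And>x. P x \<Longrightarrow> P (A x I)) \<Longrightarrow> P x"
  by (rule S1_induct[of P]) (auto intro: D_S1)

end

section \<open>Arithmetic in models of \<open>RCA\<^sub>0\<close>\<close>

text \<open>The operations are parameters and there are no sets, so that both a countermodel and the
  standard numbers can be shown to satisfy these laws.\<close>

locale arith =
  fixes Z I :: 'm and A M :: "'m \<Rightarrow> 'm \<Rightarrow> 'm" and L :: "'m \<Rightarrow> 'm \<Rightarrow> bool"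
  assumes assoc: "A (A x y) z = A x (A y z)"
    and comm: "A x y = A y x"
    and zero: "A x Z = x"
    and cancel: "A x z = A y z \<longrightarrow> x = y"
    and mult_assoc: "M (M x y) z = M x (M y z)"
    and mult_comm: "M x y = M y x"
    and one: "M x I = x"
    and mult_zero: "M x Z = Z"
    and distrib: "M x (A y z) = A (M x y) (M x z)"
    and succ: "A x I \<noteq> Z"
    and cases: "x = Z \<or> (\<exists>y. x = A y I)"
    and less: "L x y \<longleftrightarrow> (\<exists>k. y = A (A x k) I)"
    and total: "\<exists>k. y = A x k \<or> x = A y k"

context rca_struct
begin

lemma basic:
  "A m Z = m" "A m (A n I) = A (A m n) I" "M m Z = Z" "M m (A n I) = A (M m n) m"
  "A n I \<noteq> Z" "A m I = A n I \<longleftrightarrow> m = n" "\<not> L m Z" "L m (A n I) \<longleftrightarrow> L m n \<or> m = n"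
proof -
  have *: "sat (case_nat m (\<lambda>_. n)) (\<lambda>_. f 0) p" if "p \<in> basic_axioms" for p
    using that ax[of p _ "\<lambda>_. 0"] by (simp add: RCA0_def)
  note ** = *[unfolded basic_axioms_def Let_def]
  show "A m Z = m" using **[of "Eq (Add (Var 0) Zero) (Var 0)"] by simp
  show "A m (A n I) = A (A m n) I"
    using **[of "Eq (Add (Var 0) (Add (Var 1) One)) (Add (Add (Var 0) (Var 1)) One)"] by simp
  show "M m Z = Z" using **[of "Eq (Mul (Var 0) Zero) Zero"] by simp
  show "M m (A n I) = A (M m n) m"
    using **[of "Eq (Mul (Var 0) (Add (Var 1) One)) (Add (Mul (Var 0) (Var 1)) (Var 0))"] by simp
  show "A n I \<noteq> Z" using **[of "Neg (Eq (Add (Var 1) One) Zero)"] by simp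
  show "A m I = A n I \<longleftrightarrow> m = n"
    using **[of "Imp (Eq (Add (Var 0) One) (Add (Var 1) One)) (Eq (Var 0) (Var 1))"] by auto
  show "\<not> L m Z" using **[of "Neg (Less (Var 0) Zero)"] by simp
  show "L m (A n I) \<longleftrightarrow> L m n \<or> m = n"
    using **[of "Iff (Less (Var 0) (Add (Var 1) One)) (Or (Less (Var 0) (Var 1)) (Eq (Var 0) (Var 1)))"]
    by auto
qed

lemma Z_add: "A Z x = x"
  by (rule D_induct[of "\<lambda>x. A Z x = x"]) (intro D_intros, simp_all add: basic)

lemma S_add: "A (A x I) y = A (A x y) I"
  by (rule D_induct[of "\<lambda>y. A (A x I) y = A (A x y) I"]) (intro D_intros, simp_all add: basic)

lemma A_comm: "A x y = A y x"
  by (rule D_induct[of "\<lambda>y. A x y = A y x"]) (intro D_intros, simp_all add: basic Z_add S_add)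

lemma A_assoc: "A (A x y) z = A x (A y z)"
  by (rule D_induct[of "\<lambda>z. A (A x y) z = A x (A y z)"]) (intro D_intros, simp_all add: basic)

lemma A_cancel: "A x z = A y z \<longrightarrow> x = y"
  by (rule D_induct[of "\<lambda>z. A x z = A y z \<longrightarrow> x = y"]) (intro D_intros, simp_all add: basic)

lemma A_left_comm: "A x (A y z) = A y (A x z)"
  by (metis A_assoc A_comm)

lemma Z_mul: "M Z x = Z"
  by (rule D_induct[of "\<lambda>x. M Z x = Z"]) (intro D_intros, simp_all add: basic)

lemma S_mul: "M (A x I) y = A (M x y) y"
  by (rule D_induct[of "\<lambda>y. M (A x I) y = A (M x y) y"])
    (intro D_intros, simp_all add: basic(1,3,4) A_assoc A_left_comm A_comm)

lemma M_comm: "M x y = M y x"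
  by (rule D_induct[of "\<lambda>y. M x y = M y x"]) (intro D_intros, simp_all add: basic Z_mul S_mul)

lemma M_distrib: "M x (A y z) = A (M x y) (M x z)"
  by (rule D_induct[of "\<lambda>z. M x (A y z) = A (M x y) (M x z)"])
    (intro D_intros, simp_all add: basic A_assoc[symmetric])

lemma M_one: "M x I = x"
  using basic(4)[of x Z] by (simp add: basic(3) Z_add)

lemma M_assoc: "M (M x y) z = M x (M y z)"
  by (rule D_induct[of "\<lambda>z. M (M x y) z = M x (M y z)"])
    (intro D_intros, simp_all add: basic(1,3) M_distrib M_one)

lemma Z_or_S: "x = Z \<or> (\<exists>y. x = A y I)"
proof -
  \<comment> \<open>The existential quantifier is moved to the front because \<open>S1_exD\<close>
    expects it before a bounded matrix.\<close>
  have "\<exists>y. x = Z \<or> x = A y I"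
    by (rule S1_induct[of "\<lambda>x. \<exists>y. x = Z \<or> x = A y I"]) (rule S1_exD, intro D_intros, auto)
  then show ?thesis by blast
qed

lemma L_iff: "L x y \<longleftrightarrow> (\<exists>k. y = A (A x k) I)"
proof
  have "\<exists>k. L x y \<longrightarrow> y = A (A x k) I"
  proof (rule S1_induct[of "\<lambda>y. \<exists>k. L x y \<longrightarrow> y = A (A x k) I"])
    fix y assume "\<exists>k. L x y \<longrightarrow> y = A (A x k) I"
    then show "\<exists>k. L x (A y I) \<longrightarrow> A y I = A (A x k) I"
      using basic(2)[of x] by (auto simp: basic(6,8)) (metis basic(1) basic(2))+
  qed (rule S1_exD, intro D_intros, simp_all add: basic)
  then show "L x y \<Longrightarrow> \<exists>k. y = A (A x k) I" by blast
next
  have "L x (A (A x k) I)" for k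
    by (rule D_induct[of "\<lambda>k. L x (A (A x k) I)"]) (intro D_intros, simp_all add: basic)
  then show "\<exists>k. y = A (A x k) I \<Longrightarrow> L x y" by blast
qed

lemma L_total: "\<exists>k. y = A x k \<or> x = A y k"
proof (rule S1_induct[of "\<lambda>x. \<exists>k. y = A x k \<or> x = A y k"])
  fix x assume "\<exists>k. y = A x k \<or> x = A y k"
  then obtain k where "y = A x k \<or> x = A y k" by blast
  then show "\<exists>k. y = A (A x I) k \<or> A x I = A y k"
  proof
    assume y: "y = A x k"
    obtain k' where "k = Z \<or> k = A k' I" using Z_or_S by blast
    then show ?thesis using y basic(1,2) S_add by metis
  next
    assume "x = A y k"
    then show ?thesis using basic(2) by metis
  qed
qed (rule S1_exD, intro D_intros, auto simp: Z_add)

lemma arith: "arith Z I A M L"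
  unfolding arith_def
  by (intro conjI allI A_assoc A_comm A_cancel M_assoc M_comm M_one M_distrib basic(1,3,5)
      Z_or_S L_iff L_total)

end

section \<open>Discretely ordered semirings\<close>

class disc_semidom = linordered_semidom + canonically_ordered_monoid_add +
  assumes less_imp_add1_le: "a < b \<Longrightarrow> a + 1 \<le> b"
begin

lemma less_iff_add1_le: "a < b \<longleftrightarrow> a + 1 \<le> b"
  using less_imp_add1_le less_add_one less_le_trans by blast

lemma less_add1_iff: "a < b + 1 \<longleftrightarrow> a \<le> b"
  by (simp add: less_iff_add1_le)

lemma pos_imp_ge1: "0 < a \<Longrightarrow> 1 \<le> a"
  using less_imp_add1_le[of 0 a] by simp

lemma zero_or_add1: "x = 0 \<or> (\<exists>y. x = y + 1)"
proof (cases "x = 0")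
  case False
  then have "1 \<le> x" using pos_imp_ge1 zero_less_iff_neq_zero by blast
  then obtain y where "x = 1 + y" unfolding le_iff_add by blast
  then show ?thesis by (auto simp: add.commute)
qed simp

end

subsection \<open>The ring of differences\<close>

text \<open>
  Every \<open>disc_semidom\<close> embeds into an ordered ring, where linear arithmetic is available.
\<close>

definition gint_rel :: "'a::disc_semidom \<times> 'a \<Rightarrow> 'a \<times> 'a \<Rightarrow> bool" where
  "gint_rel = (\<lambda>(a, b) (c, d). a + d = c + b)"

lemma gint_rel_equivp: "equivp (gint_rel :: 'a::disc_semidom \<times> 'a \<Rightarrow> _)"
proof (rule equivpI)
  show "transp (gint_rel :: 'a \<times> 'a \<Rightarrow> _)"
  proof (rule transpI, clarsimp simp: gint_rel_def)
    fix a b c d s t :: 'a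
    assume "a + d = c + b" "c + t = s + d"
    then have "(a + t) + (c + d) = (s + b) + (c + d)" by (metis add.assoc add.commute)
    then show "a + t = s + b" by simp
  qed
qed (auto simp: gint_rel_def reflp_def symp_def)

quotient_type (overloaded) 'a gint = "'a::disc_semidom \<times> 'a" / gint_rel
  by (rule gint_rel_equivp)

instantiation gint :: (disc_semidom) linordered_idom
begin

lift_definition zero_gint :: "'a gint" is "(0, 0)" .
lift_definition one_gint :: "'a gint" is "(1, 0)" .

lift_definition plus_gint :: "'a gint \<Rightarrow> 'a gint \<Rightarrow> 'a gint" is "\<lambda>(a, b) (c, d). (a + c, b + d)"
  by (clarsimp simp: gint_rel_def) (metis add.assoc add.left_commute)

lift_definition uminus_gint :: "'a gint \<Rightarrow> 'a gint" is "\<lambda>(a, b). (b, a)"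
  by (clarsimp simp: gint_rel_def) (metis add.commute)

definition minus_gint :: "'a gint \<Rightarrow> 'a gint \<Rightarrow> 'a gint" where "minus_gint x y = x + - y"

lift_definition times_gint :: "'a gint \<Rightarrow> 'a gint \<Rightarrow> 'a gint"
  is "\<lambda>(a, b) (c, d). (a * c + b * d, a * d + b * c)"
proof (clarsimp simp: gint_rel_def)
  fix a b c d s t u v :: 'a
  assume 1: "a + d = c + b" and 2: "s + v = u + t"
  have "(a * s + b * t + (c * v + d * u)) + (d * s + c * t) = (a + d) * s + (c + b) * t + c * v + d * u"
    by (simp add: algebra_simps)
  also have "\<dots> = (c + b) * s + (a + d) * t + c * v + d * u" by (simp only: 1)
  also have "\<dots> = c * (s + v) + d * (u + t) + b * s + a * t" by (simp add: algebra_simps)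
  also have "\<dots> = c * (u + t) + d * (s + v) + b * s + a * t" by (simp only: 2)
  also have "\<dots> = (c * u + d * v + (a * t + b * s)) + (d * s + c * t)" by (simp add: algebra_simps)
  finally show "a * s + b * t + (c * v + d * u) = c * u + d * v + (a * t + b * s)" by simp
qed

lift_definition less_eq_gint :: "'a gint \<Rightarrow> 'a gint \<Rightarrow> bool" is "\<lambda>(a, b) (c, d). a + d \<le> c + b"
proof (clarsimp simp: gint_rel_def)
  fix a b c d s t u v :: 'a
  assume 1: "a + d = c + b" and 2: "s + v = u + t"
  have "a + t \<le> s + b \<longleftrightarrow> (a + t) + (d + v) \<le> (s + b) + (d + v)" by simp
  also have "\<dots> \<longleftrightarrow> (a + d) + (t + v) \<le> (s + v) + (b + d)" by (simp add: algebra_simps)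
  also have "\<dots> \<longleftrightarrow> (c + v) + (b + t) \<le> (u + d) + (b + t)" unfolding 1 2 by (simp add: algebra_simps)
  finally show "a + t \<le> s + b \<longleftrightarrow> c + v \<le> u + d" by simp
qed

definition less_gint :: "'a gint \<Rightarrow> 'a gint \<Rightarrow> bool" where "less_gint x y \<longleftrightarrow> x \<le> y \<and> \<not> y \<le> x"
definition abs_gint_if: "\<bar>x :: 'a gint\<bar> = (if x < 0 then - x else x)"
definition sgn_gint :: "'a gint \<Rightarrow> 'a gint" where
  "sgn_gint x = (if x = 0 then 0 else if 0 < x then 1 else - 1)"

instance
proof
  fix x y z :: "'a gint"
  show "x + y + z = x + (y + z)" by transfer (auto simp: gint_rel_def algebra_simps)
  show "x + y = y + x" by transfer (auto simp: gint_rel_def algebra_simps)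
  show "0 + x = x" by transfer (auto simp: gint_rel_def algebra_simps)
  show "- x + x = 0" by transfer (auto simp: gint_rel_def algebra_simps)
  show "x - y = x + - y" by (simp add: minus_gint_def)
  show "x + y - x = y" unfolding minus_gint_def by transfer (auto simp: gint_rel_def algebra_simps)
  show "x - y - z = x - (y + z)"
    unfolding minus_gint_def by transfer (auto simp: gint_rel_def algebra_simps)
  show "0 * x = 0" "x * 0 = 0" by (transfer, auto simp: gint_rel_def)+
  show "x * y * z = x * (y * z)" by transfer (auto simp: gint_rel_def algebra_simps)
  show "x * y = y * x" by transfer (auto simp: gint_rel_def algebra_simps)
  show "1 * x = x" by transfer (auto simp: gint_rel_def algebra_simps)
  show "(x + y) * z = x * z + y * z" by transfer (auto simp: gint_rel_def algebra_simps)
  show "(0 :: 'a gint) \<noteq> 1" by transfer (auto simp: gint_rel_def)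
  show "x < y \<longleftrightarrow> x \<le> y \<and> \<not> y \<le> x" by (rule less_gint_def)
  show "x \<le> x" by transfer auto
  show "x \<le> z" if "x \<le> y" "y \<le> z" using that
  proof (transfer, clarsimp)
    fix a b c d s t :: 'a
    assume "a + d \<le> c + b" "c + t \<le> s + d"
    then have "(a + d) + (c + t) \<le> (c + b) + (s + d)" by (rule add_mono)
    then have "(a + t) + (c + d) \<le> (s + b) + (c + d)" by (simp only: ac_simps)
    then show "a + t \<le> s + b" by simp
  qed
  show "x = y" if "x \<le> y" "y \<le> x" using that
    by transfer (auto simp: gint_rel_def)
  show "x \<le> y \<or> y \<le> x" by transfer auto
  show "z + x \<le> z + y" if "x \<le> y" using that by transfer (auto simp: algebra_simps)
  show "z * x < z * y" if "x < y" "0 < z" using that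
    unfolding less_gint_def
  proof (transfer, clarsimp simp: not_le)
    fix a b c d s t :: 'a
    assume "a + d \<le> c + b" "c + b \<noteq> a + d" "t \<le> s" "s \<noteq> t"
    then have ab: "a + d < c + b" and st: "t < s" by auto
    \<comment> \<open>With \<open>s = t + k\<close> the two products differ from a common summand by
      \<open>k * (a + d)\<close> and \<open>k * (c + b)\<close>, so strict monotonicity in the
      semiring suffices.\<close>
    obtain k where k: "s = t + k" using st by (metis le_iff_add less_imp_le)
    with st have "0 < k" by simp
    with ab have "k * (a + d) < k * (c + b)" by (rule mult_strict_left_mono)
    then have "(t * a + t * b + t * c + t * d) + k * (a + d) < (t * a + t * b + t * c + t * d) + k * (c + b)"
      by simp
    moreover have "s * a + t * b + (s * d + t * c) = (t * a + t * b + t * c + t * d) + k * (a + d)"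
      by (simp add: k algebra_simps)
    moreover have "s * c + t * d + (s * b + t * a) = (t * a + t * b + t * c + t * d) + k * (c + b)"
      by (simp add: k algebra_simps)
    ultimately show "s * a + t * b + (s * d + t * c) \<le> s * c + t * d + (s * b + t * a) \<and>
      s * a + t * b + (s * d + t * c) < s * c + t * d + (s * b + t * a)"
      by simp
  qed
  show "\<bar>x\<bar> = (if x < 0 then - x else x)" by (rule abs_gint_if)
  show "sgn x = (if x = 0 then 0 else if 0 < x then 1 else - 1)" by (rule sgn_gint_def)
qed

end

lift_definition zi :: "'a::disc_semidom \<Rightarrow> 'a gint" is "\<lambda>a. (a, 0)" .

lemma zi_eq: "a = b \<longleftrightarrow> zi a = zi b"
  by transfer (simp add: gint_rel_def)

lemma zi_le: "a \<le> b \<longleftrightarrow> zi a \<le> zi b"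
  by transfer simp

lemma zi_add: "zi (a + b) = zi a + zi b"
  by transfer (simp add: gint_rel_def)

lemma zi_mult: "zi (a * b) = zi a * zi b"
  by transfer (simp add: gint_rel_def)

lemma zi_0: "zi 0 = 0"
  by transfer (simp add: gint_rel_def)

lemma zi_1: "zi 1 = 1"
  by transfer (simp add: gint_rel_def)

text \<open>Linear arithmetic over ordered rings knows nothing of discreteness, so strict
  inequalities are translated with the gap 1 made explicit.\<close>

lemma zi_less: "a < b \<longleftrightarrow> zi a + 1 \<le> zi b"
  unfolding less_iff_add1_le zi_le zi_add zi_1 ..

lemma zi_numeral: "zi (numeral n) = numeral n"
  by (induction n) (simp_all only: numeral.simps zi_1 zi_add)

lemma zi_nonneg: "0 \<le> zi a"
  by transfer simp

lemmas zi_simps = zi_eq zi_le zi_less zi_add zi_mult zi_0 zi_1 zi_numeral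

section \<open>A countermodel\<close>

definition goal :: "nat \<Rightarrow> fm" where
  "goal k = sentence
    (\<^bold>\<forall>\<^sub>S \<B>.
       dynamical_hierarchy \<B> \<^bold>\<and>
       (\<^bold>\<forall>b. entry \<B> \<^bold>0 b \<^bold>\<longrightarrow>
          (\<^bold>\<exists>m. \<^bold>\<exists>s. is_min (entry \<B> \<^bold>0) m \<^bold>\<and> is_S (entry \<B> \<^bold>0) b s \<^bold>\<and>
             s \<^bold>\<le> \<^bold>3 \<^bold>* b \<^bold>\<and> s \<^bold>\<le> b \<^bold>* m)) \<^bold>\<and>
       exactly k (\<lambda>b. entry \<B> \<^bold>0 b \<^bold>\<and> is_S (entry \<B> \<^bold>0) b (\<^bold>3 \<^bold>* b)) \<^bold>\<longrightarrow>
       (\<^bold>\<forall>n. \<^bold>\<exists>i. is_goodstein \<B> i n \<^bold>0))"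

text \<open>
  The type \<open>hm\<close> carries a countermodel to one of the sentences \<open>goal k\<close>, if there is one, and
  the standard numbers otherwise. Thus it is unconditionally an instance of \<open>disc_semidom\<close>, and
  arithmetic in the countermodel is arithmetic in a type class.
\<close>

datatype hm = Hm nat

instance hm :: countable by countable_datatype

lemma infinite_hm: "infinite (UNIV :: hm set)"
proof -
  have "inj Hm" by (rule injI) simp
  then show ?thesis using finite_subset[OF subset_UNIV] finite_imageD infinite_UNIV_nat by blast
qed

text \<open>The failing \<open>k\<close> is quantified inside, so one structure, and hence one type,
  serves for all \<open>k\<close> at once.\<close>

definition countermodel ::
  "hm \<Rightarrow> hm \<Rightarrow> (hm \<Rightarrow> hm \<Rightarrow> hm) \<Rightarrow> (hm \<Rightarrow> hm \<Rightarrow> hm) \<Rightarrow> (hm \<Rightarrow> hm \<Rightarrow> bool) \<Rightarrow> (nat \<Rightarrow> hm set) \<Rightarrow> bool"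
  where "countermodel Z I A M L f \<longleftrightarrow> arith Z I A M L \<and>
    ((\<exists>k. \<not> RCA0 \<turnstile> goal k) \<longrightarrow>
      rca_struct Z I A M L f \<and> (\<exists>k e. \<not> struct.sat Z I A M L (range f) e f (goal k)))"

lemma ex_countermodel: "\<exists>Z I A M L f. countermodel Z I A M L f"
proof (cases "\<exists>k. \<not> RCA0 \<turnstile> goal k")
  case True
  then obtain k where k: "\<not> RCA0 \<turnstile> goal k" ..
  have "basic_axioms \<subseteq> RCA0" unfolding RCA0_def by blast
  from completeness[OF this subst_closed_RCA0 infinite_hm k] show ?thesis
  proof (elim exE conjE)
    fix Z I A M L and f :: "nat \<Rightarrow> hm set" and e
    assume m: "\<forall>p\<in>RCA0. \<forall>e \<rho>. struct.sat Z I A M L (range f) e (\<lambda>n. f (\<rho> n)) p"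
      "\<not> struct.sat Z I A M L (range f) e f (goal k)"
    then have r: "rca_struct Z I A M L f" by unfold_locales blast
    with m(2) have "countermodel Z I A M L f"
      unfolding countermodel_def using rca_struct.arith[OF r] by blast
    then show ?thesis by blast
  qed
next
  case False
  define g where "g = case_hm (\<lambda>n. n)"
  have "arith (Hm 0) (Hm 1) (\<lambda>x y. Hm (g x + g y)) (\<lambda>x y. Hm (g x * g y)) (\<lambda>x y. g x < g y)"
    unfolding arith_def
  proof (intro conjI allI)
    fix x y :: hm
    show "x = Hm 0 \<or> (\<exists>y. x = Hm (g y + g (Hm 1)))"
    proof (cases x)
      case (Hm n)
      then show ?thesis by (cases n) (auto simp: g_def intro!: exI[of _ "Hm (n - 1)"])
    qed
    show "g x < g y \<longleftrightarrow> (\<exists>k. y = Hm (g (Hm (g x + g k)) + g (Hm 1)))"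
      by (cases x; cases y) (auto simp: g_def less_iff_Suc_add intro: exI[of _ "Hm _"])
    show "\<exists>k. y = Hm (g x + g k) \<or> x = Hm (g y + g k)"
    proof (cases x; cases y)
      fix m n assume "x = Hm m" "y = Hm n"
      then show ?thesis
        by (intro exI[of _ "Hm ((m - n) + (n - m))"]) (auto simp: g_def)
    qed
  qed (auto simp: g_def algebra_simps split: hm.splits)
  with False show ?thesis unfolding countermodel_def by blast
qed

definition the_model where
  "the_model = (SOME (Z, I, A, M, L, f). countermodel Z I A M L f)"

lemma the_model: "case the_model of (Z, I, A, M, L, f) \<Rightarrow> countermodel Z I A M L f"
  unfolding the_model_def by (rule someI_ex) (use ex_countermodel in auto)

definition hm_sets :: "nat \<Rightarrow> hm set" where
  "hm_sets = (case the_model of (Z, I, A, M, L, f) \<Rightarrow> f)"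

instantiation hm :: "{zero, one, plus, times, minus, ord}"
begin

definition zero_hm :: hm where "0 = (case the_model of (Z, I, A, M, L, f) \<Rightarrow> Z)"
definition one_hm :: hm where "1 = (case the_model of (Z, I, A, M, L, f) \<Rightarrow> I)"
definition plus_hm :: "hm \<Rightarrow> hm \<Rightarrow> hm" where
  "((+) :: hm \<Rightarrow> hm \<Rightarrow> hm) = (case the_model of (Z, I, A, M, L, f) \<Rightarrow> A)"
definition times_hm :: "hm \<Rightarrow> hm \<Rightarrow> hm" where
  "((*) :: hm \<Rightarrow> hm \<Rightarrow> hm) = (case the_model of (Z, I, A, M, L, f) \<Rightarrow> M)"
definition less_hm :: "hm \<Rightarrow> hm \<Rightarrow> bool" where
  "((<) :: hm \<Rightarrow> hm \<Rightarrow> bool) = (case the_model of (Z, I, A, M, L, f) \<Rightarrow> L)"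
text \<open>The signature has neither \<le> nor subtraction; both are recovered from addition,
  subtraction being cut off at 0 as the class demands.\<close>

definition less_eq_hm :: "hm \<Rightarrow> hm \<Rightarrow> bool" where "(x :: hm) \<le> y \<longleftrightarrow> (\<exists>k. y = x + k)"
definition minus_hm :: "hm \<Rightarrow> hm \<Rightarrow> hm" where
  "(x :: hm) - y = (if y \<le> x then THE k. x = y + k else 0)"

instance ..

end

lemma countermodel_hm: "countermodel (0 :: hm) 1 (+) (*) (<) hm_sets"
proof -
  obtain Z I A M L f where eq: "the_model = (Z, I, A, M, L, f)" by (cases the_model)
  have "countermodel Z I A M L f" using the_model unfolding eq by simp
  then show ?thesis
    unfolding zero_hm_def one_hm_def plus_hm_def times_hm_def less_hm_def hm_sets_def eq by simp
qed

instance hm :: disc_semidom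
proof
  have "arith (0 :: hm) 1 (+) (*) (<)" using countermodel_hm by (simp add: countermodel_def)
  note assoc = arith.assoc[OF this] and comm = arith.comm[OF this] and zero = arith.zero[OF this]
    and massoc = arith.mult_assoc[OF this] and mcomm = arith.mult_comm[OF this]
    and one = arith.one[OF this] and mzero = arith.mult_zero[OF this]
    and distrib = arith.distrib[OF this] and succ = arith.succ[OF this]
    and cases = arith.cases[OF this] and less = arith.less[OF this] and total = arith.total[OF this]
    and D = arith.cancel[OF this]
  have cancel: "x + z = y + z \<longleftrightarrow> x = y" for x y z :: hm using D by blast
  have cancel': "z + x = z + y \<longleftrightarrow> x = y" for x y z :: hm using cancel comm by metis
  have zero': "0 + x = x" for x :: hm using zero[of x] comm[of x 0] by simp
  have le_add: "x \<le> x + y" for x y :: hm by (auto simp: less_eq_hm_def)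
  have le_cases: "x \<le> y \<or> y \<le> x" for x y :: hm
    using total[of y x] by (auto simp: less_eq_hm_def)
  have sum0: "x + y = 0 \<longleftrightarrow> x = 0 \<and> y = 0" for x y :: hm
    using cases[of y] succ[of "x + z" for z] zero assoc by metis
  have minus: "(x + y) - x = y" for x y :: hm
    by (auto simp: minus_hm_def less_eq_hm_def cancel')
  have minus': "x - y = 0" if "\<not> y \<le> x" for x y :: hm
    using that by (simp add: minus_hm_def)
  have le_antisym: "x = y" if "x \<le> y" "y \<le> x" for x y :: hm
  proof -
    obtain k l where "y = x + k" "x = y + l" using \<open>x \<le> y\<close> \<open>y \<le> x\<close> by (auto simp: less_eq_hm_def)
    then have "x + 0 = x + (k + l)" by (metis assoc zero)
    then show ?thesis using \<open>y = x + k\<close> sum0 zero by (metis cancel')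
  qed
  have less_le: "x < y \<longleftrightarrow> x \<le> y \<and> x \<noteq> y" for x y :: hm
  proof
    assume "x < y"
    then obtain k where k: "y = x + (k + 1)" using less assoc by metis
    moreover have "x \<noteq> y" using k cancel'[of x 0 "k + 1"] succ[of k] zero by metis
    ultimately show "x \<le> y \<and> x \<noteq> y" by (auto simp: less_eq_hm_def)
  next
    assume "x \<le> y \<and> x \<noteq> y"
    then obtain k where "y = x + k" by (auto simp: less_eq_hm_def)
    moreover from this have "k \<noteq> 0" using \<open>x \<le> y \<and> x \<noteq> y\<close> zero by auto
    ultimately show "x < y" using cases[of k] less assoc by metis
  qed
  fix a b c x y z :: hm
  show "a + b + c = a + (b + c)" by (rule assoc)
  show "a + b = b + a" by (rule comm)
  show "0 + a = a" using zero comm by metis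
  show "a * b * c = a * (b * c)" by (rule massoc)
  show "a * b = b * a" by (rule mcomm)
  show "1 * a = a" using one mcomm by metis
  show "(a + b) * c = a * c + b * c" using distrib mcomm by metis
  show "a * (b + c) = a * b + a * c" by (rule distrib)
  show "a + b - a = b" by (rule minus)
  show "a - b - c = a - (b + c)"
  proof (cases "b + c \<le> a")
    case True
    then obtain k where "a = b + (c + k)" by (auto simp: less_eq_hm_def assoc)
    then show ?thesis by (metis minus assoc)
  next
    case False
    show ?thesis
    proof (cases "b \<le> a")
      case True
      then obtain k where k: "a = b + k" by (auto simp: less_eq_hm_def)
      with False have "\<not> c \<le> k" by (auto simp: less_eq_hm_def assoc)
      then show ?thesis using False k by (simp add: minus minus')
    next
      case b: False
      have "0 - c = 0" by (cases "c \<le> 0") (auto simp: minus' less_eq_hm_def sum0 minus_hm_def)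
      with b False show ?thesis by (simp add: minus')
    qed
  qed
  show "0 * a = 0" "a * 0 = 0" using mzero mcomm by metis+
  show "(0 :: hm) \<noteq> 1" using succ[of 0] zero comm by metis
  have mult_less: "c * a < c * b" if "a < b" "0 < c" for a b c :: hm
  proof -
    obtain k where "b = (a + k) + 1" using \<open>a < b\<close> less by blast
    moreover obtain l where "c = (0 + l) + 1" using \<open>0 < c\<close> less by blast
    ultimately have "b = a + (k + 1)" "c = l + 1" using zero' by (simp_all add: assoc)
    then have "c * b = (c * a + (c * k + l)) + 1" by (simp add: distrib one assoc)
    then show ?thesis using less by blast
  qed
  show "x * (y - z) = x * y - x * z"
  proof (cases "z \<le> y")
    case True
    then obtain k where "y = z + k" by (auto simp: less_eq_hm_def)
    then show ?thesis by (simp add: minus distrib)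
  next
    case False
    then have "y < z" using le_cases[of y z] less_le by auto
    show ?thesis
    proof (cases "x = 0")
      case True
      have "(0 :: hm) - 0 = 0" using minus[of 0 0] zero by simp
      with True show ?thesis using mzero[of y] mzero[of z] mzero[of "y - z"] by (simp add: mcomm[of 0])
    next
      case x: False
      have "0 < x" unfolding less_le using x le_add[of 0 x] zero'[of x] by simp
      with \<open>y < z\<close> have "x * y < x * z" by (rule mult_less)
      then have "\<not> x * z \<le> x * y" using less_le le_antisym by blast
      then show ?thesis using False by (simp add: minus' mzero)
    qed
  qed
  show "a \<le> a" using le_add[of a 0] zero[of a] by simp
  show "a \<le> c" if "a \<le> b" "b \<le> c" using that by (auto simp: less_eq_hm_def assoc)
  show "a = b" if "a \<le> b" "b \<le> a" using that by (rule le_antisym)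
  show "a < b \<longleftrightarrow> a \<le> b \<and> \<not> b \<le> a" using less_le le_antisym by blast
  show "a \<le> b \<or> b \<le> a" by (rule le_cases)
  show "c + a \<le> c + b" if "a \<le> b" using that by (auto simp: less_eq_hm_def assoc)
  show "c * a < c * b" if "a < b" "0 < c" using that by (rule mult_less)
  show "a \<le> b \<longleftrightarrow> (\<exists>c. b = a + c)" by (rule less_eq_hm_def)
  show "(0 :: hm) < 1" unfolding less_le using le_add[of 0 1] zero'[of 1] succ[of 0] by auto
  show "a - b + b = a" if "b \<le> a"
    using that minus comm[of _ b] by (auto simp: less_eq_hm_def)
  show "a * b \<noteq> 0" if ab: "a \<noteq> 0" "b \<noteq> 0"
  proof -
    obtain k l where "a = k + 1" "b = l + 1" using ab cases[of a] cases[of b] by blast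
    then have "a * b = (a * l + k) + 1" by (simp add: distrib one assoc)
    then show ?thesis using succ by simp
  qed
  show "a + 1 \<le> b" if ab: "a < b"
  proof -
    obtain k where "b = (a + k) + 1" using ab less by blast
    then have "b = (a + 1) + k" using assoc comm[of k 1] by simp
    then show ?thesis by (simp add: le_add)
  qed
qed

section \<open>Recursive terms and predicates\<close>

locale rca = rca_struct 0 1 "(+)" "(*)" "(<)" f
  for f :: "nat \<Rightarrow> 'm::{disc_semidom,countable} set"
begin

lemma D_subst:
  assumes "D n Q" "\<And>i. i < n \<Longrightarrow> T m (\<tau> i)"
  shows "D m (\<lambda>e. Q (\<lambda>i. \<tau> i e))"
proof -
  from assms(1) obtain p where p: "bounded p" "\<And>e. Q e \<longleftrightarrow> sat (env n e) f p" unfolding D_def by blast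
  from assms(2) obtain t where t: "\<And>i e. i < n \<Longrightarrow> \<tau> i e = eval (env m e) (t i)"
    unfolding T_def by metis
  define \<sigma> where "\<sigma> i = (if i < n then t i else Var (m + (i - n)))" for i
  have "env n (\<lambda>i. \<tau> i e) = (\<lambda>i. eval (env m e) (\<sigma> i))" for e
    by (auto simp: fun_eq_iff \<sigma>_def env_def t[unfolded env_def])
  then have "Q (\<lambda>i. \<tau> i e) \<longleftrightarrow> sat (env m e) f (subst \<sigma> id p)" for e
    by (simp add: p(2) sat_subst)
  then show ?thesis unfolding D_def using bounded_subst[OF p(1)] by blast
qed

lemma D_ex:
  assumes "T n g" "D (Suc n) (\<lambda>e. P (e 0) (\<lambda>i. e (Suc i)))"
  shows "D n (\<lambda>e. \<exists>x. x < g e \<and> P x e)"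
proof -
  have "D n (\<lambda>e. \<not> (\<forall>x. x < g e \<longrightarrow> \<not> P x e))"
    by (rule D_not, rule D_all[OF assms(1)], rule D_not, rule assms(2))
  then show ?thesis by simp
qed

lemma case_nat_eta [simp]: "case_nat (e 0) (\<lambda>i. e (Suc i)) = e"
  by (rule ext) (simp split: nat.split)

text \<open>Reading the witness as a bound on a witness makes the matrix monotone in it. Two
  witnesses can then be merged by passing to a larger one, with no need for pairing.\<close>

lemma S1E:
  assumes "S1 n P"
  obtains K where "D (Suc n) (\<lambda>e. K (e 0) (\<lambda>i. e (Suc i)))" "\<And>e. P e \<longleftrightarrow> (\<exists>x. K x e)"
    "\<And>x y e. K x e \<Longrightarrow> x \<le> y \<Longrightarrow> K y e"
proof -
  from assms obtain Q where Q: "D (Suc n) Q" "\<And>e. P e \<longleftrightarrow> (\<exists>x. Q (case_nat x e))"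
    unfolding S1_def by blast
  define K where "K w e \<longleftrightarrow> (\<exists>x. x < w \<and> Q (case_nat x e))" for w e
  have "D (Suc (Suc n)) (\<lambda>e. Q (\<lambda>i. e (if i = 0 then 0 else Suc i)))"
    by (rule D_subst[OF Q(1)]) (auto intro: T_var)
  then have "D (Suc (Suc n)) (\<lambda>e. Q (case_nat (e 0) (\<lambda>i. e (Suc (Suc i)))))"
  proof -
    have "(\<lambda>i. e (if i = 0 then 0 else Suc i)) = case_nat (e 0) (\<lambda>i. e (Suc (Suc i)))" for e :: "nat \<Rightarrow> 'm"
      by (rule ext) (simp split: nat.split)
    then show ?thesis using \<open>D (Suc (Suc n)) (\<lambda>e. Q (\<lambda>i. e (if i = 0 then 0 else Suc i)))\<close> by simp
  qed
  then have "D (Suc n) (\<lambda>e. K (e 0) (\<lambda>i. e (Suc i)))"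
    unfolding K_def by (intro D_ex T_var) simp_all
  moreover have "P e \<longleftrightarrow> (\<exists>w. K w e)" for e
    unfolding Q(2) K_def using less_add_one by blast
  moreover have "K y e" if "K x e" "x \<le> y" for x y e
    using that unfolding K_def by (meson less_le_trans)
  ultimately show ?thesis by (rule that)
qed

lemma S1I:
  "D (Suc n) (\<lambda>e. K (e 0) (\<lambda>i. e (Suc i))) \<Longrightarrow> (\<And>e. P e \<longleftrightarrow> (\<exists>x. K x e)) \<Longrightarrow> S1 n P"
  unfolding S1_def by (intro exI[of _ "\<lambda>e. K (e 0) (\<lambda>i. e (Suc i))"]) simp

lemma S1_ren:
  assumes "S1 n P" "\<And>i. i < n \<Longrightarrow> T m (\<tau> i)"
  shows "S1 m (\<lambda>e. P (\<lambda>i. \<tau> i e))"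
proof (rule S1E[OF assms(1)])
  fix K assume K: "D (Suc n) (\<lambda>e. K (e 0) (\<lambda>i. e (Suc i)))" "\<And>e. P e \<longleftrightarrow> (\<exists>x. K x e)"
  have lift: "T (Suc m) (\<lambda>e. g (\<lambda>i. e (Suc i)))" if g: "T m g" for g
  proof -
    from g obtain t where t: "\<And>e. g e = eval (env m e) t" unfolding T_def by blast
    have "g (\<lambda>i. e (Suc i)) = eval (env (Suc m) e) (lift_tm t)" for e
      using env_Suc[of m "e 0" "\<lambda>i. e (Suc i)"] by (simp add: t eval_subst)
    then show ?thesis unfolding T_def by blast
  qed
  have "D (Suc m) (\<lambda>e. (\<lambda>e'. K (e' 0) (\<lambda>i. e' (Suc i)))
    (\<lambda>i. (case i of 0 \<Rightarrow> (\<lambda>e. e 0) | Suc i \<Rightarrow> (\<lambda>e. \<tau> i (\<lambda>j. e (Suc j)))) e))"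
    by (rule D_subst[OF K(1)]) (auto split: nat.split intro: T_var lift assms(2))
  then have "D (Suc m) (\<lambda>e. K (e 0) (\<lambda>i. \<tau> i (\<lambda>j. e (Suc j))))" by simp
  then show ?thesis by (rule S1I[where K = "\<lambda>x e. K x (\<lambda>i. \<tau> i e)"]) (rule K(2))
qed

lemma S1_and: assumes "S1 n P" "S1 n Q" shows "S1 n (\<lambda>e. P e \<and> Q e)"
proof (rule S1E[OF assms(1)], rule S1E[OF assms(2)])
  fix K L
  assume K: "D (Suc n) (\<lambda>e. K (e 0) (\<lambda>i. e (Suc i)))" "\<And>e. P e \<longleftrightarrow> (\<exists>x. K x e)"
    "\<And>x y e. K x e \<Longrightarrow> x \<le> y \<Longrightarrow> K y e"
    and L: "D (Suc n) (\<lambda>e. L (e 0) (\<lambda>i. e (Suc i)))" "\<And>e. Q e \<longleftrightarrow> (\<exists>x. L x e)"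
    "\<And>x y e. L x e \<Longrightarrow> x \<le> y \<Longrightarrow> L y e"
  show ?thesis
    by (rule S1I[OF D_and[OF K(1) L(1)]]) (metis K(2,3) L(2,3) linear)
qed

lemma S1_or: assumes "S1 n P" "S1 n Q" shows "S1 n (\<lambda>e. P e \<or> Q e)"
proof (rule S1E[OF assms(1)], rule S1E[OF assms(2)])
  fix K L
  assume K: "D (Suc n) (\<lambda>e. K (e 0) (\<lambda>i. e (Suc i)))" "\<And>e. P e \<longleftrightarrow> (\<exists>x. K x e)"
    and L: "D (Suc n) (\<lambda>e. L (e 0) (\<lambda>i. e (Suc i)))" "\<And>e. Q e \<longleftrightarrow> (\<exists>x. L x e)"
  show ?thesis by (rule S1I[OF D_or[OF K(1) L(1)]]) (auto simp: K(2) L(2))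
qed

lemma D_swap:
  assumes "D (Suc (Suc n)) (\<lambda>e. K (e 0) (\<lambda>i. e (Suc i)))"
  shows "D (Suc (Suc n)) (\<lambda>e. K (e (Suc 0)) (case_nat (e 0) (\<lambda>i. e (Suc (Suc i)))))"
proof -
  have "D (Suc (Suc n)) (\<lambda>e. (\<lambda>e. K (e 0) (\<lambda>i. e (Suc i)))
      (\<lambda>i. e (if i = 0 then 1 else if i = 1 then 0 else i)))"
    by (rule D_subst[OF assms]) (rule T_var, auto)
  then have "D (Suc (Suc n)) (\<lambda>e. K (e (Suc 0)) (\<lambda>i. e (if i = 0 then 0 else Suc i)))" by simp
  moreover have "(\<lambda>i. e (if i = 0 then 0 else Suc i)) = case_nat (e 0) (\<lambda>i. e (Suc (Suc i)))" for e :: "nat \<Rightarrow> 'm"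
    by (rule ext) (simp split: nat.split)
  ultimately show ?thesis by simp
qed

lemma S1_ex:
  assumes "S1 (Suc n) (\<lambda>e. P (e 0) (\<lambda>i. e (Suc i)))" shows "S1 n (\<lambda>e. \<exists>x. P x e)"
proof (rule S1E[OF assms])
  fix K
  assume K: "D (Suc (Suc n)) (\<lambda>e. K (e 0) (\<lambda>i. e (Suc i)))"
    "\<And>e. P (e 0) (\<lambda>i. e (Suc i)) \<longleftrightarrow> (\<exists>x. K x e)" "\<And>x y e. K x e \<Longrightarrow> x \<le> y \<Longrightarrow> K y e"
  have P: "P x e \<longleftrightarrow> (\<exists>w. K w (case_nat x e))" for x e using K(2)[of "case_nat x e"] by simp
  show ?thesis
  proof (rule S1I[where K = "\<lambda>w e. \<exists>x. x < w \<and> K w (case_nat x e)"])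
    show "D (Suc n) (\<lambda>e. \<exists>x. x < e 0 \<and> K (e 0) (case_nat x (\<lambda>i. e (Suc i))))"
      by (rule D_ex) (simp_all add: T_var D_swap[OF K(1)])
    show "(\<exists>x. P x e) \<longleftrightarrow> (\<exists>w x. x < w \<and> K w (case_nat x e))" for e
    proof
      assume "\<exists>x. P x e"
      then obtain x w where "K w (case_nat x e)" using P by blast
      then have "K (x + 1 + w) (case_nat x e)" by (rule K(3)) (simp add: add_increasing)
      moreover have "x < x + 1 + w" by (simp add: less_iff_add1_le add_increasing2)
      ultimately show "\<exists>w x. x < w \<and> K w (case_nat x e)" by blast
    qed (use P in blast)
  qed
qed

text \<open>This is \<open>\<Sigma>\<^sub>1\<close> collection. Since the matrix \<open>K\<close> is
  monotone in its witness, a common witness for all \<open>x < a\<close> is found by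
  \<open>\<Sigma>\<^sub>1\<close> induction on \<open>a\<close>.\<close>

lemma S1_ball_lt:
  assumes "S1 (Suc n) (\<lambda>e. P (e 0) (\<lambda>i. e (Suc i)))"
  shows "S1 (Suc n) (\<lambda>e. \<forall>x. x < e 0 \<longrightarrow> P x (\<lambda>i. e (Suc i)))"
proof (rule S1E[OF assms])
  fix K
  assume K: "D (Suc (Suc n)) (\<lambda>e. K (e 0) (\<lambda>i. e (Suc i)))"
    "\<And>e. P (e 0) (\<lambda>i. e (Suc i)) \<longleftrightarrow> (\<exists>x. K x e)" "\<And>x y e. K x e \<Longrightarrow> x \<le> y \<Longrightarrow> K y e"
  have P: "P x e \<longleftrightarrow> (\<exists>w. K w (case_nat x e))" for x e using K(2)[of "case_nat x e"] by simp
  let ?K = "\<lambda>w e. \<forall>x. x < e 0 \<longrightarrow> K w (case_nat x (\<lambda>i. e (Suc i)))"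
  have D: "D (Suc (Suc n)) (\<lambda>e. \<forall>x. x < e (Suc 0) \<longrightarrow> K (e 0) (case_nat x (\<lambda>i. e (Suc (Suc i)))))"
  proof (rule D_all)
    have "D (Suc (Suc (Suc n))) (\<lambda>e. (\<lambda>e. K (e 0) (\<lambda>i. e (Suc i)))
        (\<lambda>i. e (if i = 0 then 1 else if i = 1 then 0 else Suc i)))"
      by (rule D_subst[OF K(1)]) (rule T_var, auto)
    then have "D (Suc (Suc (Suc n))) (\<lambda>e. K (e (Suc 0)) (\<lambda>i. e (if i = 0 then 0 else Suc (Suc i))))"
      by simp
    moreover have "(\<lambda>i. e (if i = 0 then 0 else Suc (Suc i))) = case_nat (e 0) (\<lambda>i. e (Suc (Suc (Suc i))))" for e :: "nat \<Rightarrow> 'm"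
      by (rule ext) (simp split: nat.split)
    ultimately show "D (Suc (Suc (Suc n))) (\<lambda>e. K (e (Suc 0)) (case_nat (e 0) (\<lambda>i. e (Suc (Suc (Suc i))))))"
      by simp
  qed (simp add: T_var)
  show ?thesis
  proof (rule S1I[where K = ?K])
    show "D (Suc (Suc n)) (\<lambda>e. ?K (e 0) (\<lambda>i. e (Suc i)))" by (rule D)
    fix e :: "nat \<Rightarrow> 'm"
    define e' where "e' = (\<lambda>i. e (Suc i))"
    show "(\<forall>x. x < e 0 \<longrightarrow> P x (\<lambda>i. e (Suc i))) \<longleftrightarrow> (\<exists>w. ?K w e)"
    proof
      assume all: "\<forall>x. x < e 0 \<longrightarrow> P x (\<lambda>i. e (Suc i))"
      \<comment> \<open>The guard \<open>a \<le> e 0\<close> makes the claim trivial beyond the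
        bound, so the induction can run over all numbers.\<close>
      let ?Q = "\<lambda>a. \<exists>w. a \<le> e 0 \<longrightarrow> (\<forall>x. x < a \<longrightarrow> K w (case_nat x e'))"
      have "?Q (e 0)"
      proof (rule S1_induct[of ?Q])
        have cD: "D 3 (\<lambda>d. K (d 1) (case_nat (d 0) e'))"
        proof -
          let ?\<tau> = "\<lambda>i. case i of 0 \<Rightarrow> (\<lambda>d. d 1) | Suc 0 \<Rightarrow> (\<lambda>d. d 0) | Suc (Suc i) \<Rightarrow> (\<lambda>d. e' i)"
          have "D 3 (\<lambda>d. (\<lambda>e. K (e 0) (\<lambda>i. e (Suc i))) (\<lambda>i. ?\<tau> i d))"
            by (rule D_subst[OF K(1)]) (auto intro: T_var T_const split: nat.splits)
          moreover have "(\<lambda>i. ?\<tau> (Suc i) d) = case_nat (d 0) e'" for d :: "nat \<Rightarrow> 'm"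
            by (rule ext) (simp split: nat.split)
          ultimately show ?thesis by simp
        qed
        have "D 2 (\<lambda>d. d 1 < e 0 + 1 \<longrightarrow> (\<forall>x. x < d 1 \<longrightarrow> K (d 0) (case_nat x e')))"
          by (intro D_imp D_all D_intros) (use cD in \<open>simp_all add: numeral_2_eq_2 numeral_3_eq_3\<close>)
        then show "S1 1 (\<lambda>d. ?Q (d 0))" unfolding less_add1_iff
          by (intro S1_exD) (simp add: numeral_2_eq_2)
        show "?Q 0" by auto
        fix a assume "?Q a"
        then obtain w where w: "a \<le> e 0 \<longrightarrow> (\<forall>x. x < a \<longrightarrow> K w (case_nat x e'))" ..
        show "?Q (a + 1)"
        proof (cases "a + 1 \<le> e 0")
          case True
          then have "P a e'" using all unfolding less_iff_add1_le[symmetric] e'_def by blast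
          then obtain v where "K v (case_nat a e')" using P by blast
          then have "K (max w v) (case_nat a e')" by (rule K(3)) simp
          moreover have "K (max w v) (case_nat x e')" if "x < a" for x
            using that w True K(3)[of w "case_nat x e'" "max w v"]
            by (meson less_add_one less_imp_le max.cobounded1 order_trans)
          ultimately have "\<forall>x. x < a + 1 \<longrightarrow> K (max w v) (case_nat x e')"
            by (auto simp: less_add1_iff le_less)
          then show ?thesis by blast
        qed blast
      qed
      then show "\<exists>w. ?K w e" by (auto simp: e'_def)
    next
      assume "\<exists>w. ?K w e" then show "\<forall>x. x < e 0 \<longrightarrow> P x (\<lambda>i. e (Suc i))" using P by blast
    qed
  qed
qed

section \<open>\<open>\<Delta>\<^sub>1\<close> predicates and recursive functions\<close>

definition D1 :: "nat \<Rightarrow> ((nat \<Rightarrow> 'm) \<Rightarrow> bool) \<Rightarrow> bool" where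
  "D1 n P \<longleftrightarrow> S1 n P \<and> S1 n (\<lambda>e. \<not> P e)"

definition P1 :: "nat \<Rightarrow> ((nat \<Rightarrow> 'm) \<Rightarrow> bool) \<Rightarrow> bool" where
  "P1 n P \<longleftrightarrow> S1 n (\<lambda>e. \<not> P e)"

text \<open>Recursive terms: total functions of the assignment with a
  \<open>\<Sigma>\<^sub>1\<close> graph. They may be substituted into
  \<open>\<Sigma>\<^sub>1\<close> and \<open>\<Delta>\<^sub>1\<close> predicates, because the value
  can be introduced by an existential quantifier.\<close>

definition R :: "nat \<Rightarrow> ((nat \<Rightarrow> 'm) \<Rightarrow> 'm) \<Rightarrow> bool" where
  "R n g \<longleftrightarrow> S1 (Suc n) (\<lambda>e. e 0 = g (\<lambda>i. e (Suc i)))"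

definition rec1 :: "('m \<Rightarrow> 'm) \<Rightarrow> bool" where
  "rec1 F \<longleftrightarrow> S1 2 (\<lambda>e. e 0 = F (e 1))"

definition rec2 :: "('m \<Rightarrow> 'm \<Rightarrow> 'm) \<Rightarrow> bool" where
  "rec2 F \<longleftrightarrow> S1 3 (\<lambda>e. e 0 = F (e 1) (e 2))"

lemma D_D1: "D n P \<Longrightarrow> D1 n P"
  unfolding D1_def by (auto intro: D_S1 D_not)

lemma D1_S1: "D1 n P \<Longrightarrow> S1 n P"
  by (simp add: D1_def)

lemma D1_P1: "D1 n P \<Longrightarrow> P1 n P"
  by (simp add: D1_def P1_def)

lemma S1_subst:
  assumes "S1 (Suc n) (\<lambda>e. P (e 0) (\<lambda>i. e (Suc i)))" "R n g"
  shows "S1 n (\<lambda>e. P (g e) e)"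
proof -
  have "S1 n (\<lambda>e. \<exists>x. x = g e \<and> P x e)"
    using assms by (intro S1_ex S1_and) (simp_all add: R_def)
  then show ?thesis by simp
qed

lemma R_lift: "R n g \<Longrightarrow> R (Suc n) (\<lambda>e. g (\<lambda>i. e (Suc i)))"
  unfolding R_def
  using S1_ren[of "Suc n" "\<lambda>e. e 0 = g (\<lambda>i. e (Suc i))" "Suc (Suc n)" "\<lambda>i e. e (if i = 0 then 0 else Suc i)"]
  by (simp add: T_var)

lemma S1_rel1:
  assumes "S1 1 (\<lambda>e. P (e 0))" "R n g" shows "S1 n (\<lambda>e. P (g e))"
  by (rule S1_subst[OF S1_ren[OF assms(1), of "Suc n" "\<lambda>i e. e 0"] assms(2)]) (simp add: T_var)

lemma S1_rel2:
  assumes "S1 2 (\<lambda>e. P (e 0) (e 1))" "R n g" "R n h" shows "S1 n (\<lambda>e. P (g e) (h e))"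
proof -
  have "S1 (Suc (Suc n)) (\<lambda>e. P (e 0) (e (Suc 0)))"
    by (rule S1_ren[OF assms(1), of "Suc (Suc n)" "\<lambda>i e. e i", simplified]) (simp add: T_var)
  then have "S1 (Suc n) (\<lambda>e. P (g (\<lambda>i. e (Suc i))) (e 0))"
    by (rule S1_subst[of "Suc n" "\<lambda>x e. P x (e 0)", OF _ R_lift[OF assms(2)]])
  then show ?thesis by (rule S1_subst[OF _ assms(3), of "\<lambda>x e. P (g e) x"])
qed

lemma S1_rel3:
  assumes "S1 3 (\<lambda>e. P (e 0) (e 1) (e 2))" "R n g" "R n h" "R n k"
  shows "S1 n (\<lambda>e. P (g e) (h e) (k e))"
proof -
  have "S1 (Suc (Suc (Suc n))) (\<lambda>e. P (e 0) (e (Suc 0)) (e (Suc (Suc 0))))"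
    using S1_ren[OF assms(1), of "Suc (Suc (Suc n))" "\<lambda>i e. e i"]
    by (simp add: T_var numeral_2_eq_2)
  then have "S1 (Suc (Suc n)) (\<lambda>e. P (g (\<lambda>i. e (Suc (Suc i)))) (e 0) (e (Suc 0)))"
    by (rule S1_subst[of "Suc (Suc n)" "\<lambda>x e. P x (e 0) (e (Suc 0))", OF _ R_lift[OF R_lift[OF assms(2)]]])
  then have "S1 (Suc n) (\<lambda>e. P (g (\<lambda>i. e (Suc i))) (h (\<lambda>i. e (Suc i))) (e 0))"
    by (rule S1_subst[of "Suc n" "\<lambda>x e. P (g (\<lambda>i. e (Suc i))) x (e 0)", OF _ R_lift[OF assms(3)]])
  then show ?thesis by (rule S1_subst[OF _ assms(4), of "\<lambda>x e. P (g e) (h e) x"])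
qed

lemma D1_rel1: "D1 1 (\<lambda>e. P (e 0)) \<Longrightarrow> R n g \<Longrightarrow> D1 n (\<lambda>e. P (g e))"
  using S1_rel1[of P] S1_rel1[of "\<lambda>x. \<not> P x"] by (simp add: D1_def)

lemma D1_rel2: "D1 2 (\<lambda>e. P (e 0) (e 1)) \<Longrightarrow> R n g \<Longrightarrow> R n h \<Longrightarrow> D1 n (\<lambda>e. P (g e) (h e))"
  using S1_rel2[of P] S1_rel2[of "\<lambda>x y. \<not> P x y"] by (simp add: D1_def)

lemma R_D: "D (Suc n) (\<lambda>e. e 0 = g (\<lambda>i. e (Suc i))) \<Longrightarrow> R n g"
  unfolding R_def by (rule D_S1)

lemma R_var: "i < n \<Longrightarrow> R n (\<lambda>e. e i)"
  by (rule R_D, rule D_eq) (auto intro: T_var)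

lemma R_const: "R n (\<lambda>e. c)"
  by (rule R_D, rule D_eq) (auto intro: T_var T_const)

lemma R_app1: "rec1 F \<Longrightarrow> R n g \<Longrightarrow> R n (\<lambda>e. F (g e))"
  unfolding R_def[of n "\<lambda>e. F (g e)"] rec1_def
  by (rule S1_rel2[of "\<lambda>x y. x = F y", OF _ R_var R_lift]) simp_all

lemma R_app2: "rec2 F \<Longrightarrow> R n g \<Longrightarrow> R n h \<Longrightarrow> R n (\<lambda>e. F (g e) (h e))"
  unfolding R_def[of n "\<lambda>e. F (g e) (h e)"] rec2_def
  by (rule S1_rel3[of "\<lambda>x y z. x = F y z", OF _ R_var R_lift R_lift]) simp_all

lemma R_add: "R n g \<Longrightarrow> R n h \<Longrightarrow> R n (\<lambda>e. g e + h e)"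
  by (rule R_app2[of "(+)"]) (auto simp: rec2_def intro!: D_S1 D_intros)

lemma R_mult: "R n g \<Longrightarrow> R n h \<Longrightarrow> R n (\<lambda>e. g e * h e)"
  by (rule R_app2[of "(*)"]) (auto simp: rec2_def intro!: D_S1 D_intros)

lemma D1_eq: "R n g \<Longrightarrow> R n h \<Longrightarrow> D1 n (\<lambda>e. g e = h e)"
  by (rule D1_rel2[of "\<lambda>x y. x = y"]) (auto intro!: D_D1 D_intros)

lemma D1_less: "R n g \<Longrightarrow> R n h \<Longrightarrow> D1 n (\<lambda>e. g e < h e)"
  by (rule D1_rel2[of "\<lambda>x y. x < y"]) (auto intro!: D_D1 D_intros)

lemma D1_mem: "X \<in> range f \<Longrightarrow> R n g \<Longrightarrow> D1 n (\<lambda>e. g e \<in> X)"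
  by (rule D1_rel1[of "\<lambda>x. x \<in> X"]) (auto intro!: D_D1 D_mem T_var)

lemma D1_const: "D1 n (\<lambda>e. b)"
  by (intro D_D1 D_const)

lemma D1_not: "D1 n P \<Longrightarrow> D1 n (\<lambda>e. \<not> P e)"
  by (simp add: D1_def)

lemma D1_and: "D1 n P \<Longrightarrow> D1 n Q \<Longrightarrow> D1 n (\<lambda>e. P e \<and> Q e)"
  by (simp only: D1_def de_Morgan_conj S1_and S1_or simp_thms)

lemma D1_or: "D1 n P \<Longrightarrow> D1 n Q \<Longrightarrow> D1 n (\<lambda>e. P e \<or> Q e)"
  by (simp add: D1_def S1_and S1_or)

lemma D1_imp: "D1 n P \<Longrightarrow> D1 n Q \<Longrightarrow> D1 n (\<lambda>e. P e \<longrightarrow> Q e)"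
  by (simp only: imp_conv_disj D1_or D1_not)

lemma D1_iff: "D1 n P \<Longrightarrow> D1 n Q \<Longrightarrow> D1 n (\<lambda>e. P e \<longleftrightarrow> Q e)"
  unfolding iff_conv_conj_imp by (intro D1_and D1_imp)

lemma D1_le: "R n g \<Longrightarrow> R n h \<Longrightarrow> D1 n (\<lambda>e. g e \<le> h e)"
  using D1_not[OF D1_less[of n h g]] by (simp add: not_less)

lemma S1_ball:
  "R n g \<Longrightarrow> S1 (Suc n) (\<lambda>e. P (e 0) (\<lambda>i. e (Suc i))) \<Longrightarrow> S1 n (\<lambda>e. \<forall>x. x < g e \<longrightarrow> P x e)"
  using S1_subst[of n "\<lambda>z e. \<forall>x. x < z \<longrightarrow> P x e" g] S1_ball_lt[of n P] by simp

lemma S1_bex: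
  assumes "R n g" "S1 (Suc n) (\<lambda>e. P (e 0) (\<lambda>i. e (Suc i)))"
  shows "S1 n (\<lambda>e. \<exists>x. x < g e \<and> P x e)"
  using assms by (intro S1_ex S1_and D1_S1[OF D1_less] R_var R_lift) auto

lemma D1_ball:
  "R n g \<Longrightarrow> D1 (Suc n) (\<lambda>e. P (e 0) (\<lambda>i. e (Suc i))) \<Longrightarrow> D1 n (\<lambda>e. \<forall>x. x < g e \<longrightarrow> P x e)"
  using S1_ball[of n g P] S1_bex[of n g "\<lambda>x e. \<not> P x e"] by (simp add: D1_def)

lemma D1_bex:
  "R n g \<Longrightarrow> D1 (Suc n) (\<lambda>e. P (e 0) (\<lambda>i. e (Suc i))) \<Longrightarrow> D1 n (\<lambda>e. \<exists>x. x < g e \<and> P x e)"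
  using D1_not[OF D1_ball[of n g "\<lambda>x e. \<not> P x e"]] D1_not[of "Suc n" "\<lambda>e. P (e 0) (\<lambda>i. e (Suc i))"]
  by simp

lemma D1_ball_le:
  "R n g \<Longrightarrow> D1 (Suc n) (\<lambda>e. P (e 0) (\<lambda>i. e (Suc i))) \<Longrightarrow> D1 n (\<lambda>e. \<forall>x. x \<le> g e \<longrightarrow> P x e)"
  using D1_ball[OF R_add[OF _ R_const[of _ 1]], of n g P] by (simp add: less_add1_iff)

lemma D1_bex_le:
  "R n g \<Longrightarrow> D1 (Suc n) (\<lambda>e. P (e 0) (\<lambda>i. e (Suc i))) \<Longrightarrow> D1 n (\<lambda>e. \<exists>x. x \<le> g e \<and> P x e)"
  using D1_bex[OF R_add[OF _ R_const[of _ 1]], of n g P] by (simp add: less_add1_iff)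

lemma S1_ball_le:
  "R n g \<Longrightarrow> S1 (Suc n) (\<lambda>e. P (e 0) (\<lambda>i. e (Suc i))) \<Longrightarrow> S1 n (\<lambda>e. \<forall>x. x \<le> g e \<longrightarrow> P x e)"
  using S1_ball[OF R_add[OF _ R_const[of _ 1]], of n g P] by (simp add: less_add1_iff)

lemma D1_dvd: "R n g \<Longrightarrow> R n h \<Longrightarrow> D1 n (\<lambda>e. g e dvd h e)"
proof (rule D1_rel2[of "\<lambda>x y. x dvd y"])
  \<comment> \<open>The cofactor must be bounded to make divisibility
    \<open>\<Delta>\<^sub>1\<close>. For \<open>x = 0\<close> any cofactor works, and 0 is within
    the bound.\<close>
  have "x dvd y \<longleftrightarrow> (\<exists>z. z \<le> y \<and> y = x * z)" for x y :: 'm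
  proof
    assume "x dvd y"
    then obtain z where z: "y = x * z" ..
    show "\<exists>z. z \<le> y \<and> y = x * z"
    proof (cases "x = 0")
      case False
      then have "1 * z \<le> x * z" by (intro mult_right_mono) (simp_all add: pos_imp_ge1 zero_less_iff_neq_zero)
      then show ?thesis using z by auto
    qed (use z in \<open>auto intro: exI[of _ 0]\<close>)
  qed auto
  then show "D1 2 (\<lambda>e. e 0 dvd e 1)"
    by (simp only:) (intro D1_bex_le D1_eq R_mult R_var; simp)
qed

lemmas rec_intros = D1_const D1_and D1_or D1_not D1_imp D1_iff D1_ball D1_bex D1_ball_le D1_bex_le
  D1_eq D1_less D1_le D1_dvd D1_mem R_const R_var R_add R_mult

lemma rec1I: "R 1 (\<lambda>e. F (e 0)) \<Longrightarrow> rec1 F"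
  by (simp add: R_def rec1_def numeral_2_eq_2)

lemma rec2I: "R 2 (\<lambda>e. F (e 0) (e 1)) \<Longrightarrow> rec2 F"
  by (simp add: R_def rec2_def numeral_2_eq_2 numeral_3_eq_3)

section \<open>Comprehension, induction, and least number principles\<close>

lemma comprehension_D1: "D1 1 (\<lambda>e. P (e 0)) \<Longrightarrow> {x. P x} \<in> range f"
  by (rule comprehension) (simp_all add: D1_def)

text \<open>Run \<open>\<Sigma>\<^sub>1\<close> induction downwards from a counterexample
  \<open>a\<close>: if \<open>P\<close> fails at \<open>a - x\<close>, it fails at
  \<open>a - (x + 1)\<close>. After \<open>a\<close> steps it would fail at 0.\<close>

lemma P1_induct:
  assumes P: "P1 1 (\<lambda>e. P (e 0))" and "P 0" and "\<And>x. P x \<Longrightarrow> P (x + 1)"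
  shows "P a"
proof (rule ccontr)
  assume "\<not> P a"
  let ?Q = "\<lambda>x. a < x \<or> (\<exists>y. x + y = a \<and> \<not> P y)"
  have "?Q a"
  proof (rule S1_induct[of ?Q])
    have "S1 1 (\<lambda>e. \<not> P (e 0))" using P by (simp add: P1_def)
    then have "S1 2 (\<lambda>e. \<not> P (e 0))" by (rule S1_rel1[of "\<lambda>x. \<not> P x"]) (simp add: R_var)
    moreover have "S1 2 (\<lambda>e. e (Suc 0) + e 0 = a)" by (intro D1_S1 rec_intros) auto
    moreover have "S1 1 (\<lambda>e. a < e 0)" by (intro D1_S1 rec_intros) auto
    ultimately show "S1 1 (\<lambda>e. ?Q (e 0))"
      by (intro S1_or S1_ex S1_and) (simp_all add: numeral_2_eq_2)
    show "?Q 0" using \<open>\<not> P a\<close> by simp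
    fix x assume "?Q x"
    then show "?Q (x + 1)"
    proof
      assume "a < x" then show ?thesis using less_add_one[of x] by (meson less_trans)
    next
      assume "\<exists>y. x + y = a \<and> \<not> P y"
      then obtain y where y: "x + y = a" "\<not> P y" by blast
      then obtain z where "y = z + 1" using zero_or_add1[of y] \<open>P 0\<close> by blast
      then have "x + 1 + z = a" using y(1) by (simp add: ac_simps)
      moreover have "\<not> P z" using y(2) assms(3)[of z] \<open>y = z + 1\<close> by blast
      ultimately show ?thesis by blast
    qed
  qed
  then show False using \<open>P 0\<close> by auto
qed

lemma D1_induct: "D1 1 (\<lambda>e. P (e 0)) \<Longrightarrow> P 0 \<Longrightarrow> (\<And>x. P x \<Longrightarrow> P (x + 1)) \<Longrightarrow> P a"
  by (rule P1_induct[OF D1_P1])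

lemma S1_least:
  assumes P: "S1 1 (\<lambda>e. P (e 0))" and x: "P x"
  shows "\<exists>y. P y \<and> (\<forall>z<y. \<not> P z)"
proof (rule ccontr)
  assume no: "\<not> ?thesis"
  have "\<forall>z. z < x + 1 \<longrightarrow> \<not> P z"
  proof (rule P1_induct[of "\<lambda>x. \<forall>z. z < x \<longrightarrow> \<not> P z"])
    have "S1 (Suc 1) (\<lambda>e. P (e 0))" using P by (rule S1_rel1) (simp add: R_var)
    then have "S1 1 (\<lambda>e. \<exists>z. z < e 0 \<and> P z)" by (intro S1_bex R_var) simp_all
    then show "P1 1 (\<lambda>e. \<forall>z. z < e 0 \<longrightarrow> \<not> P z)" by (simp add: P1_def)
  qed (use no in \<open>auto simp: less_add1_iff le_less\<close>)
  then show False using x less_add_one by blast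
qed

text \<open>The greatest element up to \<open>n\<close> is the one of least distance
  \<open>k\<close> to \<open>n\<close>.\<close>

lemma S1_greatest:
  assumes P: "S1 1 (\<lambda>e. P (e 0))" and x: "P x" "x \<le> n"
  shows "\<exists>y. P y \<and> y \<le> n \<and> (\<forall>z. P z \<longrightarrow> z \<le> n \<longrightarrow> z \<le> y)"
proof -
  from x(2) obtain k where "x + k = n" by (metis le_iff_add)
  then have "\<exists>k. (\<exists>y. P y \<and> y + k = n) \<and> (\<forall>z<k. \<not> (\<exists>y. P y \<and> y + z = n))"
    using x(1)
  proof (intro S1_least[of "\<lambda>k. \<exists>y. P y \<and> y + k = n" k])
    have "S1 (Suc 1) (\<lambda>e. P (e 0))" using P by (rule S1_rel1) (simp add: R_var)
    moreover have "S1 (Suc 1) (\<lambda>e. e 0 + e (Suc 0) = n)" by (intro D1_S1 rec_intros) auto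
    ultimately show "S1 1 (\<lambda>e. \<exists>y. P y \<and> y + e 0 = n)"
      by (intro S1_ex S1_and) simp_all
  qed blast
  then obtain k y where y: "P y" "y + k = n" "\<forall>z<k. \<not> (\<exists>y. P y \<and> y + z = n)" by blast
  have "z \<le> y" if "P z" "z \<le> n" for z
  proof (rule ccontr)
    assume "\<not> z \<le> y"
    obtain l where l: "z + l = n" using \<open>z \<le> n\<close> by (metis le_iff_add)
    then have "l < k" using \<open>\<not> z \<le> y\<close> y(2) by (metis add_mono linear not_le add_less_le_mono less_irrefl)
    then show False using y(3) l \<open>P z\<close> by blast
  qed
  then show ?thesis using y by (metis le_iff_add)
qed

lemma D1_strong_induct:
  assumes "D1 1 (\<lambda>e. P (e 0))" and "\<And>x. (\<And>y. y < x \<Longrightarrow> P y) \<Longrightarrow> P x"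
  shows "P x"
  using S1_least[of "\<lambda>x. \<not> P x" x] assms by (auto simp: D1_def)

end

section \<open>Pairs, codes of finite sets, and recursion\<close>

context disc_semidom
begin

definition pr :: "'a \<Rightarrow> 'a \<Rightarrow> 'a" where
  "pr x y = (x + y) * (x + y) + x"

lemma le_square: "x \<le> x * x"
proof (cases "x = 0")
  case False
  then have "1 \<le> x" using pos_imp_ge1 zero_less_iff_neq_zero by blast
  from mult_left_mono[OF this, of x] show ?thesis by simp
qed simp

lemma le_pr1: "x \<le> pr x y"
  unfolding pr_def by (rule le_add_same_cancel2[THEN iffD2]) simp

lemma le_pr2: "y \<le> pr x y"
proof -
  have "y \<le> x + y" by simp
  also have "\<dots> \<le> pr x y" unfolding pr_def using le_square add_increasing2 zero_le by blast
  finally show ?thesis .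
qed

text \<open>For \<open>x \<le> s\<close> the code \<open>s * s + x\<close> is below
  \<open>(s + 1) * (s + 1)\<close>, so the code determines the sum \<open>s\<close> of the two
  components.\<close>

lemma pr_eq_imp_le: assumes "pr x y = pr x' y'" shows "x + y \<le> x' + y'"
proof (rule ccontr)
  assume "\<not> ?thesis"
  then have "x' + y' + 1 \<le> x + y" by (simp add: less_iff_add1_le not_le)
  then have "(x' + y' + 1) * (x' + y' + 1) \<le> (x + y) * (x + y)" by (intro mult_mono) simp_all
  also have "\<dots> \<le> pr x y" by (simp add: pr_def)
  finally have "pr x' y' + (x' + y' + 1 + y') \<le> pr x y" by (simp add: pr_def algebra_simps)
  then have "pr x' y' + (x' + y' + 1 + y') \<le> pr x' y' + 0" using assms by simp
  then show False by (simp only: add_le_cancel_left) simp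
qed

lemma pr_eq_iff [simp]: "pr x y = pr x' y' \<longleftrightarrow> x = x' \<and> y = y'"
proof
  assume eq: "pr x y = pr x' y'"
  from pr_eq_imp_le[OF eq] pr_eq_imp_le[OF eq[symmetric]] have s: "x + y = x' + y'"
    by (rule order.antisym)
  with eq have "x = x'" by (simp add: pr_def)
  with s show "x = x' \<and> y = y'" by simp
qed simp

text \<open>The number \<open>p = 1 + k * v\<close> is coprime to \<open>v\<close>, so a factor
  \<open>v\<close> can be cancelled. The factor \<open>d\<close> is removed by completing it to
  \<open>v = d * z\<close> and cancelling once more; neither primes nor common divisors have to be
  developed.\<close>

lemma dvd_cancel_coprime:
  assumes v: "v = d * z" and f: "1 + k * v = p" and dvd: "p dvd u * (d * v)"
  shows "p dvd u"
proof -
  have cancel: "p dvd a" if "p dvd a * v" for a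
  proof -
    have "p dvd a * (k * v)" using dvd_mult[OF that, of k] by (simp add: ac_simps)
    moreover have "a * (k * v) + a = p * a" unfolding f[symmetric] by (simp add: algebra_simps)
    then have "p dvd a * (k * v) + a" by simp
    ultimately show ?thesis by (simp add: dvd_add_right_iff)
  qed
  have "p dvd u * d" using dvd by (intro cancel[of "u * d"]) (simp only: mult.assoc)
  then have "p dvd u * v" unfolding v mult.assoc[symmetric] by (rule dvd_mult2)
  then show ?thesis by (rule cancel)
qed

text \<open>The moduli of Goedel's beta function are coprime: two of them differ by
  \<open>d * v\<close>, where \<open>d\<close> is the difference of their indices and divides
  \<open>v\<close>.\<close>

lemma code_factor:
  assumes v: "\<And>d. 0 < d \<Longrightarrow> d \<le> w \<Longrightarrow> d dvd v" and xy: "x < w" "y < w" "x \<noteq> y"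
    and dvd: "(1 + (x + 1) * v) dvd u * (1 + (y + 1) * v)"
  shows "(1 + (x + 1) * v) dvd u"
proof -
  have mult_lt: "\<exists>d z. y = x + d \<and> v = d * z" if lt: "x < y" "y < w" for x y
  proof -
    from less_imp_le[OF lt(1)] obtain d where d: "y = x + d" unfolding le_iff_add by blast
    have "d \<le> y" unfolding d by simp
    then have "d \<le> w" using lt(2) by (meson le_less_trans less_imp_le)
    moreover have "0 < d" using lt(1) d by (auto simp: zero_less_iff_neq_zero)
    ultimately show ?thesis using v[of d] d by (auto simp: dvd_def)
  qed
  show ?thesis
  proof (cases "x < y")
    case True
    then obtain d z where d: "y = x + d" "v = d * z" using mult_lt xy by blast
    have "u * (1 + (y + 1) * v) = u * (1 + (x + 1) * v) + u * (d * v)"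
      unfolding d(1) by (simp add: algebra_simps)
    then have "(1 + (x + 1) * v) dvd u * (d * v)" using dvd by (simp add: dvd_add_right_iff)
    then show ?thesis by (rule dvd_cancel_coprime[OF d(2) refl])
  next
    case False
    then have "y < x" using xy(3) by (auto simp: neq_iff)
    then obtain d z where d: "x = y + d" "v = d * z" using mult_lt xy(1) by blast
    have "u * (1 + (x + 1) * v) = u * (1 + (y + 1) * v) + u * (d * v)"
      unfolding d(1) by (simp add: algebra_simps)
    moreover have "(1 + (x + 1) * v) dvd u * (1 + (x + 1) * v)" by simp
    ultimately have "(1 + (x + 1) * v) dvd u * (d * v)" using dvd by (metis dvd_add_right_iff)
    then show ?thesis by (rule dvd_cancel_coprime[OF d(2) refl])
  qed
qed

text \<open>The triple \<open>(u, v, w)\<close> codes a finite set of numbers below \<open>w\<close>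
  by divisibility of \<open>u\<close> by Goedel's moduli.\<close>

definition cmem :: "'a \<Rightarrow> 'a \<Rightarrow> 'a \<Rightarrow> 'a \<Rightarrow> bool" where
  "cmem z u v w \<longleftrightarrow> z < w \<and> (1 + (z + 1) * v) dvd u"

end

context rca
begin

lemma R_pr: "R n g \<Longrightarrow> R n h \<Longrightarrow> R n (\<lambda>e. pr (g e) (h e))"
  unfolding pr_def by (intro R_add R_mult)

lemma D1_cmem:
  "R n g \<Longrightarrow> R n h \<Longrightarrow> R n k \<Longrightarrow> R n l \<Longrightarrow> D1 n (\<lambda>e. cmem (g e) (h e) (k e) (l e))"
  unfolding cmem_def by (intro rec_intros)

lemmas rec_intros' = rec_intros R_pr D1_cmem

definition graph :: "('m \<Rightarrow> 'm) \<Rightarrow> 'm set" where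
  "graph F = {z. \<exists>x\<le>z. z = pr x (F x)}"

lemma pr_graph [simp]: "pr x y \<in> graph F \<longleftrightarrow> F x = y"
  unfolding graph_def using le_pr1 by auto

text \<open>For a total function a \<open>\<Sigma>\<^sub>1\<close> graph is already
  \<open>\<Delta>\<^sub>1\<close>, so comprehension provides it as a set of the model.\<close>

lemma rec1_graph: "rec1 F \<longleftrightarrow> graph F \<in> range f"
proof
  assume "rec1 F"
  then show "graph F \<in> range f"
    unfolding graph_def by (intro comprehension_D1 rec_intros' R_app1[of F]) auto
next
  assume "graph F \<in> range f"
  then have "D1 2 (\<lambda>e. pr (e 1) (e 0) \<in> graph F)" by (intro rec_intros') auto
  then show "rec1 F" unfolding rec1_def by (simp add: D1_S1 eq_commute)
qed

lemma choose_rec1: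
  assumes "S1 2 (\<lambda>e. P (e 0) (e 1))" "\<And>x. \<exists>!y. P y x"
  shows "\<exists>F. rec1 F \<and> (\<forall>x y. P y x \<longleftrightarrow> y = F x)"
proof (intro exI[of _ "\<lambda>x. THE y. P y x"] conjI allI)
  show P: "P y x \<longleftrightarrow> y = (THE y. P y x)" for x y
    using theI'[OF assms(2)[of x]] assms(2)[of x] by auto
  show "rec1 (\<lambda>x. THE y. P y x)" unfolding rec1_def P[symmetric] by (rule assms(1))
qed

lemma common_multiple: "\<exists>v. 0 < (v :: 'm) \<and> (\<forall>d. d \<le> w \<longrightarrow> 0 < d \<longrightarrow> d dvd v)"
proof (rule S1_induct[of "\<lambda>w. \<exists>v. 0 < v \<and> (\<forall>d. d \<le> w \<longrightarrow> 0 < d \<longrightarrow> d dvd v)"])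
  show "S1 1 (\<lambda>e. \<exists>v. 0 < v \<and> (\<forall>d. d \<le> e 0 \<longrightarrow> 0 < d \<longrightarrow> d dvd v))"
    by (intro S1_ex D1_S1 rec_intros) auto
  show "\<exists>v. 0 < (v :: 'm) \<and> (\<forall>d. d \<le> 0 \<longrightarrow> 0 < d \<longrightarrow> d dvd v)" by (intro exI[of _ 1]) auto
  fix w :: 'm assume "\<exists>v. 0 < v \<and> (\<forall>d. d \<le> w \<longrightarrow> 0 < d \<longrightarrow> d dvd v)"
  then obtain v where v: "0 < v" "\<And>d. d \<le> w \<Longrightarrow> 0 < d \<Longrightarrow> d dvd v" by blast
  have "d dvd v * (w + 1)" if "d \<le> w + 1" "0 < d" for d
    using that v(2)[of d] by (cases "d = w + 1") (auto simp: le_less less_add1_iff)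
  then show "\<exists>v. 0 < v \<and> (\<forall>d. d \<le> w + 1 \<longrightarrow> 0 < d \<longrightarrow> d dvd v)"
    using v(1) by (intro exI[of _ "v * (w + 1)"]) (auto intro!: mult_pos_pos add_nonneg_pos)
qed

text \<open>By \<open>\<Sigma>\<^sub>1\<close> induction on \<open>n\<close>, \<open>u\<close> is a
  product of the moduli of the elements of \<open>X\<close> below \<open>n\<close>; coprimality
  ensures that no further modulus comes to divide it.\<close>

lemma ex_code:
  assumes X: "X \<in> range f"
  shows "\<exists>u v. \<forall>z. cmem z u v w \<longleftrightarrow> z < w \<and> z \<in> X"
proof -
  obtain v where v: "0 < v" "\<And>d. d \<le> w \<Longrightarrow> 0 < d \<Longrightarrow> d dvd v" using common_multiple by blast
  let ?f = "\<lambda>z. 1 + (z + 1) * v"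
  let ?P = "\<lambda>n u. n \<le> w \<longrightarrow> (\<forall>z. z < w \<longrightarrow> (?f z dvd u \<longleftrightarrow> z < n \<and> z \<in> X))"
  have "\<exists>u. ?P w u"
  proof (rule S1_induct[of "\<lambda>n. \<exists>u. ?P n u"])
    show "S1 1 (\<lambda>e. \<exists>u. ?P (e 0) u)" using X by (intro S1_ex D1_S1 rec_intros) auto
    \<comment> \<open>The empty product 1 is a code of the empty set since all moduli exceed 1,
      which is why \<open>v\<close> must be positive.\<close>
    have "\<not> ?f z dvd 1" for z
    proof
      assume "?f z dvd 1"
      then obtain b where b: "1 = ?f z * b" by (auto simp: dvd_def)
      then have "b \<noteq> 0" by auto
      then have "1 \<le> b" using pos_imp_ge1 zero_less_iff_neq_zero by blast
      from mult_left_mono[OF this, of "?f z"] have "?f z \<le> 1 + 0" using b by simp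
      then have "(z + 1) * v \<le> 0" by (simp only: add_le_cancel_left)
      then show False using v(1) by (simp add: add_eq_0_iff_both_eq_0)
    qed
    then show "\<exists>u. ?P 0 u" by (intro exI[of _ 1]) simp
    fix n assume "\<exists>u. ?P n u"
    then obtain u where u: "?P n u" ..
    show "\<exists>u. ?P (n + 1) u"
    proof (cases "n + 1 \<le> w")
      case True
      then have nw: "n < w" by (simp add: less_iff_add1_le)
      show ?thesis
      proof (cases "n \<in> X")
        case nX: True
        have "?f z dvd u * ?f n \<longleftrightarrow> z < n + 1 \<and> z \<in> X" if zw: "z < w" for z
        proof (cases "z = n")
          case False
          have "?f z dvd u * ?f n \<longleftrightarrow> ?f z dvd u"
            using code_factor[OF v(2) zw nw False, of u] by auto
          then show ?thesis using u zw nw False by (auto simp: less_add1_iff le_less)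
        qed (simp add: nX)
        then show ?thesis by blast
      next
        case False
        then show ?thesis using u nw by (intro exI[of _ u]) (auto simp: less_add1_iff le_less)
      qed
    qed auto
  qed
  then show ?thesis unfolding cmem_def by auto
qed

text \<open>
  Recursion on \<open>x\<close>, where \<open>H x g y\<close> says how the value \<open>y\<close> at \<open>x\<close> depends on the graph \<open>g\<close> of
  the values below \<open>x\<close>. The value \<open>F x\<close> is read off from a code of the values up to \<open>x\<close>.
\<close>

theorem course_of_values:
  fixes H :: "'m \<Rightarrow> ('m \<Rightarrow> 'm \<Rightarrow> bool) \<Rightarrow> 'm \<Rightarrow> bool"
  assumes def: "S1 5 (\<lambda>e. H (e 0) (\<lambda>a b. cmem (pr a b) (e 1) (e 2) (e 3)) (e 4))"
    and loc: "\<And>x g g' y. (\<And>a b. a < x \<Longrightarrow> g a b \<longleftrightarrow> g' a b) \<Longrightarrow> H x g y \<Longrightarrow> H x g' y"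
    and tot: "\<And>x g. (\<And>a. a < x \<Longrightarrow> \<exists>!b. g a b) \<Longrightarrow> \<exists>!y. H x g y"
  shows "\<exists>F. rec1 F \<and> (\<forall>x. H x (\<lambda>a b. F a = b) (F x))"
proof -
  define g where "g u v w = (\<lambda>a b. cmem (pr a b) u v w)" for u v w :: 'm
  have g_less: "b < w" if "g u v w a b" for u v w a b
    using that le_pr2[of b a] unfolding g_def cmem_def by (blast intro: le_less_trans)
  \<comment> \<open>The code holds a correct computation of the values below \<open>x\<close>. All
    values are below \<open>w\<close>, because pairs bound their components, so every quantifier
    except those inside \<open>H\<close> is bounded.\<close>
  define G where "G x u v w \<longleftrightarrow> (\<forall>a. a < x \<longrightarrow> (\<exists>b. b < w \<and> g u v w a b \<and>
    (\<forall>b'. b' < w \<longrightarrow> g u v w a b' \<longrightarrow> b' = b) \<and> H a (g u v w) b))" for x u v w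
  have G_ex1: "\<exists>!b. g u v w a b" if "G x u v w" "a < x" for x u v w a
    using that g_less unfolding G_def by blast
  have G_H: "H a (g u v w) b" if "G x u v w" "a < x" "g u v w a b" for x u v w a b
    using that g_less unfolding G_def by blast
  have S1G: "S1 4 (\<lambda>e. G (e 0) (e 1) (e 2) (e 3))"
  proof -
    have H: "S1 (Suc (Suc 4)) (\<lambda>e. H (e (Suc 0))
        (\<lambda>a b. cmem (pr a b) (e (Suc (Suc 1))) (e (Suc (Suc 2))) (e (Suc (Suc 3)))) (e 0))"
      using S1_ren[OF def, of 6 "\<lambda>i e. e (if i = 0 then 1 else if i = 4 then 0 else i + 2)"]
      by (simp add: T_var numeral_eq_Suc)
    show ?thesis unfolding G_def g_def
      by (intro S1_ball S1_bex S1_and R_var H) (auto intro!: D1_S1 rec_intros')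
  qed
  have uniq: "g u v w a b \<longleftrightarrow> g u' v' w' a b"
    if G: "G x u v w" "G x' u' v' w'" and ax: "a < x" "a < x'" for x x' u u' v v' w w' a b
  proof -
    \<comment> \<open>Restricting \<open>b\<close> to \<open>b < w + w'\<close> keeps the claim
      \<open>\<Delta>\<^sub>1\<close>; larger \<open>b\<close> occur in neither code.\<close>
    have "a < x \<longrightarrow> a < x' \<longrightarrow> (\<forall>b. b < w + w' \<longrightarrow> (g u v w a b \<longleftrightarrow> g u' v' w' a b))"
    proof (rule D1_strong_induct[of "\<lambda>a. a < x \<longrightarrow> a < x' \<longrightarrow> (\<forall>b. b < w + w' \<longrightarrow> (g u v w a b \<longleftrightarrow> g u' v' w' a b))"])
      show "D1 1 (\<lambda>e. e 0 < x \<longrightarrow> e 0 < x' \<longrightarrow> (\<forall>b. b < w + w' \<longrightarrow> (g u v w (e 0) b \<longleftrightarrow> g u' v' w' (e 0) b)))"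
        unfolding g_def by (intro rec_intros') auto
      fix a
      assume IH: "\<And>c. c < a \<Longrightarrow> c < x \<longrightarrow> c < x' \<longrightarrow> (\<forall>b. b < w + w' \<longrightarrow> (g u v w c b \<longleftrightarrow> g u' v' w' c b))"
      show "a < x \<longrightarrow> a < x' \<longrightarrow> (\<forall>b. b < w + w' \<longrightarrow> (g u v w a b \<longleftrightarrow> g u' v' w' a b))"
      proof (intro impI)
        assume ax: "a < x" "a < x'"
        have agree: "g u' v' w' c b \<longleftrightarrow> g u v w c b" if "c < a" for c b
        proof (cases "b < w + w'")
          case True
          then show ?thesis using IH[OF that] that ax by (meson less_trans)
        next
          case False
          then have "\<not> b < w" "\<not> b < w'" by (auto simp: not_less intro: order_trans[of _ "w + w'"])
          then show ?thesis using g_less by blast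
        qed
        obtain b b' where b: "g u v w a b" "g u' v' w' a b'" using G_ex1 G ax by metis
        have "H a (g u' v' w') b'" using G_H[OF G(2) ax(2) b(2)] .
        then have "H a (g u v w) b'" by (rule loc[rotated]) (rule agree)
        moreover have "\<exists>!y. H a (g u v w) y"
          by (rule tot) (rule G_ex1[OF G(1)], rule less_trans[OF _ ax(1)])
        ultimately have "b = b'" using G_H[OF G(1) ax(1) b(1)] by blast
        then show "\<forall>c. c < w + w' \<longrightarrow> (g u v w a c \<longleftrightarrow> g u' v' w' a c)"
          using b G_ex1[OF G(1) ax(1)] G_ex1[OF G(2) ax(2)] by blast
      qed
    qed
    then show ?thesis
    proof (cases "b < w + w'")
      case False
      then have "\<not> b < w" "\<not> b < w'" by (auto simp: not_less intro: order_trans[of _ "w + w'"])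
      then show ?thesis using g_less by blast
    qed (use ax in blast)
  qed
  have exist: "\<exists>u v w. G x u v w" for x
  proof (rule S1_induct[of "\<lambda>x. \<exists>u v w. G x u v w"])
    have "S1 4 (\<lambda>e. G (e 3) (e 2) (e 1) (e 0))"
      using S1_ren[OF S1G, of 4 "\<lambda>i e. e (3 - i)"] by (simp add: T_var)
    then show "S1 1 (\<lambda>e. \<exists>u v w. G (e 0) u v w)"
      by (intro S1_ex) (simp add: numeral_eq_Suc)
    show "\<exists>u v w. G 0 u v w" by (simp add: G_def)
    fix x assume "\<exists>u v w. G x u v w"
    then obtain u v w where G: "G x u v w" by blast
    obtain y where y: "H x (g u v w) y" using tot[of x "g u v w"] G_ex1[OF G] by blast
    define X where "X = {z. \<exists>a\<le>z. \<exists>b\<le>z. z = pr a b \<and> (a < x \<and> cmem z u v w \<or> a = x \<and> b = y)}"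
    have "X \<in> range f" unfolding X_def by (intro comprehension_D1 rec_intros') auto
    \<comment> \<open>Large enough for the old pairs and for the new pair of \<open>x\<close> and
      \<open>y\<close>.\<close>
    define w' where "w' = w + (pr x y + 1)"
    obtain u' v' where code: "\<And>z. cmem z u' v' w' \<longleftrightarrow> z < w' \<and> z \<in> X"
      using ex_code[OF \<open>X \<in> range f\<close>] by blast
    have X: "pr a b \<in> X \<longleftrightarrow> a < x \<and> g u v w a b \<or> a = x \<and> b = y" for a b
      unfolding X_def g_def using le_pr1 le_pr2 by auto
    have xw': "pr x y < w'" unfolding w'_def by (simp add: less_iff_add1_le)
    have "pr a b < w'" if "g u v w a b" for a b
      using that unfolding g_def cmem_def w'_def by (auto intro: less_le_trans)
    then have g': "g u' v' w' a b \<longleftrightarrow> a < x \<and> g u v w a b \<or> a = x \<and> b = y" for a b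
      unfolding g_def[of u' v' w'] code X using xw' by blast
    have "G (x + 1) u' v' w'"
      unfolding G_def
    proof (intro allI impI)
      fix a assume "a < x + 1"
      then consider "a < x" | "a = x" by (auto simp: less_add1_iff le_less)
      then show "\<exists>b. b < w' \<and> g u' v' w' a b \<and> (\<forall>b'. b' < w' \<longrightarrow> g u' v' w' a b' \<longrightarrow> b' = b) \<and>
        H a (g u' v' w') b"
      proof cases
        case 1
        obtain b where b: "g u v w a b" "\<And>b'. g u v w a b' \<Longrightarrow> b' = b" using G_ex1[OF G 1] by blast
        have gb: "g u' v' w' a b" using b 1 g' by blast
        have "H a (g u v w) b" by (rule G_H[OF G 1 b(1)])
        then have "H a (g u' v' w') b" by (rule loc[rotated]) (use g' 1 less_trans in blast)
        then show ?thesis using gb g_less[OF gb] b(2) g' 1 by (intro exI[of _ b]) auto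
      next
        case 2
        have gb: "g u' v' w' a y" using 2 g' by blast
        have "H a (g u' v' w') y" unfolding 2 by (rule loc[OF _ y]) (use g' in blast)
        then show ?thesis using gb g_less[OF gb] g' 2 by (intro exI[of _ y]) auto
      qed
    qed
    then show "\<exists>u v w. G (x + 1) u v w" by blast
  qed
  let ?P = "\<lambda>y x. \<exists>u v w. G (x + 1) u v w \<and> g u v w x y"
  have "\<exists>F. rec1 F \<and> (\<forall>x y. ?P y x \<longleftrightarrow> y = F x)"
  proof (rule choose_rec1)
    have "S1 5 (\<lambda>e. G (e 4) (e 2) (e 1) (e 0))"
      using S1_ren[OF S1G, of 5 "\<lambda>i e. e (if i = 0 then 4 else 3 - i)"] by (simp add: T_var)
    then have "S1 6 (\<lambda>e. G (e 0) (e 3) (e 2) (e 1))"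
      using S1_ren[OF S1G, of 6 "\<lambda>i e. e (if i = 0 then 0 else 4 - i)"] by (simp add: T_var)
    then have "S1 5 (\<lambda>e. G (e 4 + 1) (e 2) (e 1) (e 0))"
      using S1_subst[of 5 "\<lambda>x e. G x (e 2) (e 1) (e 0)" "\<lambda>e. e 4 + 1"]
      by (simp add: numeral_eq_Suc R_add R_var R_const)
    moreover have "S1 5 (\<lambda>e. g (e 2) (e 1) (e 0) (e 4) (e 3))"
      unfolding g_def by (intro D1_S1 rec_intros') auto
    ultimately show "S1 2 (\<lambda>e. ?P (e 0) (e 1))"
      by (intro S1_ex S1_and) (simp_all add: numeral_eq_Suc)
    fix x
    obtain u v w where G: "G (x + 1) u v w" using exist by blast
    have x: "x < x + 1" by (rule less_add_one)
    from G_ex1[OF G x] obtain y where "g u v w x y" by blast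
    moreover have "y' = y" if "?P y' x" for y'
      using that uniq[OF _ G x x] \<open>g u v w x y\<close> G_ex1[OF G x] by blast
    ultimately show "\<exists>!y. ?P y x" using G by blast
  qed
  then obtain F where F: "rec1 F" "\<And>x y. ?P y x \<longleftrightarrow> y = F x" by blast
  have "H x (\<lambda>a b. F a = b) (F x)" for x
  proof -
    obtain u v w where G: "G (x + 1) u v w" "g u v w x (F x)" using F(2) by blast
    have x: "x < x + 1" by (rule less_add_one)
    have "g u v w a b \<longleftrightarrow> F a = b" if "a < x" for a b
    proof -
      have a: "a < x + 1" "a < a + 1" using that by (simp_all add: less_add1_iff less_imp_le)
      obtain u' v' w' where G': "G (a + 1) u' v' w'" "g u' v' w' a (F a)" using F(2) by blast
      then show ?thesis using uniq[OF G(1) G'(1) a] G_ex1[OF G'(1) a(2)] by blast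
    qed
    with G_H[OF G(1) x G(2)] show ?thesis by (rule loc[rotated]) simp
  qed
  with F(1) show ?thesis by blast
qed

theorem primitive_recursion:
  fixes a :: 'm
  assumes h: "rec2 h"
  shows "\<exists>F. rec1 F \<and> F 0 = a \<and> (\<forall>x. F (x + 1) = h x (F x))"
proof -
  let ?H = "\<lambda>x (g :: 'm \<Rightarrow> 'm \<Rightarrow> bool) y. x = 0 \<and> y = a \<or> (\<exists>x'. x' < x \<and> x = x' + 1 \<and> (\<exists>z. g x' z \<and> y = h x' z))"
  have "\<exists>F. rec1 F \<and> (\<forall>x. ?H x (\<lambda>a b. F a = b) (F x))"
  proof (rule course_of_values[of ?H])
    show "S1 5 (\<lambda>e. ?H (e 0) (\<lambda>a b. cmem (pr a b) (e 1) (e 2) (e 3)) (e 4))"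
      by (intro S1_or S1_bex S1_and S1_ex D1_S1[OF D1_eq] D1_S1[OF D1_cmem] rec_intros' R_app2[OF h])
        auto
    fix x :: 'm and g :: "'m \<Rightarrow> 'm \<Rightarrow> bool"
    assume g: "\<And>a. a < x \<Longrightarrow> \<exists>!b. g a b"
    show "\<exists>!y. ?H x g y"
    proof (cases "x = 0")
      case False
      then obtain x' where x': "x = x' + 1" using zero_or_add1 by blast
      then have "x' < x" using less_add_one by blast
      with g obtain z where z: "g x' z" "\<And>z'. g x' z' \<Longrightarrow> z' = z" by blast
      show ?thesis
      proof (rule ex1I)
        show "?H x g (h x' z)" using z(1) x' \<open>x' < x\<close> by blast
        fix y assume "?H x g y"
        then obtain a b where "x = a + 1" "g a b" "y = h a b" using False by blast
        moreover from this(1) have "a = x'" using x' by simp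
        ultimately show "y = h x' z" using z(2) by blast
      qed
    qed auto
  qed auto
  then obtain F where F: "rec1 F" "\<And>x. ?H x (\<lambda>a b. F a = b) (F x)" by blast
  have "F 0 = a" using F(2)[of 0] by auto
  moreover have "F (x + 1) = h x (F x)" for x using F(2)[of "x + 1"] by auto
  ultimately show ?thesis using F(1) by blast
qed

end

section \<open>Evaluation of the formulas\<close>

context disc_semidom
begin

definition smin :: "('a \<Rightarrow> bool) \<Rightarrow> 'a \<Rightarrow> bool" where
  "smin B m \<longleftrightarrow> B m \<and> (\<forall>x. B x \<longrightarrow> m \<le> x)"

definition sbase :: "('a \<Rightarrow> bool) \<Rightarrow> 'a \<Rightarrow> 'a \<Rightarrow> bool" where
  "sbase B n b \<longleftrightarrow> (\<exists>m. smin B m \<and> (m \<le> n \<and> B b \<and> b \<le> n \<and> (\<forall>x. B x \<and> x \<le> n \<longrightarrow> x \<le> b) \<or> n < m \<and> b = m))"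

definition snext :: "('a \<Rightarrow> bool) \<Rightarrow> 'a \<Rightarrow> 'a \<Rightarrow> bool" where
  "snext B n s \<longleftrightarrow> B s \<and> n < s \<and> (\<forall>x. B x \<and> n < x \<longrightarrow> s \<le> x)"

definition slessS :: "('a \<Rightarrow> bool) \<Rightarrow> 'a \<Rightarrow> 'a \<Rightarrow> bool" where
  "slessS B v n \<longleftrightarrow> (\<forall>s. snext B n s \<longrightarrow> v < s)"

definition sbh :: "('a \<Rightarrow> bool) \<Rightarrow> bool" where
  "sbh B \<longleftrightarrow> (\<exists>x. B x) \<and> (\<forall>b. B b \<longrightarrow> 1 < b \<and> (\<forall>s. snext B b s \<longrightarrow> b dvd s))"

definition sfun :: "'a set \<Rightarrow> bool" where
  "sfun X \<longleftrightarrow> (\<forall>z. z \<in> X \<longrightarrow> (\<exists>x y. z = pr x y)) \<and>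
    (\<forall>x. \<exists>y. pr x y \<in> X \<and> (\<forall>z. pr x z \<in> X \<longrightarrow> z = y))"

end

primrec sexact :: "nat \<Rightarrow> ('a \<Rightarrow> bool) \<Rightarrow> bool" where
  "sexact 0 P \<longleftrightarrow> (\<forall>x. \<not> P x)"
| "sexact (Suc k) P \<longleftrightarrow> (\<exists>x. P x \<and> sexact k (\<lambda>y. P y \<and> \<not> y = x))"

text \<open>Since \<open>k\<close> is a metatheoretic number, the set is finite also from outside
  the model. This permits a metatheoretic induction over its elements in the termination
  proof.\<close>

lemma sexact_finite: "sexact k P \<Longrightarrow> \<exists>A. finite A \<and> (\<forall>x. P x \<longleftrightarrow> x \<in> A)"
proof (induction k arbitrary: P)
  case (Suc k)
  then obtain x A where "P x" "finite A" "\<forall>y. P y \<and> y \<noteq> x \<longleftrightarrow> y \<in> A" by fastforce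
  then show ?case by (intro exI[of _ "insert x A"]) auto
qed auto

context rca
begin

definition spow :: "'m \<Rightarrow> 'm \<Rightarrow> 'm \<Rightarrow> bool" where
  "spow b e p \<longleftrightarrow> (\<exists>F. rec1 F \<and> F 0 = 1 \<and> (\<forall>i. F (i + 1) = F i * b) \<and> F e = p)"

definition sdec :: "'m \<Rightarrow> 'm \<Rightarrow> 'm \<Rightarrow> 'm \<Rightarrow> 'm \<Rightarrow> bool" where
  "sdec b n e a r \<longleftrightarrow> (\<exists>p q. spow b e p \<and> spow b (e + 1) q \<and>
     p \<le> n \<and> n < q \<and> 0 < a \<and> a < b \<and> r < p \<and> n = p * a + r)"

definition ssubst :: "('m \<Rightarrow> 'm) \<Rightarrow> 'm \<Rightarrow> 'm \<Rightarrow> 'm \<Rightarrow> 'm \<Rightarrow> bool" where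
  "ssubst u b c m v \<longleftrightarrow> (\<exists>V. rec1 V \<and>
     (\<forall>x. (x < b \<longrightarrow> V x = u x) \<and>
       (b \<le> x \<longrightarrow> (\<exists>e a r. sdec b x e a r \<and> (\<exists>p. spow c (V e) p \<and> V x = p * u a + V r)))) \<and>
     V m = v)"

definition sadm :: "('m \<Rightarrow> bool) \<Rightarrow> ('m \<Rightarrow> 'm) \<Rightarrow> 'm \<Rightarrow> 'm \<Rightarrow> 'm \<Rightarrow> bool" where
  "sadm C u n b c \<longleftrightarrow> C c \<and> (\<exists>i v. n = i + 1 \<and> ssubst u b c n v \<and> u i < v \<and> slessS C v c)"

definition supg :: "('m \<Rightarrow> bool) \<Rightarrow> ('m \<Rightarrow> bool) \<Rightarrow> 'm \<Rightarrow> 'm \<Rightarrow> bool" where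
  "supg B C n v \<longleftrightarrow> (\<exists>u. rec1 u \<and> (\<exists>m. smin B m \<and>
     (\<forall>j. j \<le> n \<longrightarrow> (j < m \<longrightarrow> u j = j) \<and>
       (m \<le> j \<longrightarrow> (\<exists>b c y. sbase B j b \<and> sadm C u j b c \<and>
         (\<forall>c'. c' < c \<longrightarrow> \<not> sadm C u j b c') \<and> ssubst u b c j y \<and> u j = y)))) \<and> u n = v)"

definition sgood :: "('m \<Rightarrow> bool) \<Rightarrow> ('m \<Rightarrow> bool) \<Rightarrow> bool" where
  "sgood B C \<longleftrightarrow> (\<exists>m m'. smin B m \<and> smin C m' \<and> m \<le> m') \<and> (\<forall>n. \<exists>v. supg B C n v) \<and>
     (\<forall>i m x d. B (i + 1) \<and> smin B m \<and> m < i + 1 \<and> supg B C i x \<and> sbase C x d \<longrightarrow>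
       \<not> (\<exists>y. d dvd y \<and> x < y \<and> slessS C y x))"

definition ent :: "'m set \<Rightarrow> 'm \<Rightarrow> 'm \<Rightarrow> bool" where
  "ent X i x \<longleftrightarrow> pr i x \<in> X"

definition sdyn :: "'m set \<Rightarrow> bool" where
  "sdyn X \<longleftrightarrow> (\<forall>i. sbh (ent X i) \<and> sgood (ent X i) (ent X (i + 1)))"

definition sgoodstein :: "'m set \<Rightarrow> 'm \<Rightarrow> 'm \<Rightarrow> 'm \<Rightarrow> bool" where
  "sgoodstein X i n v \<longleftrightarrow> (\<exists>G. rec1 G \<and> G 0 = n \<and>
     (\<forall>j. (0 < G j \<longrightarrow> supg (ent X j) (ent X (j + 1)) (G j) (G (j + 1) + 1)) \<and>
          (G j = 0 \<longrightarrow> G (j + 1) = 0)) \<and> G i = v)"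

lemma sfun_graph: "sfun (graph F)"
  unfolding sfun_def by (auto simp: graph_def le_pr1)

lemma sfun_imp_graph:
  assumes "sfun X" shows "\<exists>F. X = graph F"
proof -
  have "\<exists>y. pr x y \<in> X \<and> (\<forall>z. pr x z \<in> X \<longrightarrow> z = y)" for x using assms by (simp add: sfun_def)
  then obtain F where F: "\<And>x. pr x (F x) \<in> X" "\<And>x z. pr x z \<in> X \<Longrightarrow> z = F x" by metis
  have "z \<in> X \<longleftrightarrow> z \<in> graph F" for z
  proof
    assume "z \<in> X"
    moreover from this obtain x y where "z = pr x y" using assms by (auto simp: sfun_def)
    ultimately show "z \<in> graph F" using F(2) by auto
  next
    assume "z \<in> graph F" then show "z \<in> X" using F(1) by (auto simp: graph_def)
  qed
  then show ?thesis by blast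
qed

text \<open>Quantifying over coded functions of the model amounts to quantifying over functions that
  are recursive in parameters.\<close>

lemma ex_sfun: "(\<exists>X\<in>range f. sfun X \<and> Q X) \<longleftrightarrow> (\<exists>F. rec1 F \<and> Q (graph F))"
proof
  assume "\<exists>X\<in>range f. sfun X \<and> Q X"
  then obtain X where X: "X \<in> range f" "sfun X" "Q X" by blast
  moreover obtain F where "X = graph F" using sfun_imp_graph[OF X(2)] ..
  ultimately show "\<exists>F. rec1 F \<and> Q (graph F)" by (auto simp: rec1_graph)
next
  assume "\<exists>F. rec1 F \<and> Q (graph F)"
  then obtain F where "graph F \<in> range f" "Q (graph F)" by (auto simp: rec1_graph)
  then show "\<exists>X\<in>range f. sfun X \<and> Q X" using sfun_graph by (intro bexI[of _ "graph F"]) auto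
qed

end

text \<open>
  Contexts \<open>(l, k, E, F)\<close> record the values \<open>E i\<close>, \<open>F j\<close> of the number and set variables bound
  at depths \<open>i < l\<close>, \<open>j < k\<close>. The value of a term in a context must persist in all larger
  contexts, since terms are used at larger depths than the one where they are formed.
\<close>

type_synonym 'm ctx = "nat \<times> nat \<times> (nat \<Rightarrow> 'm) \<times> (nat \<Rightarrow> 'm set)"

definition le_ctx :: "'m ctx \<Rightarrow> 'm ctx \<Rightarrow> bool" (infix "\<sqsubseteq>" 50) where
  "c \<sqsubseteq> c' \<longleftrightarrow> (case c of (l, k, E, F) \<Rightarrow> case c' of (l', k', E', F') \<Rightarrow>
    l \<le> l' \<and> k \<le> k' \<and> (\<forall>i<l. E' i = E i) \<and> (\<forall>i<k. F' i = F i))"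

lemma le_refl: "c \<sqsubseteq> c"
  by (auto simp: le_ctx_def)

lemma le_up: "c' \<sqsubseteq> c'' \<Longrightarrow> c \<sqsubseteq> c' \<Longrightarrow> c \<sqsubseteq> c''"
  by (auto simp: le_ctx_def)

locale rca_eval = rca f for f :: "nat \<Rightarrow> 'm::{disc_semidom,countable} set" +
  fixes e0 :: "nat \<Rightarrow> 'm"
begin

definition en :: "nat \<Rightarrow> (nat \<Rightarrow> 'm) \<Rightarrow> nat \<Rightarrow> 'm" where
  "en l E n = (if n < l then E (l - Suc n) else e0 (n - l))"

definition sn :: "nat \<Rightarrow> (nat \<Rightarrow> 'm set) \<Rightarrow> nat \<Rightarrow> 'm set" where
  "sn k F n = (if n < k then F (k - Suc n) else f (n - k))"

lemma case_nat_en: "case_nat m (en l E) = en (Suc l) (E(l := m))"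
  by (rule ext) (auto simp: en_def split: nat.split)

lemma case_nat_sn: "case_nat A (sn k F) = sn (Suc k) (F(k := A))"
  by (rule ext) (auto simp: sn_def split: nat.split)

definition TV :: "'m ctx \<Rightarrow> trm \<Rightarrow> 'm \<Rightarrow> bool" where
  "TV c t m \<longleftrightarrow> (\<forall>l k E F. c \<sqsubseteq> (l, k, E, F) \<longrightarrow> eval (en l E) (t l) = m)"

definition SV :: "'m ctx \<Rightarrow> svar \<Rightarrow> 'm set \<Rightarrow> bool" where
  "SV c X A \<longleftrightarrow> (\<forall>l k E F. c \<sqsubseteq> (l, k, E, F) \<longrightarrow> sn k F (X k) = A)"

definition FV :: "'m ctx \<Rightarrow> form \<Rightarrow> bool \<Rightarrow> bool" where
  "FV c \<phi> p \<longleftrightarrow> (\<forall>l k E F. c \<sqsubseteq> (l, k, E, F) \<longrightarrow> sat (en l E) (sn k F) (\<phi> l k) = p)"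

definition PV :: "'m ctx \<Rightarrow> pred \<Rightarrow> ('m \<Rightarrow> bool) \<Rightarrow> bool" where
  "PV c B P \<longleftrightarrow> (\<forall>c' t m. c \<sqsubseteq> c' \<longrightarrow> TV c' t m \<longrightarrow> FV c' (B t) (P m))"

lemma TV_up: "c \<sqsubseteq> c' \<Longrightarrow> TV c t m \<Longrightarrow> TV c' t m"
  unfolding TV_def using le_up by blast

lemma SV_up: "c \<sqsubseteq> c' \<Longrightarrow> SV c X A \<Longrightarrow> SV c' X A"
  unfolding SV_def using le_up by blast

lemma PV_up: "c \<sqsubseteq> c' \<Longrightarrow> PV c B P \<Longrightarrow> PV c' B P"
  unfolding PV_def using le_up by blast

lemma PVI: "(\<And>c' t m. c \<sqsubseteq> c' \<Longrightarrow> TV c' t m \<Longrightarrow> FV c' (B t) (P m)) \<Longrightarrow> PV c B P"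
  unfolding PV_def by blast

lemma PVD: "PV c B P \<Longrightarrow> c \<sqsubseteq> c' \<Longrightarrow> TV c' t m \<Longrightarrow> FV c' (B t) (P m)"
  unfolding PV_def by blast

lemma FV_cong: "FV c \<phi> p \<Longrightarrow> p = q \<Longrightarrow> FV c \<phi> q"
  by simp

lemma TV_zero: "TV c \<^bold>0 0"
  by (simp add: TV_def zero_t_def)

lemma TV_one: "TV c \<^bold>1 1"
  by (simp add: TV_def one_t_def)

lemma TV_plus: "TV c s a \<Longrightarrow> TV c t b \<Longrightarrow> TV c (s \<^bold>+ t) (a + b)"
  by (simp add: TV_def plus_t_def)

lemma TV_times: "TV c s a \<Longrightarrow> TV c t b \<Longrightarrow> TV c (s \<^bold>* t) (a * b)"
  by (simp add: TV_def times_t_def)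

lemma TV_pair: "TV c s a \<Longrightarrow> TV c t b \<Longrightarrow> TV c (pair s t) (pr a b)"
  unfolding pair_def pr_def by (intro TV_plus TV_times)

lemma FV_eq: "TV c s a \<Longrightarrow> TV c t b \<Longrightarrow> FV c (s \<^bold>= t) (a = b)"
  by (simp add: TV_def FV_def eq_f_def)

lemma FV_less: "TV c s a \<Longrightarrow> TV c t b \<Longrightarrow> FV c (s \<^bold>< t) (a < b)"
  by (simp add: TV_def FV_def less_f_def)

lemma FV_mem: "TV c s a \<Longrightarrow> SV c X A \<Longrightarrow> FV c (s \<^bold>\<in> X) (a \<in> A)"
  by (simp add: TV_def SV_def FV_def mem_f_def)

lemma FV_not: "FV c \<phi> p \<Longrightarrow> FV c (\<^bold>\<not> \<phi>) (\<not> p)"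
  by (simp add: FV_def not_f_def)

lemma FV_and: "FV c \<phi> p \<Longrightarrow> FV c \<psi> q \<Longrightarrow> FV c (\<phi> \<^bold>\<and> \<psi>) (p \<and> q)"
  by (simp add: FV_def and_f_def)

lemma FV_or: "FV c \<phi> p \<Longrightarrow> FV c \<psi> q \<Longrightarrow> FV c (\<phi> \<^bold>\<or> \<psi>) (p \<or> q)"
  by (auto simp: FV_def or_f_def)

lemma FV_imp: "FV c \<phi> p \<Longrightarrow> FV c \<psi> q \<Longrightarrow> FV c (\<phi> \<^bold>\<longrightarrow> \<psi>) (p \<longrightarrow> q)"
  by (simp add: FV_def imp_f_def)

lemma FV_leq: "TV c s a \<Longrightarrow> TV c t b \<Longrightarrow> FV c (s \<^bold>\<le> t) (a \<le> b)"
  unfolding leq_f_def by (rule FV_cong, rule FV_or, rule FV_less, assumption+, rule FV_eq, assumption+)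
    (simp add: le_less)

lemma bound_ctx:
  assumes "c \<sqsubseteq> (l, k, E, F)"
  shows "c \<sqsubseteq> (Suc l, k, E(l := m), F)" "TV (Suc l, k, E(l := m), F) (\<lambda>d'. Var (d' - Suc l)) m"
    "c \<sqsubseteq> (l, Suc k, E, F(k := A))" "SV (l, Suc k, E, F(k := A)) (\<lambda>e'. e' - Suc k) A"
  using assms unfolding le_ctx_def TV_def SV_def by (auto simp: en_def sn_def)

lemma FV_all:
  assumes "PV c \<Phi> P" shows "FV c (all_n \<Phi>) (\<forall>m. P m)"
  unfolding FV_def
proof (intro allI impI)
  fix l k E F assume c: "c \<sqsubseteq> (l, k, E, F)"
  have "sat (en (Suc l) (E(l := m))) (sn k F) (\<Phi> (\<lambda>d'. Var (d' - Suc l)) (Suc l) k) = P m" for m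
    using PVD[OF assms bound_ctx(1,2)[OF c]] unfolding FV_def by (simp add: le_refl)
  then show "sat (en l E) (sn k F) (all_n \<Phi> l k) = (\<forall>m. P m)"
    by (simp add: all_n_def case_nat_en)
qed

lemma FV_ex:
  assumes "PV c \<Phi> P" shows "FV c (ex_n \<Phi>) (\<exists>m. P m)"
  unfolding FV_def
proof (intro allI impI)
  fix l k E F assume c: "c \<sqsubseteq> (l, k, E, F)"
  have "sat (en (Suc l) (E(l := m))) (sn k F) (\<Phi> (\<lambda>d'. Var (d' - Suc l)) (Suc l) k) = P m" for m
    using PVD[OF assms bound_ctx(1,2)[OF c]] unfolding FV_def by (simp add: le_refl)
  then show "sat (en l E) (sn k F) (ex_n \<Phi> l k) = (\<exists>m. P m)"
    by (simp add: ex_n_def case_nat_en)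
qed

lemma FV_all_s:
  assumes "\<And>c' X A. c \<sqsubseteq> c' \<Longrightarrow> A \<in> range f \<Longrightarrow> SV c' X A \<Longrightarrow> FV c' (\<Phi> X) (P A)"
  shows "FV c (all_s \<Phi>) (\<forall>A\<in>range f. P A)"
  unfolding FV_def
proof (intro allI impI)
  fix l k E F assume c: "c \<sqsubseteq> (l, k, E, F)"
  have "sat (en l E) (sn (Suc k) (F(k := A))) (\<Phi> (\<lambda>e'. e' - Suc k) l (Suc k)) = P A" if "A \<in> range f" for A
    using assms[OF bound_ctx(3)[OF c] that bound_ctx(4)[OF c]] unfolding FV_def by (simp add: le_refl)
  then show "sat (en l E) (sn k F) (all_s \<Phi> l k) = (\<forall>A\<in>range f. P A)"
    by (simp add: all_s_def case_nat_sn)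
qed

lemma FV_ex_s:
  assumes "\<And>c' X A. c \<sqsubseteq> c' \<Longrightarrow> SV c' X A \<Longrightarrow> FV c' (\<Phi> X) (P A)"
  shows "FV c (ex_s \<Phi>) (\<exists>A\<in>range f. P A)"
  unfolding FV_def
proof (intro allI impI)
  fix l k E F assume c: "c \<sqsubseteq> (l, k, E, F)"
  have "sat (en l E) (sn (Suc k) (F(k := A))) (\<Phi> (\<lambda>e'. e' - Suc k) l (Suc k)) = P A" if "A \<in> range f" for A
    using assms[OF bound_ctx(3)[OF c] bound_ctx(4)[OF c]] unfolding FV_def by (simp add: le_refl)
  then show "sat (en l E) (sn k F) (ex_s \<Phi> l k) = (\<exists>A\<in>range f. P A)"
    by (simp add: ex_s_def case_nat_sn)
qed

lemmas FV_intros = FV_eq FV_less FV_leq FV_mem FV_not FV_and FV_or FV_imp FV_all FV_ex PVI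
  TV_zero TV_one TV_plus TV_times TV_pair
lemmas up = TV_up SV_up PV_up le_up le_refl

lemma FV_dvd: "TV c s a \<Longrightarrow> TV c t b \<Longrightarrow> FV c (s \<^bold>dvd t) (a dvd b)"
  unfolding dvd_f_def dvd_def by (intro FV_intros) (assumption | rule le_refl TV_zero | rule up, assumption)+

lemma PV_entry: "SV c X A \<Longrightarrow> TV c i a \<Longrightarrow> PV c (entry X i) (ent A a)"
  unfolding entry_def ent_def[abs_def] by (intro FV_intros) (assumption | rule le_refl TV_zero | rule up, assumption)+

lemma FV_maps: "SV c X A \<Longrightarrow> TV c s a \<Longrightarrow> TV c t b \<Longrightarrow> FV c (maps X s t) (pr a b \<in> A)"
  unfolding maps_def by (intro FV_intros)

lemma FV_is_function: "SV c X A \<Longrightarrow> FV c (is_function X) (sfun A)"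
  unfolding is_function_def sfun_def by (intro FV_intros FV_maps) (assumption | rule le_refl TV_zero | rule up, assumption)+

text \<open>The body needs a meaning only at graphs of functions: for any other set the conjunct
  \<open>is_function\<close> is already false.\<close>

lemma FV_ex_fun:
  assumes "\<And>c' X F. c \<sqsubseteq> c' \<Longrightarrow> SV c' X (graph F) \<Longrightarrow> FV c' (\<Phi> X) (P F)"
  shows "FV c (\<^bold>\<exists>\<^sub>S X. is_function X \<^bold>\<and> \<Phi> X) (\<exists>F. rec1 F \<and> P F)"
proof -
  define Q where "Q A \<longleftrightarrow> (\<exists>F. A = graph F \<and> P F)" for A
  have inj: "graph F = graph G \<Longrightarrow> F = G" for F G
    using pr_graph by (metis ext)
  have "FV c' (is_function X \<^bold>\<and> \<Phi> X) (sfun A \<and> Q A)" if "c \<sqsubseteq> c'" "SV c' X A" for c' X A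
  proof (cases "\<exists>F. A = graph F")
    case True
    then obtain F where F: "A = graph F" ..
    with assms that have "FV c' (\<Phi> X) (P F)" by blast
    moreover have "P F = Q A" unfolding Q_def F using inj by blast
    ultimately show ?thesis using that by (intro FV_and FV_is_function) simp_all
  next
    case False
    then have "\<not> sfun A" using sfun_imp_graph by blast
    then have "FV c' (is_function X) False" using FV_is_function[OF that(2)] by simp
    then show ?thesis using \<open>\<not> sfun A\<close> by (auto simp: FV_def and_f_def)
  qed
  then have "FV c (\<^bold>\<exists>\<^sub>S X. is_function X \<^bold>\<and> \<Phi> X) (\<exists>A\<in>range f. sfun A \<and> Q A)"
    by (rule FV_ex_s)
  moreover have "(\<exists>A\<in>range f. sfun A \<and> Q A) \<longleftrightarrow> (\<exists>F. rec1 F \<and> P F)"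
    unfolding ex_sfun Q_def using inj by blast
  ultimately show ?thesis by simp
qed

abbreviation mp :: "('m \<Rightarrow> 'm) \<Rightarrow> 'm \<Rightarrow> 'm \<Rightarrow> bool" where
  "mp F a b \<equiv> pr a b \<in> graph F"

lemma FV_is_power:
  assumes "TV c b b'" "TV c e e'" "TV c p p'" shows "FV c (is_power b e p) (spow b' e' p')"
proof (rule FV_cong)
  show "FV c (is_power b e p) (\<exists>F. rec1 F \<and> mp F 0 1 \<and> (\<forall>i y. mp F i y \<longrightarrow> mp F (i + 1) (y * b')) \<and> mp F e' p')"
    unfolding is_power_def using assms by (intro FV_ex_fun FV_intros FV_maps) (assumption | rule le_refl TV_zero | rule up, assumption)+
qed (simp add: spow_def)

lemma FV_is_min:
  assumes "PV c B P" "TV c m m'"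
  shows "FV c (is_min B m) (smin P m')"
  unfolding is_min_def smin_def using assms
  by (intro FV_intros PVD[OF assms(1)]) (assumption | rule le_refl TV_zero | rule up, assumption)+

lemma FV_is_base:
  assumes "PV c B P" "TV c n n'" "TV c b b'"
  shows "FV c (is_base B n b) (sbase P n' b')"
  unfolding is_base_def sbase_def
  using assms
  by (intro FV_intros FV_is_min PVD[OF assms(1)]) (assumption | rule le_refl TV_zero | rule up, assumption)+

lemma FV_is_S:
  assumes "PV c B P" "TV c n n'" "TV c s s'"
  shows "FV c (is_S B n s) (snext P n' s')"
  unfolding is_S_def snext_def
  using assms
  by (intro FV_intros PVD[OF assms(1)]) (assumption | rule le_refl TV_zero | rule up, assumption)+

lemma FV_less_S:
  assumes "PV c B P" "TV c v v'" "TV c n n'"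
  shows "FV c (less_S B v n) (slessS P v' n')"
  unfolding less_S_def slessS_def
  using assms
  by (intro FV_intros FV_is_S PVD[OF assms(1)]) (assumption | rule le_refl TV_zero | rule up, assumption)+

lemma FV_base_hierarchy:
  assumes "PV c B P"
  shows "FV c (base_hierarchy B) (sbh P)"
  unfolding base_hierarchy_def sbh_def
  using assms
  by (intro FV_intros FV_is_S FV_dvd PVD[OF assms(1)]) (assumption | rule le_refl TV_zero | rule up, assumption)+

lemma FV_decomposition:
  "TV c b b' \<Longrightarrow> TV c n n' \<Longrightarrow> TV c e e' \<Longrightarrow> TV c a a' \<Longrightarrow> TV c r r' \<Longrightarrow>
    FV c (decomposition b n e a r) (sdec b' n' e' a' r')"
  unfolding decomposition_def sdec_def
  by (intro FV_intros FV_is_power) (assumption | rule le_refl TV_zero | rule up, assumption)+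

lemma FV_is_subst:
  assumes "SV c U (graph u)" "TV c b b'" "TV c d d'" "TV c m m'" "TV c v v'"
  shows "FV c (is_subst U b d m v) (ssubst u b' d' m' v')"
proof (rule FV_cong)
  show "FV c (is_subst U b d m v) (\<exists>V. rec1 V \<and>
     (\<forall>x. (x < b' \<longrightarrow> (\<exists>y. mp u x y \<and> mp V x y)) \<and>
       (b' \<le> x \<longrightarrow> (\<exists>e a r. sdec b' x e a r \<and> (\<exists>e' a' r' p. mp V e e' \<and> mp u a a' \<and> mp V r r' \<and>
         spow d' e' p \<and> mp V x (p * a' + r'))))) \<and>
     mp V m' v')"
    unfolding is_subst_def using assms
    by (intro FV_ex_fun FV_intros FV_maps FV_decomposition FV_is_power) (assumption | rule le_refl TV_zero | rule up, assumption)+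
qed (simp add: ssubst_def eq_commute)

lemma FV_admissible:
  assumes "PV c C P" "SV c U (graph u)" "TV c n n'" "TV c b b'" "TV c d d'"
  shows "FV c (admissible C U n b d) (sadm P u n' b' d')"
proof (rule FV_cong)
  show "FV c (admissible C U n b d) (P d' \<and> (\<exists>i w v. n' = i + 1 \<and> mp u i w \<and> ssubst u b' d' n' v \<and>
      w < v \<and> slessS P v d'))"
    unfolding admissible_def using assms
    by (intro FV_intros FV_maps FV_is_subst FV_less_S PVD[OF assms(1)]) (assumption | rule le_refl TV_zero | rule up, assumption)+
qed (auto simp: sadm_def)

lemma FV_is_upgrade:
  assumes "PV c B P" "PV c C Q" "TV c n n'" "TV c v v'"
  shows "FV c (is_upgrade B C n v) (supg P Q n' v')"
proof (rule FV_cong)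
  show "FV c (is_upgrade B C n v) (\<exists>u. rec1 u \<and> (\<exists>m. smin P m \<and>
     (\<forall>j. j \<le> n' \<longrightarrow> (j < m \<longrightarrow> mp u j j) \<and>
       (m \<le> j \<longrightarrow> (\<exists>b c y. sbase P j b \<and> sadm Q u j b c \<and>
         (\<forall>c'. c' < c \<longrightarrow> \<not> sadm Q u j b c') \<and> ssubst u b c j y \<and> mp u j y)))) \<and> mp u n' v')"
    unfolding is_upgrade_def using assms
    by (intro FV_ex_fun FV_intros FV_maps FV_is_subst FV_is_min FV_is_base FV_admissible
        PVD[OF assms(1)] PVD[OF assms(2)])
      (assumption | rule le_refl TV_zero | rule up, assumption)+
qed (simp add: supg_def)

lemma FV_good_successor:
  assumes "PV c B P" "PV c C Q" shows "FV c (good_successor B C) (sgood P Q)"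
  unfolding good_successor_def sgood_def using assms
  by (intro FV_intros FV_is_min FV_is_upgrade FV_is_base FV_dvd FV_less_S PVD[OF assms(1)] PVD[OF assms(2)])
    (assumption | rule le_refl TV_zero | rule up, assumption)+

lemma FV_dynamical: "SV c X A \<Longrightarrow> FV c (dynamical_hierarchy X) (sdyn A)"
  unfolding dynamical_hierarchy_def sdyn_def
  by (intro FV_intros FV_base_hierarchy FV_good_successor PV_entry) (assumption | rule le_refl TV_zero | rule up, assumption)+

lemma FV_goodstein:
  assumes "SV c X A" "TV c i i'" "TV c n n'" "TV c v v'"
  shows "FV c (is_goodstein X i n v) (sgoodstein A i' n' v')"
proof (rule FV_cong)
  show "FV c (is_goodstein X i n v) (\<exists>G. rec1 G \<and> mp G 0 n' \<and>
     (\<forall>j x y. mp G j x \<and> mp G (j + 1) y \<longrightarrow> (0 < x \<longrightarrow> supg (ent A j) (ent A (j + 1)) x (y + 1)) \<and>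
          (x = 0 \<longrightarrow> y = 0)) \<and> mp G i' v')"
    unfolding is_goodstein_def using assms
    by (intro FV_ex_fun FV_intros FV_maps FV_is_upgrade PV_entry) (assumption | rule le_refl TV_zero | rule up, assumption)+
qed (simp add: sgoodstein_def)

lemma FV_exactly: "PV c \<Phi> P \<Longrightarrow> FV c (exactly k \<Phi>) (sexact k P)"
proof (induction k arbitrary: c \<Phi> P)
  case 0
  show ?case unfolding exactly.simps sexact.simps
    by (intro FV_intros PVD[OF 0]) (assumption | rule le_refl TV_zero | rule up, assumption)+
next
  case (Suc k)
  show ?case unfolding exactly.simps sexact.simps
    by (intro FV_intros Suc.IH PVD[OF Suc.prems]) (assumption | rule le_refl TV_zero | rule up, assumption)+
qed

lemma sat_goal:
  "sat e0 f (goal k) \<longleftrightarrow> (\<forall>A\<in>range f.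
     sdyn A \<and> (\<forall>b. ent A 0 b \<longrightarrow> (\<exists>m s. smin (ent A 0) m \<and> snext (ent A 0) b s \<and>
       s \<le> (1 + 1 + 1) * b \<and> s \<le> b * m)) \<and>
     sexact k (\<lambda>b. ent A 0 b \<and> snext (ent A 0) b ((1 + 1 + 1) * b)) \<longrightarrow>
     (\<forall>n. \<exists>i. sgoodstein A i n 0))" (is "_ \<longleftrightarrow> ?R")
proof -
  let ?c = "(0, 0, \<lambda>_. e0 0, \<lambda>_. f 0) :: 'm ctx"
  have *: "FV ?c (\<^bold>\<forall>\<^sub>S \<B>.
       dynamical_hierarchy \<B> \<^bold>\<and>
       (\<^bold>\<forall>b. entry \<B> \<^bold>0 b \<^bold>\<longrightarrow>
          (\<^bold>\<exists>m. \<^bold>\<exists>s. is_min (entry \<B> \<^bold>0) m \<^bold>\<and> is_S (entry \<B> \<^bold>0) b s \<^bold>\<and>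
             s \<^bold>\<le> \<^bold>3 \<^bold>* b \<^bold>\<and> s \<^bold>\<le> b \<^bold>* m)) \<^bold>\<and>
       exactly k (\<lambda>b. entry \<B> \<^bold>0 b \<^bold>\<and> is_S (entry \<B> \<^bold>0) b (\<^bold>3 \<^bold>* b)) \<^bold>\<longrightarrow>
       (\<^bold>\<forall>n. \<^bold>\<exists>i. is_goodstein \<B> i n \<^bold>0)) ?R"
    by (intro FV_all_s FV_intros FV_dynamical FV_exactly FV_is_min FV_is_S FV_goodstein
        PVD[OF PV_entry] PV_entry) (assumption | rule le_refl TV_zero | rule up, assumption)+
  have en: "en 0 (\<lambda>_. e0 0) = e0" and sn: "sn 0 (\<lambda>_. f 0) = f"
    by (simp_all add: en_def sn_def fun_eq_iff)
  show ?thesis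
    unfolding goal_def sentence_def
    by (rule *[unfolded FV_def, rule_format, OF le_refl, unfolded en sn])
qed

end

section \<open>Division, powers, and decompositions\<close>

context rca
begin

lemma ex_div:
  fixes x w :: 'm
  assumes "0 < w" shows "\<exists>q r. x = w * q + r \<and> r < w"
proof -
  \<comment> \<open>The bound on \<open>q\<close> makes the induction statement
    \<open>\<Delta>\<^sub>1\<close>.\<close>
  have "\<exists>q. q \<le> x \<and> (\<exists>r. r < w \<and> x = w * q + r)"
  proof (rule D1_induct[of "\<lambda>x. \<exists>q. q \<le> x \<and> (\<exists>r. r < w \<and> x = w * q + r)"])
    show "D1 1 (\<lambda>e. \<exists>q. q \<le> e 0 \<and> (\<exists>r. r < w \<and> e 0 = w * q + r))"
      by (intro rec_intros) auto
    fix x assume "\<exists>q. q \<le> x \<and> (\<exists>r. r < w \<and> x = w * q + r)"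
    then obtain q r where qr: "q \<le> x" "r < w" "x = w * q + r" by blast
    show "\<exists>q. q \<le> x + 1 \<and> (\<exists>r. r < w \<and> x + 1 = w * q + r)"
    proof (cases "r + 1 < w")
      case True
      moreover have "x + 1 = w * q + (r + 1)" using qr(3) by (simp add: ac_simps)
      moreover have "q \<le> x + 1" using qr(1) by (rule order_trans) simp
      ultimately show ?thesis by blast
    next
      case False
      then have "r + 1 = w" using less_imp_add1_le[OF qr(2)] by (simp add: not_less antisym)
      then have "x + 1 = w * (q + 1) + 0" using qr(3) by (auto simp: algebra_simps)
      moreover have "q + 1 \<le> x + 1" using qr(1) by simp
      ultimately show ?thesis using assms by blast
    qed
  qed (use assms in auto)
  then show ?thesis by blast
qed

lemma div_unique_le:
  fixes w :: 'm
  assumes "w * q + r = w * q' + r'" "r < w"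
  shows "q' \<le> q"
proof (rule ccontr)
  assume "\<not> q' \<le> q"
  then have "w * (q + 1) \<le> w * q'" by (intro mult_left_mono) (simp_all add: less_iff_add1_le not_le)
  then have "w * q + w \<le> w * q' + r'" by (simp add: distrib_left add_increasing2)
  then show False using assms by (metis add_less_cancel_left not_le)
qed

lemma div_unique:
  fixes w :: 'm
  assumes "w * q + r = w * q' + r'" "r < w" "r' < w"
  shows "q = q' \<and> r = r'"
proof -
  have "q = q'" using div_unique_le[OF assms(1,2)] div_unique_le[OF assms(1)[symmetric] assms(3)]
    by (rule antisym[rotated])
  with assms(1) show ?thesis by simp
qed

text \<open>The value 0 for the divisor 0 makes the function total, as recursive functions have to
  be.\<close>

definition dv :: "'m \<Rightarrow> 'm \<Rightarrow> 'm" where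
  "dv x w = (THE q. w = 0 \<and> q = 0 \<or> (\<exists>r. r < w \<and> x = w * q + r))"

definition md :: "'m \<Rightarrow> 'm \<Rightarrow> 'm" where
  "md x w = (THE r. w = 0 \<and> r = 0 \<or> r < w \<and> (\<exists>q. x = w * q + r))"

lemma dv_iff: "q = dv x w \<longleftrightarrow> w = 0 \<and> q = 0 \<or> (\<exists>r. r < w \<and> x = w * q + r)"
proof -
  have "\<exists>!q. w = 0 \<and> q = 0 \<or> (\<exists>r. r < w \<and> x = w * q + r)"
  proof (cases "w = 0")
    case False
    then obtain q r where qr: "x = w * q + r" "r < w" using ex_div[of w x] zero_less_iff_neq_zero by blast
    then show ?thesis using False by (intro ex1I[of _ q]) (auto dest: div_unique)
  qed auto
  from theI'[OF this] this show ?thesis unfolding dv_def[symmetric] by blast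
qed

lemma md_iff: "r = md x w \<longleftrightarrow> w = 0 \<and> r = 0 \<or> r < w \<and> (\<exists>q. x = w * q + r)"
proof -
  have "\<exists>!r. w = 0 \<and> r = 0 \<or> r < w \<and> (\<exists>q. x = w * q + r)"
  proof (cases "w = 0")
    case False
    then obtain q r where qr: "x = w * q + r" "r < w" using ex_div[of w x] zero_less_iff_neq_zero by blast
    then show ?thesis using False by (intro ex1I[of _ r]) (auto dest: div_unique)
  qed auto
  from theI'[OF this] this show ?thesis unfolding md_def[symmetric] by blast
qed

lemma dv_md: "0 < w \<Longrightarrow> x = w * dv x w + md x w" "0 < w \<Longrightarrow> md x w < w"
proof -
  assume w: "0 < w"
  then obtain r where r: "r < w" "x = w * dv x w + r" using dv_iff[of "dv x w" x w] by auto
  then have "r = md x w" unfolding md_iff by blast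
  with r show "x = w * dv x w + md x w" "md x w < w" by simp_all
qed

lemma dv_eqI: "x = w * q + r \<Longrightarrow> r < w \<Longrightarrow> dv x w = q"
  using dv_iff[of q x w] by auto

lemma rec2_dv: "rec2 dv"
  unfolding rec2_def dv_iff by (intro D1_S1 rec_intros) auto

lemma rec2_md: "rec2 md"
proof -
  have "r = md x w \<longleftrightarrow> w = 0 \<and> r = 0 \<or> r < w \<and> (\<exists>q. q \<le> x \<and> x = w * q + r)" for r x w
  proof -
    have "q \<le> x" if "r < w" "x = w * q + r" for q
    proof -
      have "1 * q \<le> w * q" using \<open>r < w\<close> by (intro mult_right_mono) (auto intro!: pos_imp_ge1 simp: zero_less_iff_neq_zero)
      then show ?thesis using that by (auto intro: order_trans)
    qed
    then show ?thesis unfolding md_iff by blast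
  qed
  then show ?thesis unfolding rec2_def by (simp only:) (intro D1_S1 rec_intros; auto)
qed

text \<open>The base enters as a parameter: \<open>pw b\<close> is obtained by recursion for each
  \<open>b\<close> separately, which matches the formula for powers.\<close>

definition pw :: "'m \<Rightarrow> 'm \<Rightarrow> 'm" where
  "pw b = (SOME F. rec1 F \<and> F 0 = 1 \<and> (\<forall>i. F (i + 1) = F i * b))"

lemma pw: "rec1 (pw b)" "pw b 0 = 1" "pw b (i + 1) = pw b i * b"
proof -
  have "rec2 (\<lambda>i y. y * b)" unfolding rec2_def by (intro D1_S1 rec_intros) auto
  from primitive_recursion[OF this]
  have "\<exists>F. rec1 F \<and> F 0 = 1 \<and> (\<forall>i. F (i + 1) = F i * b)" .
  from someI_ex[OF this] show "rec1 (pw b)" "pw b 0 = 1" "pw b (i + 1) = pw b i * b"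
    unfolding pw_def by auto
qed

lemma spow_iff: "spow b e p \<longleftrightarrow> p = pw b e"
proof
  assume "spow b e p"
  then obtain F where F: "rec1 F" "F 0 = 1" "\<And>i. F (i + 1) = F i * b" "F e = p"
    unfolding spow_def by blast
  have "F e = pw b e"
    by (rule D1_induct[of "\<lambda>e. F e = pw b e"])
      (intro D1_eq R_app1[OF F(1)] R_app1[OF pw(1)] R_var, simp_all add: F pw)
  with F(4) show "p = pw b e" by simp
qed (auto simp: spow_def pw intro!: exI[of _ "pw b"])

lemma pw_1: "pw b 1 = b"
  using pw(3)[of b 0] by (simp add: pw(2))

lemma pw_ge:
  assumes "2 \<le> b" shows "e + 1 \<le> pw b e"
proof (rule D1_induct[of "\<lambda>e. e + 1 \<le> pw b e"])
  fix e assume IH: "e + 1 \<le> pw b e"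
  have "e + 1 + 1 \<le> (e + 1) * 2" unfolding zi_simps distrib_right using zi_nonneg[of e] by linarith
  also have "\<dots> \<le> pw b e * b" using IH assms by (intro mult_mono) auto
  finally show "e + 1 + 1 \<le> pw b (e + 1)" by (simp add: pw)
qed (intro rec_intros R_app1[OF pw(1)], auto simp: pw)

lemma pw_mono:
  assumes "2 \<le> b" "i \<le> j" shows "pw b i \<le> pw b j"
proof -
  obtain k where k: "j = i + k" using assms(2) unfolding le_iff_add by blast
  have "pw b i \<le> pw b (i + k)"
  proof (rule D1_induct[of "\<lambda>k. pw b i \<le> pw b (i + k)"])
    fix k assume IH: "pw b i \<le> pw b (i + k)"
    have "1 \<le> b" using assms(1) by (rule order_trans[rotated]) simp
    then have "pw b (i + k) * 1 \<le> pw b (i + k) * b" by (intro mult_left_mono) auto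
    then show "pw b i \<le> pw b (i + (k + 1))" using IH pw(3)[of b "i + k"] by (simp add: add.assoc)
  qed (intro rec_intros R_app1[OF pw(1)], auto)
  then show ?thesis by (simp add: k)
qed

lemma sdec_iff:
  "sdec b n e a r \<longleftrightarrow> n < pw b (e + 1) \<and> 0 < a \<and> a < b \<and> r < pw b e \<and> n = pw b e * a + r"
proof -
  have "pw b e \<le> pw b e * a + r" if "0 < a" for a
    using mult_left_mono[OF pos_imp_ge1[OF that], of "pw b e"] by (simp add: add_increasing2)
  moreover have "sdec b n e a r \<longleftrightarrow> pw b e \<le> n \<and> n < pw b (e + 1) \<and> 0 < a \<and> a < b \<and> r < pw b e \<and>
      n = pw b e * a + r"
    unfolding sdec_def spow_iff by blast
  ultimately show ?thesis by blast
qed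

lemma sdec_less:
  assumes "2 \<le> b" "sdec b n e a r" shows "e < n" "r < n" "a < b" "pw b e \<le> n"
proof -
  show le: "pw b e \<le> n" using assms(2) unfolding sdec_def spow_iff by auto
  show "a < b" using assms(2) by (simp add: sdec_iff)
  show "e < n" using pw_ge[OF assms(1), of e] le by (simp add: less_iff_add1_le)
  have "r < pw b e" using assms(2) by (simp add: sdec_iff)
  then show "r < n" using le by (rule less_le_trans)
qed

lemma sdec_unique:
  assumes b: "2 \<le> b" and d: "sdec b n e a r" "sdec b n e' a' r'"
  shows "e = e' \<and> a = a' \<and> r = r'"
proof -
  have le: "e \<le> e'" if d: "sdec b n e a r" "sdec b n e' a' r'" for e a r e' a' r'
  proof (rule ccontr)
    assume "\<not> e \<le> e'"
    then have "pw b (e' + 1) \<le> pw b e" by (intro pw_mono[OF b]) (simp add: less_iff_add1_le not_le)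
    then show False using sdec_less(4)[OF b d(1)] d(2) by (auto simp: sdec_iff)
  qed
  have "e = e'" using le[OF d] le[OF d(2,1)] by (rule antisym)
  then show ?thesis using d div_unique[of "pw b e" a r a' r'] by (auto simp: sdec_iff)
qed

text \<open>The exponent is the greatest \<open>e\<close> with \<open>pw b e \<le> n\<close>. The
  search can be bounded by \<open>n\<close> since powers outgrow their exponents.\<close>

lemma ex_sdec:
  assumes b: "2 \<le> b" and n: "b \<le> n"
  shows "\<exists>e a r. sdec b n e a r"
proof -
  have "S1 1 (\<lambda>e. pw b (e 0) \<le> n)" by (intro D1_S1 rec_intros R_app1[OF pw(1)]) auto
  moreover have "pw b 0 \<le> n" unfolding pw(2)
    using b n by (meson one_le_numeral order_trans)
  ultimately obtain e where e: "pw b e \<le> n" "\<And>i. pw b i \<le> n \<Longrightarrow> i \<le> n \<Longrightarrow> i \<le> e"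
    using S1_greatest[of "\<lambda>e. pw b e \<le> n" 0 n] by auto
  have "n < pw b (e + 1)"
  proof (rule ccontr)
    assume "\<not> ?thesis"
    then have le: "pw b (e + 1) \<le> n" by simp
    then have "e + 1 \<le> n" using pw_ge[OF b, of "e + 1"] by (meson add_increasing2 less_imp_le less_add_one order_trans)
    from e(2)[OF le this] show False by (metis less_add_one not_le)
  qed
  moreover have pos: "0 < pw b e" using pw_ge[OF b, of e] by (meson add_nonneg_pos less_le_trans zero_le zero_less_one)
  obtain a r where ar: "n = pw b e * a + r" "r < pw b e" using ex_div[OF pos] by blast
  moreover have "0 < a"
  proof (rule ccontr)
    assume "\<not> 0 < a"
    then have "a = 0" by (simp add: not_less)
    then have "n = r" using ar(1) by simp
    then show False using ar(2) e(1) by simp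
  qed
  moreover have "a < b"
  proof (rule ccontr)
    assume "\<not> a < b"
    then have "pw b e * b \<le> pw b e * a" by (intro mult_left_mono) auto
    then have "pw b (e + 1) \<le> n" unfolding ar(1) pw(3) by (simp add: add_increasing2)
    then show False using \<open>n < pw b (e + 1)\<close> by simp
  qed
  ultimately show ?thesis unfolding sdec_iff by blast
qed

lemma ex_ssubst:
  assumes u: "rec1 u" and b: "2 \<le> b"
  shows "\<exists>v. ssubst u b c n v"
proof -
  \<comment> \<open>The clause of the substitution with the decomposition written out;
    \<open>e\<close>, \<open>a\<close> and \<open>r\<close> get bounds, whereas the values
    \<open>e'\<close> and \<open>r'\<close> are left unbounded, as a \<open>\<Sigma>\<^sub>1\<close>
    clause allows.\<close>
  let ?H = "\<lambda>x (g :: 'm \<Rightarrow> 'm \<Rightarrow> bool) y. x < b \<and> y = u x \<or> b \<le> x \<and>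
    (\<exists>e. e < x \<and> (\<exists>a. a < b \<and> (\<exists>r. r < x \<and> (x < pw b (e + 1) \<and> 0 < a \<and> a < b \<and> r < pw b e \<and> x = pw b e * a + r)
      \<and> (\<exists>e' r'. (g e e' \<and> g r r') \<and> y = pw c e' * u a + r'))))"
  have H: "?H x g y \<longleftrightarrow> x < b \<and> y = u x \<or> b \<le> x \<and> (\<exists>e a r e' r'. sdec b x e a r \<and>
    (g e e' \<and> g r r') \<and> y = pw c e' * u a + r')" for x g y
    unfolding sdec_iff[symmetric] using sdec_less[OF b] by blast
  have "\<exists>V. rec1 V \<and> (\<forall>x. ?H x (\<lambda>a b. V a = b) (V x))"
  proof (rule course_of_values[of ?H])
    show "S1 5 (\<lambda>e. ?H (e 0) (\<lambda>a b. cmem (pr a b) (e 1) (e 2) (e 3)) (e 4))"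
      by (intro S1_or S1_and S1_bex S1_ex D1_S1[OF D1_less] D1_S1[OF D1_le] D1_S1[OF D1_eq]
          D1_S1[OF D1_cmem] R_app1[OF u] R_app1[OF pw(1)] rec_intros') auto
  next
    fix x y :: 'm and g g' :: "'m \<Rightarrow> 'm \<Rightarrow> bool"
    assume g: "\<And>a b. a < x \<Longrightarrow> g a b = g' a b" and "?H x g y"
    then show "?H x g' y" unfolding H using sdec_less[OF b] by metis
  next
    fix x :: 'm and g :: "'m \<Rightarrow> 'm \<Rightarrow> bool"
    assume g: "\<And>a. a < x \<Longrightarrow> \<exists>!b. g a b"
    show "\<exists>!y. ?H x g y"
    proof (cases "x < b")
      case False
      then have "b \<le> x" by simp
      from ex_sdec[OF b this] obtain e a r where d: "sdec b x e a r" by blast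
      obtain e' where e': "g e e'" "\<And>z. g e z \<Longrightarrow> z = e'" using g[OF sdec_less(1)[OF b d]] by blast
      obtain r' where r': "g r r'" "\<And>z. g r z \<Longrightarrow> z = r'" using g[OF sdec_less(2)[OF b d]] by blast
      show ?thesis unfolding H
      proof (rule ex1I[of _ "pw c e' * u a + r'"])
        show "x < b \<and> pw c e' * u a + r' = u x \<or> b \<le> x \<and> (\<exists>d a' s d' s'. sdec b x d a' s \<and>
          (g d d' \<and> g s s') \<and> pw c e' * u a + r' = pw c d' * u a' + s')"
          using \<open>b \<le> x\<close> d e'(1) r'(1) by blast
        fix y assume "x < b \<and> y = u x \<or> b \<le> x \<and> (\<exists>e a r e' r'. sdec b x e a r \<and>
          (g e e' \<and> g r r') \<and> y = pw c e' * u a + r')"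
        then obtain d0 a0 r0 d' s' where "sdec b x d0 a0 r0" "g d0 d'" "g r0 s'" "y = pw c d' * u a0 + s'"
          using False by blast
        then show "y = pw c e' * u a + r'"
          using sdec_unique[OF b d] e'(2) r'(2) by blast
      qed
    qed auto
  qed
  then obtain V where V: "rec1 V" "\<And>x. ?H x (\<lambda>a b. V a = b) (V x)" by blast
  have "x < b \<Longrightarrow> V x = u x" for x using V(2)[of x] by auto
  moreover have "\<exists>e a r. sdec b x e a r \<and> (\<exists>p. spow c (V e) p \<and> V x = p * u a + V r)" if "b \<le> x" for x
    using V(2)[of x, unfolded H] that unfolding spow_iff by auto
  ultimately show ?thesis unfolding ssubst_def using V(1) by blast
qed

text \<open>A number below \<open>b * b\<close> has exponent at most 1, and the substituted exponent
  is \<open>u 1 = 1\<close>, so the power of \<open>c\<close> is \<open>c\<close> itself.\<close>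

lemma ssubst_value:
  assumes s: "ssubst u b c (b * a + r) v" and b: "2 \<le> b" and a: "0 < a" "a < b" and r: "r < b"
    and u1: "u 1 = 1"
  shows "v = c * u a + u r"
proof -
  from s obtain V where V': "\<forall>x. (x < b \<longrightarrow> V x = u x) \<and>
      (b \<le> x \<longrightarrow> (\<exists>e a r. sdec b x e a r \<and> (\<exists>p. p = pw c (V e) \<and> V x = p * u a + V r)))"
    and Vv: "V (b * a + r) = v"
    unfolding ssubst_def spow_iff by blast
  then have V: "\<And>x. x < b \<Longrightarrow> V x = u x"
    "\<And>x. b \<le> x \<Longrightarrow> \<exists>e a r. sdec b x e a r \<and> V x = pw c (V e) * u a + V r" by blast+
  have "b * a + r < b * (a + 1)" using r by (simp add: distrib_left)
  also have "\<dots> \<le> b * b" using a(2) by (intro mult_left_mono) (simp_all add: less_iff_add1_le)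
  finally have d: "sdec b (b * a + r) 1 a r"
    unfolding sdec_iff using a r pw(3)[of b 1] by (simp add: pw_1)
  have "b \<le> b * a + r" using sdec_less(4)[OF b d] by (simp add: pw_1)
  then obtain e' a' r' where "sdec b (b * a + r) e' a' r'" "V (b * a + r) = pw c (V e') * u a' + V r'"
    using V(2) by blast
  moreover from sdec_unique[OF b d this(1)] have "e' = 1" "a' = a" "r' = r" by auto
  moreover have "V 1 = 1" using V(1)[of 1] b u1 by (metis one_less_numeral_iff less_le_trans semiring_norm(76))
  ultimately show ?thesis using V(1)[OF r] Vv by (simp add: pw_1)
qed

lemma ssubst_iff:
  assumes "rec1 u" "2 \<le> b" "0 < a" "a < b" "r < b" "u 1 = 1"
  shows "ssubst u b c (b * a + r) v \<longleftrightarrow> v = c * u a + u r"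
proof -
  obtain w where w: "ssubst u b c (b * a + r) w" using ex_ssubst[OF assms(1,2)] ..
  have "w' = c * u a + u r" if "ssubst u b c (b * a + r) w'" for w'
    using ssubst_value[OF that] assms(2-) by blast
  with w show ?thesis by blast
qed

end

section \<open>One upgrade step\<close>

lemmas lin = zi_simps distrib_left distrib_right

context rca
begin

abbreviation dfn :: "('m \<Rightarrow> bool) \<Rightarrow> bool" where
  "dfn B \<equiv> D1 1 (\<lambda>e. B (e 0))"

text \<open>
  Let \<open>B\<close> be regular (\<open>reg\<close>) and \<open>j = b a + r\<close> with \<open>b\<close> the base of \<open>j\<close>. Then \<open>a < 3\<close> and the exponent is
  \<open>1\<close>, so that the substitution of \<open>c\<close> for \<open>b\<close> gives \<open>c a + q\<close>, where \<open>q\<close> is the value at \<open>r\<close>. In these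
  terms \<open>loc B C g j y\<close> is the recursive clause for the value \<open>y\<close> of the upgrade at \<open>j\<close>, given the
  graph \<open>g\<close> of the values below \<open>j\<close>.
\<close>

definition lS :: "('m \<Rightarrow> bool) \<Rightarrow> 'm \<Rightarrow> 'm \<Rightarrow> bool" where
  "lS C v c \<longleftrightarrow> (\<forall>s. s \<le> v \<longrightarrow> C s \<longrightarrow> s \<le> c)"

text \<open>By divisibility the next base is at least \<open>2 * b\<close>, and at least
  \<open>3 * b\<close> if \<open>2 * b\<close> is not a base. Membership of \<open>2 * b\<close> or
  \<open>3 * b\<close> thus determines it.\<close>

definition reg :: "('m \<Rightarrow> bool) \<Rightarrow> bool" where
  "reg B \<longleftrightarrow> (\<forall>b. B b \<longrightarrow> B (2 * b) \<or> B (3 * b) \<and> (\<forall>m. m < 3 \<longrightarrow> \<not> B m))"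

definition loc :: "('m \<Rightarrow> bool) \<Rightarrow> ('m \<Rightarrow> bool) \<Rightarrow> ('m \<Rightarrow> 'm \<Rightarrow> bool) \<Rightarrow> 'm \<Rightarrow> 'm \<Rightarrow> bool" where
  "loc B C g j y \<longleftrightarrow> (\<forall>x. x \<le> j \<longrightarrow> \<not> B x) \<and> y = j \<or>
    (\<exists>b. b \<le> j \<and> B b \<and> (\<forall>x. x \<le> j \<longrightarrow> B x \<longrightarrow> x \<le> b) \<and> (\<exists>a. a \<le> j \<and> (a = 1 \<or> a = 2) \<and>
      (\<exists>r. r < b \<and> j = b * a + r \<and> (\<exists>i. i < j \<and> j = i + 1 \<and> (\<exists>p q. (g i p \<and> g r q) \<and>
        (\<exists>c. c \<le> y \<and> C c \<and> p < c * a + q \<and> lS C (c * a + q) c \<and>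
          (\<forall>c'. c' < c \<longrightarrow> C c' \<longrightarrow> \<not> (p < c' * a + q \<and> lS C (c' * a + q) c')) \<and>
          y = c * a + q))))))"

lemma ex_next:
  assumes "dfn E" "E s" "n < s"
  obtains s0 where "snext E n s0" "s0 \<le> s"
proof -
  have "S1 1 (\<lambda>e. E (e 0) \<and> n < e 0)" by (intro D1_S1 rec_intros assms(1)) auto
  with S1_least[of "\<lambda>s. E s \<and> n < s" s] assms(2,3)
  obtain s0 where s0: "E s0" "n < s0" "\<And>z. z < s0 \<Longrightarrow> \<not> (E z \<and> n < z)" by blast
  then have "snext E n s0" unfolding snext_def by (meson not_le)
  moreover have "s0 \<le> s" using s0(3)[of s] assms(2,3) by (meson not_le)
  ultimately show ?thesis by (rule that)
qed

lemma slessS_iff: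
  assumes "dfn C" shows "slessS C v c \<longleftrightarrow> lS C v c"
proof
  assume l: "slessS C v c"
  show "lS C v c" unfolding lS_def
  proof (intro allI impI, rule ccontr)
    fix s assume s: "s \<le> v" "C s" "\<not> s \<le> c"
    then have "c < s" by simp
    then obtain s0 where "snext C c s0" "s0 \<le> s" using ex_next[OF assms s(2)] by blast
    then have "v < s" using l unfolding slessS_def by (meson less_le_trans)
    then show False using s(1) by simp
  qed
next
  assume "lS C v c" then show "slessS C v c" unfolding lS_def slessS_def snext_def by (meson not_le)
qed

lemma sbh_gt1: "sbh E \<Longrightarrow> E b \<Longrightarrow> 2 \<le> b"
  unfolding sbh_def by (metis less_imp_add1_le one_add_one)

lemma next_ge:
  assumes E: "dfn E" "sbh E" "E c" and s: "E s" "c < s"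
  shows "2 * c \<le> s" "\<not> E (2 * c) \<Longrightarrow> 3 * c \<le> s"
proof -
  obtain s0 where s0: "snext E c s0" "s0 \<le> s" using ex_next[OF E(1) s] by blast
  then have "c dvd s0" using E(2,3) by (auto simp: sbh_def)
  then obtain z where z: "s0 = c * z" ..
  have "c < s0" "E s0" using s0(1) by (auto simp: snext_def)
  have "1 < z"
  proof (rule ccontr)
    assume "\<not> 1 < z"
    then have "c * z \<le> c * 1" by (intro mult_left_mono) auto
    then show False using z \<open>c < s0\<close> by simp
  qed
  then have z2: "2 \<le> z" using less_imp_add1_le[of 1 z] by simp
  then have "c * 2 \<le> c * z" by (intro mult_left_mono) auto
  then show "2 * c \<le> s" using z s0(2) by (simp add: mult.commute)
  assume "\<not> E (2 * c)"
  then have "z \<noteq> 2" using \<open>E s0\<close> z by (auto simp: mult.commute)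
  then have "2 < z" using z2 by simp
  then have "3 \<le> z" using less_imp_add1_le[of 2 z] by simp
  then have "c * 3 \<le> c * z" by (intro mult_left_mono) auto
  then show "3 * c \<le> s" using z s0(2) by (simp add: mult.commute)
qed

lemma smin_unique: "smin E m \<Longrightarrow> smin E m' \<Longrightarrow> m = m'"
  unfolding smin_def by (meson antisym)

lemma loc_det:
  assumes "loc B C g j y" "loc B C g' j y'"
    and g: "\<And>i p q. i < j \<Longrightarrow> g i p \<Longrightarrow> g' i q \<Longrightarrow> p = q"
  shows "y = y'"
proof (cases "\<exists>x. x \<le> j \<and> B x")
  case True
  then obtain b a r i p q c where 1: "b \<le> j" "B b" "\<And>x. x \<le> j \<Longrightarrow> B x \<Longrightarrow> x \<le> b" "r < b" "j = b * a + r"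
    "j = i + 1" "g i p" "g r q" "C c" "p < c * a + q" "lS C (c * a + q) c"
    "\<And>c'. c' < c \<Longrightarrow> C c' \<Longrightarrow> \<not> (p < c' * a + q \<and> lS C (c' * a + q) c')" "y = c * a + q"
    using assms(1) unfolding loc_def by blast
  obtain b' a' r' i' p' q' c' where 2: "b' \<le> j" "B b'" "\<And>x. x \<le> j \<Longrightarrow> B x \<Longrightarrow> x \<le> b'" "r' < b'" "j = b' * a' + r'"
    "j = i' + 1" "g' i' p'" "g' r' q'" "C c'" "p' < c' * a' + q'" "lS C (c' * a' + q') c'"
    "\<And>c. c < c' \<Longrightarrow> C c \<Longrightarrow> \<not> (p' < c * a' + q' \<and> lS C (c * a' + q') c)" "y' = c' * a' + q'"
    using True assms(2) unfolding loc_def by blast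
  have "b = b'" using 1(1,2,3) 2(1,2,3) by (meson antisym)
  moreover from this have "a = a'" "r = r'" using div_unique[of b a r a' r'] 1(4,5) 2(4,5) by auto
  moreover have "i = i'" using 1(6) 2(6) by simp
  moreover have "i < j" using 1(6) by simp
  moreover have "r < j" using 1(1,4) by (meson less_le_trans)
  ultimately have "p = p'" "q = q'" using g 1(7,8) 2(7,8) by blast+
  then have "c = c'" using 1(9-12) 2(9-12) \<open>a = a'\<close> by (metis linorder_neqE)
  then show ?thesis using 1(13) 2(13) \<open>a = a'\<close> \<open>q = q'\<close> by simp
next
  case False
  then show ?thesis using assms unfolding loc_def by blast
qed

lemma loc_cong:
  assumes "loc B C g j y" "\<And>i b. i < j \<Longrightarrow> g i b \<longleftrightarrow> g' i b"
  shows "loc B C g' j y"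
proof (cases "\<exists>x. x \<le> j \<and> B x")
  case True
  then obtain b a r i p q c where 1: "b \<le> j" "B b" "\<forall>x. x \<le> j \<longrightarrow> B x \<longrightarrow> x \<le> b" "a \<le> j"
    "a = 1 \<or> a = 2" "r < b" "j = b * a + r" "i < j" "j = i + 1" "g i p" "g r q" "c \<le> y" "C c" "p < c * a + q"
    "lS C (c * a + q) c"
    "\<forall>c'. c' < c \<longrightarrow> C c' \<longrightarrow> \<not> (p < c' * a + q \<and> lS C (c' * a + q) c')" "y = c * a + q"
    using assms(1) unfolding loc_def by blast
  have "r < j" using 1(1,6) by (meson less_le_trans)
  then have "g' i p" "g' r q" using 1(8,10,11) assms(2) by auto
  with 1 show ?thesis unfolding loc_def by blast
qed (use assms(1) in \<open>auto simp: loc_def\<close>)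

end

section \<open>The upgrade between two successive hierarchies\<close>

locale good_step = rca f for f :: "nat \<Rightarrow> 'm::{disc_semidom,countable} set" +
  fixes B C :: "'m \<Rightarrow> bool"
  assumes dB: "dfn B" and dC: "dfn C" and bhB: "sbh B" and bhC: "sbh C"
    and regB: "reg B" and good: "sgood B C"
begin

definition mB where "mB = (THE m. smin B m)"
definition mC where "mC = (THE m. smin C m)"

lemma mins: "smin B mB" "smin C mC" "mB \<le> mC" "2 \<le> mB"
proof -
  obtain m m' where m: "smin B m" "smin C m'" "m \<le> m'" using good by (auto simp: sgood_def)
  have "mB = m" unfolding mB_def by (rule the_equality[of "smin B", OF m(1)]) (rule smin_unique[OF _ m(1)])
  moreover have "mC = m'"
    unfolding mC_def by (rule the_equality[of "smin C", OF m(2)]) (rule smin_unique[OF _ m(2)])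
  ultimately show "smin B mB" "smin C mC" "mB \<le> mC" using m by auto
  then show "2 \<le> mB" using sbh_gt1[OF bhB] by (auto simp: smin_def)
qed

lemma ex_base:
  assumes "mB \<le> j"
  obtains b where "B b" "b \<le> j" "\<And>x. B x \<Longrightarrow> x \<le> j \<Longrightarrow> x \<le> b"
proof -
  have "S1 1 (\<lambda>e. B (e 0))" using dB by (rule D1_S1)
  from S1_greatest[of B, OF this _ assms] mins(1) show ?thesis
    by (auto simp: smin_def intro: that)
qed

lemma no_base: "j < mB \<Longrightarrow> B x \<Longrightarrow> x \<le> j \<Longrightarrow> False"
  using mins(1) unfolding smin_def by (meson not_le le_less_trans)

text \<open>The digit 2 occurs only in front of a base with quotient 3, and then regularity makes
  all bases at least 3. So in both cases the digit is below \<open>mB\<close> and is fixed by the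
  upgrade.\<close>

lemma digits:
  assumes b: "B b" "b \<le> j" "\<And>x. B x \<Longrightarrow> x \<le> j \<Longrightarrow> x \<le> b"
  obtains a r where "a = 1 \<or> a = 2" "r < b" "j = b * a + r" "a < mB" "a \<le> j"
proof -
  have b2: "2 \<le> b" using sbh_gt1[OF bhB b(1)] .
  show ?thesis
  proof (cases "j < 2 * b")
    case True
    obtain r where r: "j = b + r" using b(2) unfolding le_iff_add by blast
    show ?thesis
    proof (rule that[of 1 r])
      show "r < b" using True r by (simp add: mult_2)
      show "1 < mB" using mins(4) by (meson less_le_trans one_less_numeral_iff semiring_norm(76))
      show "1 \<le> j" using b2 b(2) by (meson one_le_numeral order_trans)
    qed (use r in auto)
  next
    case False
    then have "2 * b \<le> j" by simp
    have nB: "\<not> B (2 * b)"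
    proof
      assume "B (2 * b)"
      from b(3)[OF this \<open>2 * b \<le> j\<close>] b2 show False unfolding lin by linarith
    qed
    then have B3: "B (3 * b)" "\<And>m. m < 3 \<Longrightarrow> \<not> B m" using regB b(1) by (auto simp: reg_def)
    have "\<not> 3 * b \<le> j"
    proof
      assume "3 * b \<le> j"
      from b(3)[OF B3(1) this] b2 show False unfolding lin by linarith
    qed
    then have "j < 3 * b" by simp
    obtain r where r: "j = 2 * b + r" using \<open>2 * b \<le> j\<close> unfolding le_iff_add by blast
    show ?thesis
    proof (rule that[of 2 r])
      show "r < b" using \<open>j < 3 * b\<close> unfolding r lin by linarith
      show "2 < mB"
      proof (rule ccontr)
        assume "\<not> 2 < mB"
        then have "mB \<le> 2" by simp
        then have "mB < 3" unfolding lin by linarith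
        then show False using B3(2) mins(1) by (auto simp: smin_def)
      qed
      show "2 \<le> j" using b2 b(2) by simp
    qed (use r in \<open>auto simp: mult.commute\<close>)
  qed
qed

text \<open>The digit and the exponent 1 are below \<open>mB\<close> and are thus their own values.
  By \<open>ssubst_iff\<close>, admissibility of \<open>c\<close> becomes an inequality between
  numbers.\<close>

lemma witness_loc:
  assumes u: "rec1 u" and up: "smin B m" "\<And>j. j \<le> n \<Longrightarrow> (j < m \<longrightarrow> u j = j) \<and>
       (m \<le> j \<longrightarrow> (\<exists>b c y. sbase B j b \<and> sadm C u j b c \<and>
         (\<forall>c'. c' < c \<longrightarrow> \<not> sadm C u j b c') \<and> ssubst u b c j y \<and> u j = y))"
    and j: "j \<le> n"
  shows "loc B C (\<lambda>a b. u a = b) j (u j)"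
proof (cases "j < mB")
  case True
  have "m = mB" using up(1) mins(1) by (rule smin_unique)
  then have "u j = j" using up(2)[OF j] True by blast
  moreover have "\<forall>x. x \<le> j \<longrightarrow> \<not> B x" using no_base[OF True] by blast
  ultimately show ?thesis unfolding loc_def by blast
next
  case False
  have m: "m = mB" using up(1) mins(1) by (rule smin_unique)
  then obtain b c where bc: "sbase B j b" "sadm C u j b c" "\<And>c'. c' < c \<Longrightarrow> \<not> sadm C u j b c'"
    "ssubst u b c j (u j)" using up(2)[OF j] False by auto
  have b: "B b" "b \<le> j" "\<And>x. B x \<Longrightarrow> x \<le> j \<Longrightarrow> x \<le> b"
    using bc(1) smin_unique[OF mins(1)] False unfolding sbase_def by auto
  obtain a r where ar: "a = 1 \<or> a = 2" "r < b" "j = b * a + r" "a < mB" "a \<le> j"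
    using digits[OF b] by blast
  have bm: "mB \<le> b" using b(1) mins(1) by (auto simp: smin_def)
  then have b2: "2 \<le> b" using mins(4) by (rule order_trans[rotated])
  have ab: "0 < a" "a < b" using ar(1) less_le_trans[OF ar(4) bm] by auto
  have small: "u x = x" if "x < mB" for x
    using up(2)[of x] that False j m by (meson less_imp_le not_le order_trans)
  have "1 < mB" using mins(4) by (meson less_le_trans one_less_numeral_iff semiring_norm(76))
  then have u1: "u 1 = 1" and ua: "u a = a" using small ar(4) by auto
  have sub: "ssubst u b c' j v \<longleftrightarrow> v = c' * a + u r" for c' v
    unfolding ar(3) using ssubst_iff[OF u b2 ab ar(2) u1] by (simp add: ua)
  have adm: "sadm C u j b c' \<longleftrightarrow> C c' \<and> (\<exists>i. j = i + 1 \<and> u i < c' * a + u r \<and> lS C (c' * a + u r) c')" for c'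
    unfolding sadm_def sub slessS_iff[OF dC] by auto
  obtain i where i: "j = i + 1" "C c" "u i < c * a + u r" "lS C (c * a + u r) c"
    using bc(2) unfolding adm by blast
  have "\<not> (u i < c' * a + u r \<and> lS C (c' * a + u r) c')" if "c' < c" "C c'" for c'
    using bc(3)[OF that(1)] that(2) i(1) unfolding adm by blast
  moreover have uj: "u j = c * a + u r" using bc(4) unfolding sub .
  moreover have "c \<le> u j"
  proof -
    have "c * 1 \<le> c * a" using ab(1) by (intro mult_left_mono pos_imp_ge1) auto
    then show ?thesis unfolding uj by (simp add: add_increasing2)
  qed
  moreover have "i < j" using i(1) by simp
  ultimately show ?thesis unfolding loc_def using b ar i by blast
qed

definition U where "U n = (THE v. supg B C n v)"

lemma witness_agree:
  assumes "rec1 u" "rec1 u'" "\<And>j. j \<le> n \<Longrightarrow> loc B C (\<lambda>a b. u a = b) j (u j)"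
    "\<And>j. j \<le> n' \<Longrightarrow> loc B C (\<lambda>a b. u' a = b) j (u' j)" "j \<le> n" "j \<le> n'"
  shows "u j = u' j"
proof -
  have "j \<le> n \<longrightarrow> j \<le> n' \<longrightarrow> u j = u' j"
  proof (rule D1_strong_induct[of "\<lambda>j. j \<le> n \<longrightarrow> j \<le> n' \<longrightarrow> u j = u' j"])
    fix j assume IH: "\<And>i. i < j \<Longrightarrow> i \<le> n \<longrightarrow> i \<le> n' \<longrightarrow> u i = u' i"
    show "j \<le> n \<longrightarrow> j \<le> n' \<longrightarrow> u j = u' j"
    proof (intro impI)
      assume j: "j \<le> n" "j \<le> n'"
      show "u j = u' j"
        by (rule loc_det[OF assms(3)[OF j(1)] assms(4)[OF j(2)]])
          (use IH j in \<open>auto dest: less_imp_le intro: order_trans\<close>)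
    qed
  qed (intro rec_intros R_app1[OF assms(1)] R_app1[OF assms(2)], auto)
  then show ?thesis using assms(5,6) by blast
qed

lemma supg_witness:
  assumes "supg B C n v"
  obtains u where "rec1 u" "\<And>j. j \<le> n \<Longrightarrow> loc B C (\<lambda>a b. u a = b) j (u j)" "u n = v"
proof -
  from assms obtain u m where u: "rec1 u" "smin B m" "u n = v" "\<And>j. j \<le> n \<Longrightarrow> (j < m \<longrightarrow> u j = j) \<and>
       (m \<le> j \<longrightarrow> (\<exists>b c y. sbase B j b \<and> sadm C u j b c \<and>
         (\<forall>c'. c' < c \<longrightarrow> \<not> sadm C u j b c') \<and> ssubst u b c j y \<and> u j = y))"
    unfolding supg_def by blast
  from u(1) witness_loc[OF u(1,2,4)] u(3) show ?thesis by (rule that)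
qed

lemma supg_iff: "supg B C n v \<longleftrightarrow> v = U n"
proof -
  obtain w where w: "supg B C n w" using good unfolding sgood_def by blast
  have "v = w" if v: "supg B C n v" for v
  proof -
    obtain u where u: "rec1 u" "\<And>j. j \<le> n \<Longrightarrow> loc B C (\<lambda>a b. u a = b) j (u j)" "u n = v"
      using supg_witness[OF v] by blast
    obtain u' where u': "rec1 u'" "\<And>j. j \<le> n \<Longrightarrow> loc B C (\<lambda>a b. u' a = b) j (u' j)" "u' n = w"
      using supg_witness[OF w] by blast
    show ?thesis using witness_agree[OF u(1) u'(1) u(2) u'(2), of n n n] u(3) u'(3) by simp
  qed
  with w have "\<exists>!v. supg B C n v" by blast
  from theI'[OF this] this show ?thesis unfolding U_def by blast
qed

lemma ex_witness:
  "\<exists>u. rec1 u \<and> (\<forall>j\<le>n. u j = U j) \<and> (\<forall>j\<le>n. loc B C (\<lambda>a b. u a = b) j (u j))"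
proof -
  have "supg B C n (U n)" by (simp add: supg_iff)
  then obtain u where u: "rec1 u" "\<And>j. j \<le> n \<Longrightarrow> loc B C (\<lambda>a b. u a = b) j (u j)"
    using supg_witness by blast
  have "u j = U j" if "j \<le> n" for j
  proof -
    have "supg B C j (U j)" by (simp add: supg_iff)
    then obtain u' where u': "rec1 u'" "\<And>i. i \<le> j \<Longrightarrow> loc B C (\<lambda>a b. u' a = b) i (u' i)" "u' j = U j"
      using supg_witness by blast
    show ?thesis using witness_agree[OF u(1) u'(1) u(2) u'(2), of n j j] that u'(3) by simp
  qed
  with u show ?thesis by blast
qed

lemma U_loc: "loc B C (\<lambda>a b. U a = b) j (U j)"
proof -
  obtain u where u: "\<And>i. i \<le> j \<Longrightarrow> u i = U i" "\<And>i. i \<le> j \<Longrightarrow> loc B C (\<lambda>a b. u a = b) i (u i)"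
    using ex_witness[of j] by blast
  have "loc B C (\<lambda>a b. U a = b) j (u j)"
    by (rule loc_cong[OF u(2)]) (simp_all add: u(1) less_imp_le)
  then show ?thesis by (simp add: u(1))
qed

text \<open>\<open>U\<close> is defined through set quantifiers, so it is not yet known to be
  recursive and induction does not apply to it directly. Up to \<open>N\<close> it agrees with a
  recursive function \<open>u\<close>, for which the induction is carried out; \<open>cong\<close>
  moves the property between the two.\<close>

lemma U_induct:
  assumes P: "\<And>u. rec1 u \<Longrightarrow> D1 1 (\<lambda>e. P u (e 0))"
    and cong: "\<And>u u' x. (\<And>j. j \<le> N \<Longrightarrow> u j = u' j) \<Longrightarrow> x \<le> N \<Longrightarrow> P u x \<Longrightarrow> P u' x"
    and step: "\<And>x. x \<le> N \<Longrightarrow> (\<And>y. y < x \<Longrightarrow> P U y) \<Longrightarrow> P U x"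
  shows "P U N"
proof -
  obtain u where u: "rec1 u" "\<And>j. j \<le> N \<Longrightarrow> u j = U j" using ex_witness[of N] by blast
  have "N \<le> N \<longrightarrow> P u N"
  proof (rule D1_strong_induct[of "\<lambda>x. x \<le> N \<longrightarrow> P u x"])
    show "D1 1 (\<lambda>e. e 0 \<le> N \<longrightarrow> P u (e 0))" by (intro rec_intros P u(1)) auto
    fix x assume IH: "\<And>y. y < x \<Longrightarrow> y \<le> N \<longrightarrow> P u y"
    show "x \<le> N \<longrightarrow> P u x"
    proof
      assume x: "x \<le> N"
      have "P U y" if "y < x" for y
      proof (rule cong[of u])
        show "y \<le> N" using that x by simp
        then show "P u y" using IH that by blast
      qed (rule u(2))
      then have "P U x" by (rule step[OF x])
      then show "P u x" by (rule cong[rotated 2]) (simp_all add: u(2) x)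
    qed
  qed
  then show ?thesis using cong[of u U N] u(2) by blast
qed

lemma U_small: assumes "j < mB" shows "U j = j"
proof -
  have "\<forall>x. x \<le> j \<longrightarrow> \<not> B x" using no_base[OF assms] by blast
  with U_loc[of j] show ?thesis unfolding loc_def by blast
qed

lemma U_0 [simp]: "U 0 = 0"
  using U_small[of 0] less_le_trans[OF zero_less_numeral mins(4)] by simp

lemma U_step:
  assumes b: "B b" and base: "\<And>x. B x \<Longrightarrow> x \<le> b * a + r \<Longrightarrow> x \<le> b"
    and ar: "a = 1 \<or> a = 2" "r < b" and i: "b * a + r = i + 1"
  obtains c where "C c" "U i < c * a + U r" "lS C (c * a + U r) c"
    "\<And>c'. c' < c \<Longrightarrow> C c' \<Longrightarrow> \<not> (U i < c' * a + U r \<and> lS C (c' * a + U r) c')"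
    "U (b * a + r) = c * a + U r"
proof -
  have bj: "b \<le> b * a + r" using ar(1) by (auto simp: mult_2_right add.assoc)
  from U_loc[of "b * a + r"] b bj obtain b' a' r' i' c where
    *: "b' \<le> b * a + r" "B b'" "\<And>x. x \<le> b * a + r \<Longrightarrow> B x \<Longrightarrow> x \<le> b'" "r' < b'" "b * a + r = b' * a' + r'"
      "b * a + r = i' + 1" "C c" "U i' < c * a' + U r'" "lS C (c * a' + U r') c"
      "\<And>c'. c' < c \<Longrightarrow> C c' \<Longrightarrow> \<not> (U i' < c' * a' + U r' \<and> lS C (c' * a' + U r') c')"
      "U (b * a + r) = c * a' + U r'"
    unfolding loc_def by blast
  have "b' = b" using *(1-3) base[of b'] b bj by (meson antisym)
  moreover from this have "a' = a" "r' = r" using div_unique[of b a r a' r'] *(4,5) ar(2) by auto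
  moreover have "i' = i" using *(6) i by simp
  ultimately show ?thesis using that[of c] * by blast
qed

lemma U_Suc: "U i < U (i + 1)"
proof (cases "i + 1 < mB")
  case True
  then show ?thesis using U_small[of i] U_small[of "i + 1"] by (metis less_add_one less_trans)
next
  case False
  then have "mB \<le> i + 1" by simp
  then obtain b where b: "B b" "b \<le> i + 1" "\<And>x. B x \<Longrightarrow> x \<le> i + 1 \<Longrightarrow> x \<le> b"
    using ex_base by blast
  obtain a r where ar: "a = 1 \<or> a = 2" "r < b" "i + 1 = b * a + r" using digits[OF b] by blast
  obtain c where "U i < c * a + U r" "U (b * a + r) = c * a + U r"
    using U_step[OF b(1) _ ar(1,2), of i] b(3) ar(3) by metis
  then show ?thesis by (simp add: ar(3))
qed

lemma U_mono: assumes "i < j" shows "U i < U j"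
proof -
  have "i < j \<longrightarrow> U i < U j"
  proof (rule U_induct[of "\<lambda>u x. i < x \<longrightarrow> u i < u x"])
    fix x assume IH: "\<And>y. y < x \<Longrightarrow> i < y \<longrightarrow> U i < U y"
    show "i < x \<longrightarrow> U i < U x"
    proof
      assume "i < x"
      then obtain y where y: "x = y + 1" using zero_or_add1[of x] by auto
      then have "i = y \<or> i < y" using \<open>i < x\<close> by (auto simp: less_add1_iff le_less)
      then show "U i < U x"
      proof
        assume "i < y"
        then have "U i < U y" using IH[of y] y by simp
        then show ?thesis using U_Suc[of y] y by simp
      qed (use U_Suc y in auto)
    qed
  next
    fix u :: "'m \<Rightarrow> 'm" assume u: "rec1 u"
    show "D1 1 (\<lambda>e. i < e 0 \<longrightarrow> u i < u (e 0))" by (intro rec_intros R_app1[OF u]) auto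
  next
    fix u u' :: "'m \<Rightarrow> 'm" and x
    assume "\<And>k. k \<le> j \<Longrightarrow> u k = u' k" "x \<le> j" "i < x \<longrightarrow> u i < u x"
    then show "i < x \<longrightarrow> u' i < u' x" by (metis less_imp_le order_trans)
  qed
  with assms show ?thesis by blast
qed

lemma U_mono_le: "i \<le> j \<Longrightarrow> U i \<le> U j"
  using U_mono by (auto simp: le_less)

lemma U_ge: "j \<le> U j"
proof (rule U_induct[of "\<lambda>u x. x \<le> u x"])
  fix x assume IH: "\<And>y. y < x \<Longrightarrow> y \<le> U y"
  show "x \<le> U x"
  proof (cases "x = 0")
    case False
    then obtain y where y: "x = y + 1" using zero_or_add1 by blast
    then have "y \<le> U y" using IH by simp
    then show ?thesis using U_Suc[of y] y by (simp add: less_iff_add1_le order_trans[of _ "U y + 1"])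
  qed simp
next
  fix u :: "'m \<Rightarrow> 'm" assume u: "rec1 u"
  show "D1 1 (\<lambda>e. e 0 \<le> u (e 0))" by (intro rec_intros R_app1[OF u]) auto
qed auto

text \<open>At a base the digit is 1 and the remainder 0, so the candidate value is \<open>c\<close>
  itself, which is trivially below the next element of \<open>C\<close>. What remains is to exceed
  the previous value.\<close>

lemma U_base:
  assumes b: "B b"
  obtains i where "b = i + 1" "C (U b)" "U i < U b" "\<And>c. C c \<Longrightarrow> U i < c \<Longrightarrow> U b \<le> c"
proof -
  have "b \<noteq> 0" using sbh_gt1[OF bhB b] by auto
  then obtain i where i: "b = i + 1" using zero_or_add1 by blast
  have "0 < b" using \<open>b \<noteq> 0\<close> by (simp add: zero_less_iff_neq_zero)
  from U_step[OF b _ _ this, of 1 i] i obtain c where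
    c: "C c" "U i < c" "U b = c" "\<And>c'. c' < c \<Longrightarrow> C c' \<Longrightarrow> \<not> (U i < c' \<and> lS C c' c')"
    by auto
  have "c \<le> c'" if "C c'" "U i < c'" for c'
    using c(4)[OF _ that(1)] that(2) by (auto simp: lS_def not_le[symmetric])
  with c i show ?thesis using that by blast
qed

text \<open>The same \<open>c\<close> is selected throughout the block. It stays admissible, since
  \<open>U x < U b \<le> c\<close> keeps the value below the next element of \<open>C\<close>. A
  smaller admissible \<open>d\<close> would have its value below \<open>c\<close>, hence below the
  value already reached.\<close>

lemma U_block:
  assumes b: "B b" and a: "a = 1 \<or> a = 2" and base: "\<And>x. B x \<Longrightarrow> b < x \<Longrightarrow> b * a + b \<le> x"
    and c: "C c" "U (b * a) = c * a" "U b \<le> c" "\<And>s. C s \<Longrightarrow> c < s \<Longrightarrow> c * a + c \<le> s"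
    and r: "r < b"
  shows "U (b * a + r) = c * a + U r"
proof -
  let ?P = "\<lambda>u x. x < b \<longrightarrow> u (b * a + x) = c * a + u x"
  have below: "U x < c" if "x < b" for x using U_mono[OF that] c(3) by (rule less_le_trans)
  have lSc: "lS C (c * a + U x) c" if "x < b" for x
    unfolding lS_def
  proof (intro allI impI, rule ccontr)
    fix s assume s: "s \<le> c * a + U x" "C s" "\<not> s \<le> c"
    then have "c * a + c \<le> s" using c(4) by simp
    then have "c * a + c \<le> c * a + U x" using s(1) by (rule order_trans)
    then show False using below[OF that] by (simp add: not_le[symmetric])
  qed
  have step: "U (b * a + x) = c * a + U x" if x: "x < b" "x = y + 1" and IH: "U (b * a + y) = c * a + U y" for x y
  proof -
    have bs: "z \<le> b" if "B z" "z \<le> b * a + x" for z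
    proof (rule ccontr)
      assume "\<not> z \<le> b"
      then have "b * a + b \<le> z" using base \<open>B z\<close> by simp
      then have "b * a + b \<le> b * a + x" using that(2) by (rule order_trans)
      then show False using x(1) by (simp add: not_le[symmetric])
    qed
    have eq: "b * a + x = (b * a + y) + 1" using x(2) by (simp add: add.assoc)
    obtain d where d: "C d" "U (b * a + y) < d * a + U x" "lS C (d * a + U x) d"
      "\<And>c'. c' < d \<Longrightarrow> C c' \<Longrightarrow> \<not> (U (b * a + y) < c' * a + U x \<and> lS C (c' * a + U x) c')"
      "U (b * a + x) = d * a + U x"
      using U_step[OF b bs a x(1) eq] by blast
    have "U y < U x" using x(2) by (simp add: U_mono)
    then have "U (b * a + y) < c * a + U x" unfolding IH by simp
    with d(4)[of c] c(1) lSc[OF x(1)] have "d \<le> c" by (meson not_le)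
    moreover have "c \<le> d"
    proof (rule ccontr)
      assume "\<not> c \<le> d"
      then have "\<not> c \<le> d * a + U x" using d(3) c(1) unfolding lS_def by blast
      then have "d * a + U x < c" by simp
      moreover have "c \<le> c * a" using a by (auto simp: mult_2_right)
      moreover have "c * a \<le> U (b * a + y)" unfolding IH by simp
      ultimately show False using d(2) by (meson less_le_trans less_trans less_irrefl)
    qed
    ultimately show ?thesis using d(5) by simp
  qed
  obtain u where u: "rec1 u" "\<And>j. j \<le> b * a + b \<Longrightarrow> u j = U j" using ex_witness by blast
  have small: "x \<le> b * a + b" "b * a + x \<le> b * a + b" if "x < b" for x
    using that by (auto intro: order_trans[of x b] dest: less_imp_le)
  have "?P u r"
  proof (rule D1_induct[of "?P u"])
    show "D1 1 (\<lambda>e. ?P u (e 0))" by (intro rec_intros R_app1[OF u(1)]) auto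
    show "?P u 0" using c(2) u(2) by simp
    fix x assume IH: "?P u x"
    show "?P u (x + 1)"
    proof
      assume x: "x + 1 < b"
      then have x': "x < b" by (meson less_add_one less_trans)
      have "U (b * a + x) = c * a + U x" using IH x' small[OF x'] by (simp add: u(2))
      from step[OF x refl this] show "u (b * a + (x + 1)) = c * a + u (x + 1)"
        using small[OF x] by (simp add: u(2))
    qed
  qed
  then show ?thesis using r small[OF r] by (simp add: u(2))
qed

lemma U_add:
  assumes b: "B b" and r: "r < b" shows "U (b + r) = U b + U r"
proof -
  obtain i where i: "C (U b)" using U_base[OF b] by blast
  have "U (b * 1 + r) = U b * 1 + U r"
  proof (rule U_block[OF b _ _ i _ _ _ r])
    show "b * 1 + b \<le> x" if "B x" "b < x" for x using next_ge(1)[OF dB bhB b that] by (simp add: mult_2)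
    show "U b * 1 + U b \<le> s" if "C s" "U b < s" for s using next_ge(1)[OF dC bhC i that] by (simp add: mult_2)
  qed auto
  then show ?thesis by simp
qed

text \<open>Clause (3) of good successors in positive form: a multiple of the base beyond
  \<open>U i\<close> yields an element of \<open>C\<close> no later than that multiple.\<close>

lemma no_multiple:
  assumes "B (i + 1)" "mB \<le> i" "C d" "d \<le> U i" "\<And>x. C x \<Longrightarrow> x \<le> U i \<Longrightarrow> x \<le> d" "d dvd y" "U i < y"
  obtains s where "C s" "U i < s" "s \<le> y"
proof -
  have "mC \<le> d" using mins(2) assms(3) by (auto simp: smin_def)
  then have "sbase C (U i) d" unfolding sbase_def using mins(2) assms(3-5) by (meson order_trans)
  moreover have "mB < i + 1" using assms(2) by (simp add: less_add1_iff)
  ultimately have "\<not> slessS C y (U i)"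
    using good mins(1) assms(1,6,7) unfolding sgood_def supg_iff by blast
  then show ?thesis unfolding slessS_def snext_def using that by (meson not_le)
qed

lemma base_pred:
  assumes "B b" "n * b = i + 1" "2 \<le> n" shows "mB \<le> i"
proof -
  have "mB \<le> b" using assms(1) mins(1) by (auto simp: smin_def)
  have "2 * b \<le> n * b" using assms(3) by (rule mult_right_mono) simp
  then have "b + b \<le> i + 1" using assms(2) by (simp add: mult_2)
  then show ?thesis using \<open>mB \<le> b\<close> mins(4) unfolding lin by linarith
qed

text \<open>The value at \<open>2 * b - 1\<close> is \<open>U b + U (b - 1)\<close>, which lies
  below the multiple \<open>2 * U b\<close> of its base \<open>U b\<close>. So \<open>C\<close> has
  an element up to \<open>2 * U b\<close>, and by divisibility it cannot be smaller.\<close>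

lemma U_double:
  assumes b: "B b" and b2: "B (2 * b)"
  shows "U (2 * b) = 2 * U b" "C (2 * U b)"
proof -
  have cb: "C (U b)" using U_base[OF b] by blast
  have c2b: "C (U (2 * b))" using U_base[OF b2] by blast
  obtain j where j: "b = j + 1" using U_base[OF b] by blast
  have "j < b" using j by simp
  have eq: "2 * b = (b + j) + 1" using j unfolding lin by linarith
  have Uj: "U (b + j) = U b + U j" by (rule U_add[OF b \<open>j < b\<close>])
  have lt: "U (b + j) < 2 * U b" using U_mono[OF \<open>j < b\<close>] unfolding Uj mult_2 by simp
  have "B (b + j + 1)" using b2 eq by simp
  moreover have "mB \<le> b + j" by (rule base_pred[OF b eq]) simp
  moreover have le: "U b \<le> U (b + j)" unfolding Uj by simp
  moreover have "x \<le> U b" if "C x" "x \<le> U (b + j)" for x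
  proof (rule ccontr)
    assume "\<not> x \<le> U b"
    then have "2 * U b \<le> x" using next_ge(1)[OF dC bhC cb that(1)] by simp
    then show False using that(2) lt by simp
  qed
  ultimately obtain s where s: "C s" "U (b + j) < s" "s \<le> 2 * U b"
    using no_multiple[of "b + j" "U b" "2 * U b"] cb lt by auto
  have "U b < s" using le s(2) by (rule le_less_trans)
  then have "2 * U b \<le> s" by (rule next_ge(1)[OF dC bhC cb s(1)])
  then show C2: "C (2 * U b)" using s(1,3) by (metis antisym)
  obtain i where i: "2 * b = i + 1" "\<And>c. C c \<Longrightarrow> U i < c \<Longrightarrow> U (2 * b) \<le> c" using U_base[OF b2] by blast
  have "i = b + j" using i(1) eq by simp
  then have "U (2 * b) \<le> 2 * U b" using i(2)[OF C2] lt by simp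
  moreover have "b < 2 * b" using sbh_gt1[OF bhB b] unfolding lin by linarith
  then have "U b < U (2 * b)" by (rule U_mono)
  then have "2 * U b \<le> U (2 * b)" by (rule next_ge(1)[OF dC bhC cb c2b])
  ultimately show "U (2 * b) = 2 * U b" by (rule antisym)
qed

text \<open>The element \<open>c\<close> is the one selected at \<open>2 * b\<close>; it can exceed
  \<open>U b\<close> because candidates whose double is in \<open>C\<close> are not admissible
  there. Once \<open>2 * c\<close> is excluded from \<open>C\<close>, clause (3) at
  \<open>3 * b - 1\<close> gives \<open>3 * c\<close>, as in the doubling case.\<close>

lemma U_triple:
  assumes b: "B b" and nb: "\<not> B (2 * b)"
  shows "\<exists>c. C c \<and> \<not> C (2 * c) \<and> C (3 * c) \<and> U b \<le> c \<and> U (2 * b) = 2 * c \<and> U (3 * b) = 3 * c \<and>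
    (\<forall>r<b. U (2 * b + r) = 2 * c + U r) \<and> (\<forall>c'. C c' \<longrightarrow> U b \<le> c' \<longrightarrow> c' < c \<longrightarrow> C (2 * c'))"
proof -
  have B3: "B (3 * b)" "\<And>m. m < 3 \<Longrightarrow> \<not> B m" using regB b nb by (auto simp: reg_def)
  have cb: "C (U b)" using U_base[OF b] by blast
  obtain j where j: "b = j + 1" using U_base[OF b] by blast
  have "j < b" using j by simp
  have "0 < b" using j by (simp add: add_nonneg_pos)
  have base: "b * 2 + b \<le> x" if "B x" "b < x" for x
    using next_ge(2)[OF dB bhB b that nb] unfolding lin by linarith
  have Uj: "U (b + j) = U b + U j" by (rule U_add[OF b \<open>j < b\<close>])
  have eq: "b * 2 + 0 = (b + j) + 1" using j by (simp add: mult_2_right add.assoc)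
  have bs: "x \<le> b" if "B x" "x \<le> b * 2 + 0" for x
  proof (rule ccontr)
    assume "\<not> x \<le> b"
    then have "b * 2 + b \<le> x" using base \<open>B x\<close> by simp
    then have "b * 2 + b \<le> b * 2 + 0" using that(2) by (rule order_trans)
    then show False using \<open>0 < b\<close> by simp
  qed
  obtain c where c: "C c" "U (b + j) < c * 2 + U 0" "lS C (c * 2 + U 0) c"
    "\<And>c'. c' < c \<Longrightarrow> C c' \<Longrightarrow> \<not> (U (b + j) < c' * 2 + U 0 \<and> lS C (c' * 2 + U 0) c')"
    "U (b * 2 + 0) = c * 2 + U 0"
    using U_step[OF b bs _ \<open>0 < b\<close> eq] by blast
  have "0 < c" using sbh_gt1[OF bhC c(1)] by (meson less_le_trans zero_less_numeral)
  have ub: "U b \<le> c"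
  proof (rule ccontr)
    assume "\<not> U b \<le> c"
    then have "\<not> U b \<le> c * 2 + U 0" using c(3) cb unfolding lS_def by blast
    then have "c * 2 + U 0 < U b" by simp
    also have "\<dots> \<le> U (b + j)" unfolding Uj by simp
    finally show False using c(2) by simp
  qed
  \<comment> \<open>A skipped \<open>c'\<close> already exceeds the previous value, so it must have
    failed because \<open>C\<close> has an element in the range up to \<open>2 * c'\<close>. By
    divisibility this is \<open>2 * c'\<close>.\<close>
  have dbl: "C (2 * c')" if c': "C c'" "U b \<le> c'" "c' < c" for c'
  proof -
    have "U (b + j) < U b * 2" using U_mono[OF \<open>j < b\<close>] unfolding Uj by (simp add: mult_2_right)
    also have "\<dots> \<le> c' * 2" using c'(2) by (rule mult_right_mono) simp
    finally have "\<not> lS C (c' * 2) c'" using c(4)[OF c'(3,1)] by simp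
    then obtain s where s: "s \<le> c' * 2" "C s" "c' < s" unfolding lS_def by (auto simp: not_le)
    then have "2 * c' \<le> s" using next_ge(1)[OF dC bhC c'(1)] by blast
    then have "s = 2 * c'" using s(1) by (simp add: mult.commute antisym)
    then show ?thesis using s(2) by simp
  qed
  have nC: "\<not> C (2 * c)"
  proof
    assume "C (2 * c)"
    then have "2 * c \<le> c" using c(3) unfolding lS_def by (simp add: mult.commute)
    then show False using \<open>0 < c\<close> by (simp add: mult_2 not_le[symmetric])
  qed
  have nx: "c * 2 + c \<le> s" if "C s" "c < s" for s
    using next_ge(2)[OF dC bhC c(1) that nC] unfolding lin by linarith
  have U2: "U (b * 2) = c * 2" using c(5) by simp
  have blk: "U (2 * b + r) = 2 * c + U r" if "r < b" for r
    using U_block[OF b _ base c(1) U2 ub nx that] by (simp add: mult.commute)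
  have eq3: "3 * b = (2 * b + j) + 1" using j unfolding zi_eq lin by linarith
  have U3j: "U (2 * b + j) = 2 * c + U j" by (rule blk[OF \<open>j < b\<close>])
  have Ujc: "U j < c" using U_mono[OF \<open>j < b\<close>] ub by (rule less_le_trans)
  have lt: "U (2 * b + j) < 3 * c" using Ujc unfolding U3j lin by linarith
  have "B (2 * b + j + 1)" using B3(1) eq3 by simp
  moreover have "mB \<le> 2 * b + j" by (rule base_pred[OF b eq3]) simp
  moreover have "c \<le> U (2 * b + j)" unfolding U3j lin using zi_nonneg[of c] zi_nonneg[of "U j"] by linarith
  moreover have "x \<le> c" if "C x" "x \<le> U (2 * b + j)" for x
  proof (rule ccontr)
    assume "\<not> x \<le> c"
    then have "c * 2 + c \<le> x" using nx that(1) by simp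
    then show False using that(2) lt unfolding lin by linarith
  qed
  ultimately obtain s where s: "C s" "U (2 * b + j) < s" "s \<le> 3 * c"
    using no_multiple[of "2 * b + j" c "3 * c"] c(1) lt by auto
  have "c < s" using s(2) \<open>c \<le> U (2 * b + j)\<close> by simp
  then have "s = 3 * c" using nx[OF s(1)] s(3) unfolding lin by linarith
  then have C3: "C (3 * c)" using s(1) by simp
  obtain i where i: "3 * b = i + 1" "C (U (3 * b))" "U i < U (3 * b)"
      "\<And>c. C c \<Longrightarrow> U i < c \<Longrightarrow> U (3 * b) \<le> c" using U_base[OF B3(1)] by blast
  have ij: "i = 2 * b + j" using i(1) eq3 by simp
  then have "U (3 * b) \<le> 3 * c" using i(4)[OF C3] lt by simp
  moreover have "c < U (3 * b)" using i(3) \<open>c \<le> U (2 * b + j)\<close> unfolding ij by simp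
  then have "c * 2 + c \<le> U (3 * b)" by (rule nx[OF i(2)])
  ultimately have U3: "U (3 * b) = 3 * c" unfolding lin by linarith
  have "U (2 * b) = 2 * c" using U2 by (simp add: mult.commute)
  with c(1) nC C3 ub U3 blk dbl show ?thesis by blast
qed

lemma U_min: "U mB = mC"
proof -
  have bm: "B mB" and cm: "C mC" using mins by (auto simp: smin_def)
  obtain i where i: "mB = i + 1" "C (U mB)" "\<And>c. C c \<Longrightarrow> U i < c \<Longrightarrow> U mB \<le> c" using U_base[OF bm] by blast
  have "U i = i" using i(1) by (intro U_small) simp
  moreover have "i < mC" using mins(3) i(1) by (simp add: less_iff_add1_le)
  ultimately have "U mB \<le> mC" using i(3)[OF cm] by simp
  moreover have "mC \<le> U mB" using mins(2) i(2) by (auto simp: smin_def)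
  ultimately show ?thesis by (rule antisym)
qed

text \<open>Locate \<open>c\<close> between the values of two successive bases. If the first has
  quotient 2, then \<open>c\<close> is its value. If it has quotient 3, elements of \<open>C\<close>
  from its value up to the selected \<open>d\<close> double, and none lies strictly between
  \<open>d\<close> and \<open>3 * d\<close>.\<close>

lemma C_cases:
  assumes c: "C c"
  shows "C (2 * c) \<or> (\<exists>b. B b \<and> \<not> B (2 * b) \<and> U (2 * b) = 2 * c \<and> C (3 * c))"
proof -
  \<comment> \<open>Because of \<open>n \<le> U n\<close>, the search for the greatest
    \<open>n\<close> with \<open>U n \<le> c\<close> may be bounded by \<open>c\<close>, and up to
    \<open>c\<close> a recursive function represents \<open>U\<close>.\<close>
  obtain u where u: "rec1 u" "\<And>j. j \<le> c \<Longrightarrow> u j = U j" using ex_witness[of c] by blast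
  have mc: "mC \<le> c" using mins(2) c by (auto simp: smin_def)
  have "S1 1 (\<lambda>e. u (e 0) \<le> c)" by (intro D1_S1 rec_intros R_app1[OF u(1)]) auto
  moreover have "u mB \<le> c" "mB \<le> c" using u(2)[of mB] U_min mc mins(3) by auto
  ultimately obtain n where n: "u n \<le> c" "n \<le> c" "\<And>z. u z \<le> c \<Longrightarrow> z \<le> c \<Longrightarrow> z \<le> n"
    using S1_greatest[of "\<lambda>n. u n \<le> c" mB c] by blast
  have nmax: "z \<le> n" if "U z \<le> c" for z
  proof -
    have "z \<le> c" using U_ge[of z] that by (rule order_trans)
    then show ?thesis using n(3)[of z] u(2)[of z] that by simp
  qed
  have "mB \<le> n" using nmax U_min mc by simp
  then obtain b where b: "B b" "b \<le> n" "\<And>x. B x \<Longrightarrow> x \<le> n \<Longrightarrow> x \<le> b" using ex_base by blast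
  have b2: "2 \<le> b" using sbh_gt1[OF bhB b(1)] .
  have cb: "C (U b)" using U_base[OF b(1)] by blast
  have "U n \<le> c" using n(1,2) u(2) by simp
  then have Ubc: "U b \<le> c" using U_mono_le[OF b(2)] by (rule order_trans[rotated])
  have next_gt: "c < U x" if "B x" "b < x" for x
  proof (rule ccontr)
    assume "\<not> c < U x"
    then have "x \<le> b" using nmax b(3)[OF \<open>B x\<close>] by simp
    then show False using that by simp
  qed
  show ?thesis
  proof (cases "B (2 * b)")
    case True
    have "b < 2 * b" using b2 unfolding lin by linarith
    from next_gt[OF True this] have lt: "c < 2 * U b" using U_double(1)[OF b(1) True] by simp
    have "c = U b"
    proof (rule ccontr)
      assume "c \<noteq> U b"
      then have "U b < c" using Ubc by simp
      from next_ge(1)[OF dC bhC cb c this] lt show False by simp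
    qed
    then show ?thesis using U_double(2)[OF b(1) True] by simp
  next
    case False
    obtain d where d: "C d" "\<not> C (2 * d)" "C (3 * d)" "U (2 * b) = 2 * d" "U (3 * b) = 3 * d"
      "\<And>c'. C c' \<Longrightarrow> U b \<le> c' \<Longrightarrow> c' < d \<Longrightarrow> C (2 * c')" using U_triple[OF b(1) False] by blast
    show ?thesis
    proof (cases "c < d")
      case True
      then show ?thesis using d(6)[OF c Ubc] by blast
    next
      case False
      have "b < 3 * b" using b2 unfolding lin by linarith
      moreover have "B (3 * b)" using regB b(1) \<open>\<not> B (2 * b)\<close> by (auto simp: reg_def)
      ultimately have "c < 3 * d" using next_gt[of "3 * b"] d(5) by simp
      then have "\<not> d < c" using next_ge(2)[OF dC bhC d(1) c _ d(2)] by (auto simp: not_le[symmetric])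
      then have "c = d" using False by simp
      then show ?thesis using d b(1) \<open>\<not> B (2 * b)\<close> by blast
    qed
  qed
qed

lemma reg_C: "reg C"
  unfolding reg_def
proof (intro allI impI)
  fix c assume "C c"
  then consider "C (2 * c)" | b where "B b" "\<not> B (2 * b)" "C (3 * c)" using C_cases by blast
  then show "C (2 * c) \<or> C (3 * c) \<and> (\<forall>m. m < 3 \<longrightarrow> \<not> C m)"
  proof cases
    case 2
    then have nB: "\<And>m. m < 3 \<Longrightarrow> \<not> B m" using regB by (auto simp: reg_def)
    then have "3 \<le> mB" using mins(1) by (auto simp: smin_def not_less[symmetric])
    then have "3 \<le> mC" using mins(3) by (rule order_trans)
    then have "\<not> C m" if "m < 3" for m
      using that mins(2) unfolding smin_def by (meson not_le order_trans)
    then show ?thesis using 2(3) by blast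
  qed blast
qed

text \<open>A place \<open>b\<close> with quotient 3 corresponds to the element selected at
  \<open>2 * b\<close>, not to \<open>U b\<close>, which may have quotient 2 in
  \<open>C\<close>.\<close>

lemma tri_C: "C c \<and> \<not> C (2 * c) \<longleftrightarrow> (\<exists>b. B b \<and> \<not> B (2 * b) \<and> U (2 * b) = 2 * c)"
proof
  assume "\<exists>b. B b \<and> \<not> B (2 * b) \<and> U (2 * b) = 2 * c"
  then obtain b where b: "B b" "\<not> B (2 * b)" "U (2 * b) = 2 * c" by blast
  obtain d where d: "C d" "\<not> C (2 * d)" "U (2 * b) = 2 * d" using U_triple[OF b(1,2)] by blast
  then have "c = d" using b(3) unfolding lin by linarith
  then show "C c \<and> \<not> C (2 * c)" using d by simp
qed (use C_cases in blast)

text \<open>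
  If there is no base with quotient \<open>3\<close> between \<open>w\<close> and \<open>N / 2\<close>, then \<open>N\<close> is a sum of bases
  \<open>2\<^sup>i w\<close> and a remainder.
\<close>

lemma U_cut:
  assumes w: "B w" and NT: "\<And>b. B b \<Longrightarrow> w \<le> b \<Longrightarrow> 2 * b \<le> N \<Longrightarrow> B (2 * b)"
    and N: "N = w * q + r" "r < w"
  shows "U N = U w * q + U r"
proof (cases "w \<le> N")
  case False
  have "q = 0"
  proof (rule ccontr)
    assume "q \<noteq> 0"
    then have "w * 1 \<le> w * q" by (intro mult_left_mono pos_imp_ge1) (auto simp: zero_less_iff_neq_zero)
    then have "w \<le> N" unfolding N by (simp add: add_increasing2)
    then show False using False by simp
  qed
  then show ?thesis using N by simp
next
  case True
  have w2: "2 \<le> w" using sbh_gt1[OF bhB w] .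
  \<comment> \<open>The induction also has to carry that bases from \<open>w\<close> on are
    multiples of \<open>w\<close>, so that the leading part of \<open>n\<close> can be divided by
    \<open>w\<close>.\<close>
  let ?P = "\<lambda>u n. (\<forall>q. q \<le> n \<longrightarrow> (\<forall>r. r < w \<longrightarrow> n = w * q + r \<longrightarrow> u n = u w * q + u r)) \<and>
    (B n \<longrightarrow> w \<le> n \<longrightarrow> w dvd n)"
  have "?P U N"
  proof (rule U_induct[of ?P])
    fix u :: "'m \<Rightarrow> 'm" assume u: "rec1 u"
    show "D1 1 (\<lambda>e. ?P u (e 0))" by (intro rec_intros R_app1[OF u] dB) auto
  next
    fix u u' :: "'m \<Rightarrow> 'm" and x
    assume eq: "\<And>j. j \<le> N \<Longrightarrow> u j = u' j" and x: "x \<le> N" and P: "?P u x"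
    have "u r = u' r" if "r < w" for r using eq[of r] that True by (meson less_imp_le order_trans)
    then show "?P u' x" using P eq[OF x] eq[OF True] by auto
  next
    fix n assume n: "n \<le> N" and IH: "\<And>y. y < n \<Longrightarrow> ?P U y"
    have IH1: "U y = U w * q + U r" if "y < n" "y = w * q + r" "r < w" for y q r
    proof -
      have "1 * q \<le> w * q" using w2 by (intro mult_right_mono) (auto intro: order_trans[of 1 2])
      then have "q \<le> y" unfolding that(2) by (simp add: add_increasing2)
      then show ?thesis using IH[OF that(1)] that by blast
    qed
    show "?P U n"
    proof (cases "w \<le> n")
      case False
      have "U n = U w * q + U r" if q: "r < w" "n = w * q + r" for q r
      proof -
        have "q = 0"
        proof (rule ccontr)
          assume "q \<noteq> 0"
          then have "w * 1 \<le> w * q" by (intro mult_left_mono pos_imp_ge1) (auto simp: zero_less_iff_neq_zero)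
          then have "w \<le> n" unfolding q by (simp add: add_increasing2)
          then show False using False by simp
        qed
        then show ?thesis using q by simp
      qed
      then show ?thesis using False by blast
    next
      case True
      have "mB \<le> w" using w mins(1) by (auto simp: smin_def)
      then have "mB \<le> n" using True by (rule order_trans)
      then obtain b where b: "B b" "b \<le> n" "\<And>x. B x \<Longrightarrow> x \<le> n \<Longrightarrow> x \<le> b"
        using ex_base by blast
      have wb: "w \<le> b" using b(3)[OF w True] .
      have b2: "2 \<le> b" using sbh_gt1[OF bhB b(1)] .
      have "n < 2 * b"
      proof (rule ccontr)
        assume "\<not> n < 2 * b"
        then have le: "2 * b \<le> n" by simp
        then have "B (2 * b)" using NT[OF b(1) wb] order_trans[OF le n] by simp
        from b(3)[OF this le] b2 show False unfolding lin by linarith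
      qed
      obtain s where s: "n = b + s" using b(2) unfolding le_iff_add by blast
      have sb: "s < b" using \<open>n < 2 * b\<close> unfolding s by (simp add: mult_2)
      \<comment> \<open>If \<open>n\<close> is itself a base above \<open>w\<close>, the induction
        hypothesis says nothing about \<open>b\<close>. But then \<open>b\<close> is twice the
        preceding base, to which it applies.\<close>
      have "\<exists>z. b = w * z \<and> U b = U w * z"
      proof (cases "b < n")
        case True
        then obtain z where z: "b = w * z" using IH[OF True] b(1) wb by (auto simp: dvd_def)
        then show ?thesis using IH1[OF True, of z 0] w2 by (intro exI[of _ z]) (auto simp: less_le_trans[of 0 2])
      next
        case False
        then have bn: "b = n" using b(2) by simp
        show ?thesis
        proof (cases "b = w")
          case True
          then show ?thesis by (intro exI[of _ 1]) simp
        next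
          case False
          then have "w < b" using wb by simp
          obtain i where i: "b = i + 1" using U_base[OF b(1)] by blast
          then have wi: "w \<le> i" using \<open>w < b\<close> by (simp add: less_add1_iff)
          have "mB \<le> i" using \<open>mB \<le> w\<close> wi by (rule order_trans)
          then obtain b' where b': "B b'" "b' \<le> i" "\<And>x. B x \<Longrightarrow> x \<le> i \<Longrightarrow> x \<le> b'"
            using ex_base by blast
          have wb': "w \<le> b'" using b'(3)[OF w wi] .
          have lt: "b' < b" using b'(2) i by (simp add: less_add1_iff)
          have le: "2 * b' \<le> b" by (rule next_ge(1)[OF dB bhB b'(1) b(1) lt])
          then have B2: "B (2 * b')" using NT[OF b'(1) wb'] n bn by simp
          have "b = 2 * b'"
          proof (rule ccontr)
            assume "b \<noteq> 2 * b'"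
            then have "2 * b' < b" using le by simp
            then have "2 * b' \<le> i" using i by (simp add: less_add1_iff)
            from b'(3)[OF B2 this] sbh_gt1[OF bhB b'(1)] show False unfolding lin by linarith
          qed
          have b'n: "b' < n" using lt bn by simp
          obtain z where z: "b' = w * z" using IH[OF b'n] b'(1) wb' by (auto simp: dvd_def)
          have "U b' = U w * z"
            using IH1[OF b'n, of z 0] z w2 by (auto simp: less_le_trans[of 0 2])
          then have "U b = U w * (2 * z)"
            using U_double(1)[OF b'(1) B2] \<open>b = 2 * b'\<close> by (simp add: ac_simps)
          moreover have "b = w * (2 * z)" using \<open>b = 2 * b'\<close> z by (simp add: ac_simps)
          ultimately show ?thesis by blast
        qed
      qed
      then obtain z where z: "b = w * z" "U b = U w * z" by blast
      have main: "U n = U w * q + U r" if q: "r < w" "n = w * q + r" for q r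
      proof -
        have "0 < w" using w2 by (rule less_le_trans[rotated]) simp
        then obtain q' r' where qr: "s = w * q' + r'" "r' < w" using ex_div by blast
        have "s < n" using s b2 by (simp add: less_le_trans[of 0 2])
        have "w * q + r = w * (z + q') + r'" using q(2) s z(1) qr(1) by (simp add: algebra_simps)
        then have eq: "q = z + q'" "r = r'" using div_unique[OF _ q(1) qr(2)] by auto
        have "U n = U b + U s" unfolding s by (rule U_add[OF b(1) sb])
        also have "\<dots> = U w * z + (U w * q' + U r')"
          using z(2) IH1[OF \<open>s < n\<close> qr] by simp
        finally show ?thesis unfolding eq by (simp add: algebra_simps)
      qed
      moreover have "w dvd n" if "B n" using b(2) b(3)[OF that] z(1) by (metis antisym dvd_triv_left order_refl)
      ultimately show ?thesis by blast
    qed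
  qed
  moreover have "q \<le> N"
  proof -
    have "1 * q \<le> w * q" using w2 by (intro mult_right_mono) (auto intro: order_trans[of 1 2])
    then show ?thesis unfolding N by (simp add: add_increasing2)
  qed
  ultimately show ?thesis using N by blast
qed

end

section \<open>Termination\<close>

context rca
begin

lemma S1_bex_le:
  "R n g \<Longrightarrow> S1 (Suc n) (\<lambda>e. P (e 0) (\<lambda>i. e (Suc i))) \<Longrightarrow> S1 n (\<lambda>e. \<exists>x. x \<le> g e \<and> P x e)"
  using S1_bex[OF R_add[OF _ R_const[of _ 1]], of n g P] by (simp add: less_add1_iff)

lemma D1_ent: "X \<in> range f \<Longrightarrow> R n g \<Longrightarrow> R n h \<Longrightarrow> D1 n (\<lambda>e. ent X (g e) (h e))"
  unfolding ent_def by (intro D1_mem R_pr)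

lemma D1_all_nat:
  assumes "\<And>j. j < k \<Longrightarrow> D1 n (P j)" shows "D1 n (\<lambda>e. \<forall>j<k::nat. P j e)"
  using assms
proof (induction k)
  case (Suc k)
  have "D1 n (\<lambda>e. P k e \<and> (\<forall>j<k. P j e))" using Suc by (intro D1_and) auto
  then show ?case by (simp add: All_less_Suc)
qed (simp add: D1_const)

lemma pr_mono: "x \<le> x' \<Longrightarrow> y \<le> y' \<Longrightarrow> pr x y \<le> pr x' (y' :: 'm)"
  unfolding pr_def by (intro add_mono mult_mono) simp_all

text \<open>The upgrade keeps the quotient by \<open>w\<close> and sends the remainder below
  \<open>w (i + 1)\<close>, so after subtracting 1 the quotient cannot have grown. Where it has
  reached its least value it is constant, and cancelling it leaves the same recurrence for the
  remainders.\<close>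

lemma descent:
  assumes \<rho>: "rec1 \<rho>" and w: "rec1 w" and pos: "\<And>i. i1 \<le> i \<Longrightarrow> 0 < w i"
    and step: "\<And>i. i1 \<le> i \<Longrightarrow> V i (\<rho> i) = \<rho> (i + 1) + 1"
    and cut: "\<And>i. i1 \<le> i \<Longrightarrow> V i (\<rho> i) = w (i + 1) * dv (\<rho> i) (w i) + V i (md (\<rho> i) (w i))"
    and less: "\<And>i. i1 \<le> i \<Longrightarrow> V i (md (\<rho> i) (w i)) < w (i + 1)"
  obtains i2 where "i1 \<le> i2" "\<And>i. i2 \<le> i \<Longrightarrow> V i (md (\<rho> i) (w i)) = md (\<rho> (i + 1)) (w (i + 1)) + 1"
proof -
  define q where "q i = dv (\<rho> i) (w i)" for i
  have Rq: "R n g \<Longrightarrow> R n (\<lambda>e. q (g e))" for n g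
    unfolding q_def by (intro R_app2[OF rec2_dv] R_app1[OF \<rho>] R_app1[OF w])
  have pos': "i1 \<le> i \<Longrightarrow> 0 < w (i + 1)" for i by (rule pos) (simp add: add_increasing2)
  have q_le: "q (i + 1) \<le> q i" if i: "i1 \<le> i" for i
  proof (rule ccontr)
    assume "\<not> q (i + 1) \<le> q i"
    then have "q i + 1 \<le> q (i + 1)" by (simp add: less_iff_add1_le not_le)
    then have "w (i + 1) * (q i + 1) \<le> w (i + 1) * q (i + 1)" by (rule mult_left_mono) simp
    also have "\<dots> \<le> \<rho> (i + 1)"
      using dv_md(1)[OF pos'[OF i], of "\<rho> (i + 1)"] unfolding q_def by (metis le_add_same_cancel1 zero_le)
    also have "\<rho> (i + 1) < V i (\<rho> i)" using step[OF i] by simp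
    also have "\<dots> < w (i + 1) * q i + w (i + 1)" using cut[OF i] less[OF i] by (simp add: q_def)
    finally show False by (simp add: distrib_left)
  qed
  \<comment> \<open>The set of quotients that occur is only \<open>\<Sigma>\<^sub>1\<close>, because
    \<open>i\<close> is unbounded.\<close>
  have "S1 1 (\<lambda>e. \<exists>i. i1 \<le> i \<and> q i = e 0)"
    by (intro S1_ex D1_S1 rec_intros Rq) auto
  from S1_least[of "\<lambda>x. \<exists>i. i1 \<le> i \<and> q i = x", OF this, of "q i1"]
  obtain i2 where i2: "i1 \<le> i2" "\<And>i. i1 \<le> i \<Longrightarrow> \<not> q i < q i2" by blast
  have const: "q (i2 + k) = q i2" for k
  proof (rule D1_induct[of "\<lambda>k. q (i2 + k) = q i2"])
    show "D1 1 (\<lambda>e. q (i2 + e 0) = q i2)" by (intro rec_intros Rq) auto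
    fix k assume IH: "q (i2 + k) = q i2"
    have i: "i1 \<le> i2 + k" using i2(1) by (simp add: add_increasing2)
    have "q (i2 + k + 1) \<le> q i2" using q_le[OF i] IH by simp
    moreover have "\<not> q (i2 + k + 1) < q i2" using i by (intro i2(2)) (simp add: add_increasing2)
    ultimately show "q (i2 + (k + 1)) = q i2" by (simp add: add.assoc)
  qed simp
  have "V i (md (\<rho> i) (w i)) = md (\<rho> (i + 1)) (w (i + 1)) + 1" if ii: "i2 \<le> i" for i
  proof -
    obtain k where k: "i = i2 + k" using ii unfolding le_iff_add by blast
    have i: "i1 \<le> i" using i2(1) ii by (rule order_trans)
    have eq: "q i = q i2" "q (i + 1) = q i2"
      using const[of k] const[of "k + 1"] by (simp_all add: k add.assoc)
    have "w (i + 1) * q i2 + V i (md (\<rho> i) (w i)) = \<rho> (i + 1) + 1"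
      using cut[OF i] step[OF i] eq(1) by (simp add: q_def)
    also have "\<dots> = w (i + 1) * q i2 + (md (\<rho> (i + 1)) (w (i + 1)) + 1)"
      using dv_md(1)[OF pos'[OF i], of "\<rho> (i + 1)"] eq(2) unfolding q_def by (simp add: add.assoc[symmetric])
    finally show ?thesis by simp
  qed
  with i2(1) show ?thesis by (rule that)
qed

end

section \<open>The upgrade and its exceptional places along a dynamical hierarchy\<close>

locale dyn = rca f for f :: "nat \<Rightarrow> 'm::{disc_semidom,countable} set" +
  fixes X :: "'m set"
  assumes X: "X \<in> range f" and dyn: "sdyn X" and reg0: "reg (ent X 0)"
begin

lemma sbh: "sbh (ent X i)" and good: "sgood (ent X i) (ent X (i + 1))"
  using dyn by (auto simp: sdyn_def)

lemma dfn_ent: "dfn (ent X i)"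
  by (intro D1_ent X R_const R_var) simp

text \<open>Regularity of the entry with index \<open>i\<close> is a \<open>\<Pi>\<^sub>1\<close>
  property of \<open>i\<close>, so it can be carried along the sequence by
  \<open>P1_induct\<close>.\<close>

lemma reg: "reg (ent X i)"
proof (rule P1_induct[of "\<lambda>i. reg (ent X i)"])
  have "S1 1 (\<lambda>e. \<exists>b. ent X (e 0) b \<and>
    \<not> (ent X (e 0) (2 * b) \<or> ent X (e 0) (3 * b) \<and> (\<forall>m. m < 3 \<longrightarrow> \<not> ent X (e 0) m)))"
    by (intro S1_ex D1_S1 rec_intros D1_ent X) auto
  then show "P1 1 (\<lambda>e. reg (ent X (e 0)))" unfolding P1_def reg_def by (simp add: not_all)
  show "reg (ent X 0)" by (rule reg0)
  fix i assume "reg (ent X i)"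
  then interpret good_step f "ent X i" "ent X (i + 1)"
    by unfold_locales (rule dfn_ent sbh good | assumption)+
  show "reg (ent X (i + 1))" by (rule reg_C)
qed

sublocale st: good_step f "ent X i" "ent X (i + 1)" for i
  by unfold_locales (rule dfn_ent sbh good reg)+

definition up :: "'m \<Rightarrow> 'm \<Rightarrow> 'm" where
  "up i n = st.U i n"

text \<open>The set that witnesses an upgrade is replaced by a number coding its values up to
  \<open>n\<close>. This gives a \<open>\<Sigma>\<^sub>1\<close> graph uniformly in
  \<open>i\<close>, which the recursion for the Goodstein sequence needs.\<close>

lemma up_graph:
  "y = up i n \<longleftrightarrow> (\<exists>u v w. (\<forall>j. j \<le> n \<longrightarrow> (\<exists>z. z < w \<and> cmem (pr j z) u v w \<and>
     (\<forall>z'. z' < w \<longrightarrow> cmem (pr j z') u v w \<longrightarrow> z' = z) \<and>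
     loc (ent X i) (ent X (i + 1)) (\<lambda>a b. cmem (pr a b) u v w) j z)) \<and> cmem (pr n y) u v w)"
  (is "_ \<longleftrightarrow> (\<exists>u v w. ?G u v w)")
proof
  assume y: "y = up i n"
  obtain h where h: "rec1 h" "\<forall>j\<le>n. h j = st.U i j"
    "\<forall>j\<le>n. loc (ent X i) (ent X (i + 1)) (\<lambda>a b. h a = b) j (h j)"
    using st.ex_witness[of n i] by blast
  \<comment> \<open>By monotonicity the last pair has the greatest code, so \<open>w\<close> bounds
    all pairs.\<close>
  define w where "w = pr n (st.U i n) + 1"
  have "graph h \<in> range f" using h(1) by (simp add: rec1_graph)
  from ex_code[OF this, of w] obtain u v where code: "\<And>z. cmem z u v w \<longleftrightarrow> z < w \<and> z \<in> graph h" by blast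
  have lt: "pr j (h j) < w" if "j \<le> n" for j
  proof -
    have "pr j (h j) \<le> pr n (st.U i n)"
      using h(2) that st.U_mono_le[OF that, of i] by (intro pr_mono) auto
    then show ?thesis unfolding w_def by (simp add: less_add1_iff)
  qed
  have g: "cmem (pr a b) u v w \<longleftrightarrow> h a = b" if "a \<le> n" for a b
    unfolding code using lt[OF that] by auto
  have "?G u v w"
  proof (intro conjI allI impI)
    fix j assume j: "j \<le> n"
    have "h j < w" using le_pr2[of "h j" j] lt[OF j] by (rule le_less_trans)
    moreover have "loc (ent X i) (ent X (i + 1)) (\<lambda>a b. cmem (pr a b) u v w) j (h j)"
      by (rule loc_cong[of _ _ "\<lambda>a b. h a = b"]) (use h(3) j g in \<open>auto dest: less_imp_le intro: order_trans\<close>)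
    ultimately show "\<exists>z. z < w \<and> cmem (pr j z) u v w \<and>
      (\<forall>z'. z' < w \<longrightarrow> cmem (pr j z') u v w \<longrightarrow> z' = z) \<and>
      loc (ent X i) (ent X (i + 1)) (\<lambda>a b. cmem (pr a b) u v w) j z"
      using g[OF j] by (intro exI[of _ "h j"]) auto
  next
    show "cmem (pr n y) u v w" using g[of n y] h(2) y by (simp add: up_def)
  qed
  then show "\<exists>u v w. ?G u v w" by blast
next
  assume "\<exists>u v w. ?G u v w"
  then obtain u v w where G: "?G u v w" by blast
  have lt: "z < w" if "cmem (pr j z) u v w" for j z
    using that le_pr2[of z j] unfolding cmem_def by (blast intro: le_less_trans)
  obtain h where h: "rec1 h" "\<forall>j\<le>n. h j = st.U i j"
    "\<forall>j\<le>n. loc (ent X i) (ent X (i + 1)) (\<lambda>a b. h a = b) j (h j)"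
    using st.ex_witness[of n i] by blast
  have "n \<le> n \<longrightarrow> (\<forall>z. z < w \<longrightarrow> cmem (pr n z) u v w \<longrightarrow> z = h n)"
  proof (rule D1_strong_induct[of "\<lambda>j. j \<le> n \<longrightarrow> (\<forall>z. z < w \<longrightarrow> cmem (pr j z) u v w \<longrightarrow> z = h j)"])
    show "D1 1 (\<lambda>e. e 0 \<le> n \<longrightarrow> (\<forall>z. z < w \<longrightarrow> cmem (pr (e 0) z) u v w \<longrightarrow> z = h (e 0)))"
      by (intro rec_intros' R_app1[OF h(1)]) auto
    fix j assume IH: "\<And>a. a < j \<Longrightarrow> a \<le> n \<longrightarrow> (\<forall>z. z < w \<longrightarrow> cmem (pr a z) u v w \<longrightarrow> z = h a)"
    show "j \<le> n \<longrightarrow> (\<forall>z. z < w \<longrightarrow> cmem (pr j z) u v w \<longrightarrow> z = h j)"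
    proof (intro impI allI)
      fix z assume j: "j \<le> n" and z: "z < w" "cmem (pr j z) u v w"
      then have l: "loc (ent X i) (ent X (i + 1)) (\<lambda>a b. cmem (pr a b) u v w) j z" using G by blast
      show "z = h j"
      proof (rule loc_det[OF l])
        show "loc (ent X i) (ent X (i + 1)) (\<lambda>a b. h a = b) j (h j)" using h(3) j by blast
        fix a p q assume "a < j" "cmem (pr a p) u v w" "h a = q"
        then show "p = q" using IH[of a] lt j by (auto dest: less_imp_le intro: order_trans)
      qed
    qed
  qed
  then show "y = up i n" using G lt h(2) by (auto simp: up_def)
qed

lemma rec2_up: "rec2 up"
  unfolding rec2_def up_graph loc_def lS_def
  by (intro S1_ex S1_and S1_ball_le S1_bex_le S1_bex S1_or)
    (auto intro!: D1_S1 rec_intros' D1_ent X)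

lemma up_mono: "m < n \<Longrightarrow> up i m < up i n"
  unfolding up_def by (rule st.U_mono)

lemma up_0 [simp]: "up i 0 = 0"
  unfolding up_def by (rule st.U_0)

definition step :: "'m \<Rightarrow> 'm \<Rightarrow> 'm" where
  "step j x = (THE y. x = 0 \<and> y = 0 \<or> x \<noteq> 0 \<and> y + 1 = up j x)"

lemma step: "y = step j x \<longleftrightarrow> x = 0 \<and> y = 0 \<or> x \<noteq> 0 \<and> y + 1 = up j x"
proof -
  have "\<exists>!y. x = 0 \<and> y = 0 \<or> x \<noteq> 0 \<and> y + 1 = up j x"
  proof (cases "x = 0")
    case False
    then have "0 < up j x" using up_mono[of 0 x j] by (simp add: zero_less_iff_neq_zero)
    then obtain y where "up j x = y + 1" using zero_or_add1[of "up j x"] by auto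
    then show ?thesis using False by (intro ex1I[of _ y]) auto
  qed auto
  from theI'[OF this] this show ?thesis unfolding step_def[symmetric] by blast
qed

lemma ex_goodstein:
  "\<exists>G. rec1 G \<and> G 0 = n \<and> (\<forall>i. G i \<noteq> 0 \<longrightarrow> up i (G i) = G (i + 1) + 1) \<and> (\<forall>i. sgoodstein X i n (G i))"
proof -
  have "rec2 step" unfolding rec2_def step by (intro D1_S1 rec_intros R_app2[OF rec2_up]) auto
  from primitive_recursion[OF this] obtain G where
    G: "rec1 G" "G 0 = n" "\<And>i. G (i + 1) = step i (G i)" by blast
  have S: "G i = 0 \<and> G (i + 1) = 0 \<or> G i \<noteq> 0 \<and> G (i + 1) + 1 = up i (G i)" for i
    using G(3)[of i] unfolding step .
  have "supg (ent X j) (ent X (j + 1)) (G j) (G (j + 1) + 1)" if "0 < G j" for j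
    using S[of j] that zero_less_iff_neq_zero[of "G j"] by (auto simp: st.supg_iff up_def)
  then have "sgoodstein X i n (G i)" for i
    unfolding sgoodstein_def using G(1,2) S by (intro exI[of _ G]) auto
  moreover have "up i (G i) = G (i + 1) + 1" if "G i \<noteq> 0" for i using S[of i] that by auto
  ultimately show ?thesis using G(1,2) by blast
qed

definition tri :: "'m \<Rightarrow> 'm \<Rightarrow> bool" where
  "tri i b \<longleftrightarrow> ent X i b \<and> \<not> ent X i (2 * b)"

lemma tri_Suc: "tri (i + 1) c \<longleftrightarrow> (\<exists>b. tri i b \<and> up i (2 * b) = 2 * c)"
  unfolding tri_def up_def by (rule st.tri_C[of i c, unfolded conj_assoc[symmetric]]) 

lemma up_tri:
  assumes "tri i b"
  shows "\<exists>c. up i (2 * b) = 2 * c \<and> up i (3 * b) = 3 * c \<and>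
    (\<forall>r<b. up i (2 * b + r) = 2 * c + up i r) \<and> up i b \<le> c"
  using st.U_triple[of i b] assms unfolding tri_def up_def by blast

lemma ent_triple: "tri i b \<Longrightarrow> ent X i (3 * b)"
  using reg[of i] unfolding tri_def reg_def by blast

text \<open>Halving the upgrade of \<open>2 * t\<close> is recursive for any argument. Only
  afterwards does induction show that the division is exact and that the values are places with
  quotient 3.\<close>

lemma ex_tri_seq:
  assumes "tri 0 a"
  shows "\<exists>t. rec1 t \<and> t 0 = a \<and> (\<forall>i. tri i (t i) \<and> up i (2 * t i) = 2 * t (i + 1))"
proof -
  have "rec2 (\<lambda>i x. dv (up i (2 * x)) 2)"
    by (rule rec2I) (intro R_app2[OF rec2_dv] R_app2[OF rec2_up] R_mult R_const R_var; simp)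
  from primitive_recursion[OF this] obtain t where
    t: "rec1 t" "t 0 = a" "\<And>i. t (i + 1) = dv (up i (2 * t i)) 2" by blast
  have up: "up i (2 * t i) = 2 * t (i + 1)" if tr: "tri i (t i)" for i
  proof -
    obtain c where c: "up i (2 * t i) = 2 * c" using up_tri[OF tr] by blast
    then have "t (i + 1) = c" unfolding t(3) by (intro dv_eqI[of _ _ _ 0]) simp_all
    with c show ?thesis by simp
  qed
  have "tri i (t i)" for i
  proof (rule D1_induct[of "\<lambda>i. tri i (t i)"])
    show "D1 1 (\<lambda>e. tri (e 0) (t (e 0)))"
      unfolding tri_def by (intro rec_intros D1_ent X R_app1[OF t(1)]) auto
    fix i assume "tri i (t i)"
    then show "tri (i + 1) (t (i + 1))" unfolding tri_Suc using up by blast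
  qed (simp add: t(2) assms)
  with up t(1,2) show ?thesis by blast
qed

lemma up_cut:
  assumes "ent X i w" "\<And>b. tri i b \<Longrightarrow> w \<le> b \<Longrightarrow> N < 2 * b"
  shows "up i N = up i w * dv N w + up i (md N w)"
proof -
  have "0 < w" using sbh_gt1[OF sbh assms(1)] by (rule less_le_trans[rotated]) simp
  note d = dv_md[OF this, of N]
  show ?thesis unfolding up_def
  proof (rule st.U_cut[OF assms(1) _ d])
    show "ent X i (2 * b)" if "ent X i b" "w \<le> b" "2 * b \<le> N" for b
      using assms(2)[of b] that unfolding tri_def by (meson not_le)
  qed
qed

text \<open>
  The sequence reaches \<open>0\<close>: otherwise divide by the larger and larger multiples \<open>3 t\<close>, \<open>2 t\<close> of
  the bases \<open>t\<close> with quotient \<open>3\<close>, starting with the greatest. Each quotient is eventually constant,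
  and then the remainders form such a sequence again. At last they are smaller than all bases.
\<close>

lemma terminates:
  assumes fin: "finite {b. tri 0 b}" and G: "rec1 G" "\<And>i. G i \<noteq> 0 \<longrightarrow> up i (G i) = G (i + 1) + 1"
  shows "\<exists>i. G i = 0"
proof (rule ccontr)
  assume nz: "\<not> ?thesis"
  \<comment> \<open>The list exists outside the model and its length is a standard number, so the
    induction over its positions below takes place in the metatheory.\<close>
  define ts where "ts = sorted_list_of_set {b. tri 0 b}"
  define k where "k = length ts"
  have ts: "set ts = {b. tri 0 b}" "sorted_wrt (<) ts"
    using fin by (simp_all add: ts_def strict_sorted_iff)
  have "\<exists>t. rec1 t \<and> t 0 = ts ! j \<and> (\<forall>i. tri i (t i) \<and> up i (2 * t i) = 2 * t (i + 1))" if "j < k" for j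
    using that ts(1) nth_mem[of j ts] by (intro ex_tri_seq) (auto simp: k_def)
  then have "\<exists>t. \<forall>j<k. rec1 (t j) \<and> t j 0 = ts ! j \<and> (\<forall>i. tri i (t j i) \<and> up i (2 * t j i) = 2 * t j (i + 1))"
    by metis
  then obtain t where t: "\<And>j. j < k \<Longrightarrow> rec1 (t j)" "\<And>j. j < k \<Longrightarrow> t j 0 = ts ! j"
    "\<And>j i. j < k \<Longrightarrow> tri i (t j i)" "\<And>j i. j < k \<Longrightarrow> up i (2 * t j i) = 2 * t j (i + 1)" by blast
  \<comment> \<open>No new places arise along the sequence. The alternative over
    \<open>j < k\<close> is finite outside the model, so \<open>D1_all_nat\<close> makes the claim
    \<open>\<Pi>\<^sub>1\<close> in \<open>i\<close>.\<close>
  have all: "\<exists>j<k. b = t j i" if "tri i b" for i b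
  proof -
    have "\<forall>b. tri i b \<longrightarrow> (\<exists>j<k. b = t j i)"
    proof (rule P1_induct[of "\<lambda>i. \<forall>b. tri i b \<longrightarrow> (\<exists>j<k. b = t j i)"])
      have "S1 1 (\<lambda>e. \<exists>b. tri (e 0) b \<and> (\<forall>j<k. b \<noteq> t j (e 0)))"
        unfolding tri_def by (intro S1_ex D1_S1 rec_intros D1_ent X D1_all_nat R_app1[OF t(1)]) auto
      then show "P1 1 (\<lambda>e. \<forall>b. tri (e 0) b \<longrightarrow> (\<exists>j<k. b = t j (e 0)))" by (simp add: P1_def not_all not_ex)
      show "\<forall>b. tri 0 b \<longrightarrow> (\<exists>j<k. b = t j 0)"
      proof (intro allI impI)
        fix b assume "tri 0 b"
        then have "b \<in> set ts" using ts(1) by simp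
        then show "\<exists>j<k. b = t j 0" using t(2) by (auto simp: in_set_conv_nth k_def)
      qed
      fix i assume IH: "\<forall>b. tri i b \<longrightarrow> (\<exists>j<k. b = t j i)"
      show "\<forall>b. tri (i + 1) b \<longrightarrow> (\<exists>j<k. b = t j (i + 1))"
      proof (intro allI impI)
        fix c assume "tri (i + 1) c"
        then obtain b where "tri i b" "up i (2 * b) = 2 * c" unfolding tri_Suc by blast
        moreover from this IH obtain j where "j < k" "b = t j i" by blast
        ultimately have "2 * c = 2 * t j (i + 1)" using t(4) by simp
        then have "c = t j (i + 1)" unfolding lin by linarith
        then show "\<exists>j<k. c = t j (i + 1)" using \<open>j < k\<close> by blast
      qed
    qed
    then show ?thesis using that by blast
  qed
  have sorted: "t j i < t j' i" if "j < j'" "j' < k" for j j' i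
  proof (rule D1_induct[of "\<lambda>i. t j i < t j' i"])
    have j: "j < k" using that by simp
    show "D1 1 (\<lambda>e. t j (e 0) < t j' (e 0))"
      by (intro rec_intros R_app1[OF t(1)[OF j]] R_app1[OF t(1)[OF that(2)]]) auto
    show "t j 0 < t j' 0" using that t(2) j ts(2) by (simp add: sorted_wrt_nth_less k_def)
    fix i assume "t j i < t j' i"
    then have "2 * t j i < 2 * t j' i" unfolding lin by linarith
    then have "2 * t j (i + 1) < 2 * t j' (i + 1)" using up_mono t(4) j that(2) by metis
    then have "\<not> t j' (i + 1) \<le> t j (i + 1)" unfolding lin by linarith
    then show "t j (i + 1) < t j' (i + 1)" by simp
  qed
  have pos: "0 < t j i" if "j < k" for j i
    using sbh_gt1[OF sbh, of i "t j i"] t(3)[OF that, of i] unfolding tri_def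
    by (meson less_le_trans zero_less_numeral)
  have up3: "up i (3 * t j i) = 3 * t j (i + 1)" "r < t j i \<Longrightarrow> up i (2 * t j i + r) = 2 * t j (i + 1) + up i r"
    "up i (t j i) \<le> t j (i + 1)" if j: "j < k" for j i r
  proof -
    obtain c where c: "up i (2 * t j i) = 2 * c" "up i (3 * t j i) = 3 * c"
      "\<And>r. r < t j i \<Longrightarrow> up i (2 * t j i + r) = 2 * c + up i r" "up i (t j i) \<le> c"
      using up_tri[OF t(3)[OF j, of i]] by blast
    have "2 * c = 2 * t j (i + 1)" using c(1) t(4)[OF j] by simp
    then have "c = t j (i + 1)" unfolding lin by linarith
    with c show "up i (3 * t j i) = 3 * t j (i + 1)" "r < t j i \<Longrightarrow> up i (2 * t j i + r) = 2 * t j (i + 1) + up i r"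
      "up i (t j i) \<le> t j (i + 1)" by auto
  qed
  have ge_next: "t j i \<le> b"
    if b: "tri i b" "w \<le> b" and w: "\<And>l. l < j \<Longrightarrow> t l i < w" and "j < k" for i b w j
  proof -
    obtain l where l: "l < k" "b = t l i" using all[OF b(1)] by blast
    have "\<not> l < j" using w[of l] b(2) l(2) by (auto simp: not_le[symmetric])
    then show ?thesis using sorted[of j l i] l by (cases "l = j") (auto intro: less_imp_le)
  qed
  have no_tri: False if "tri i b" "w \<le> b" "\<And>l. l < k \<Longrightarrow> t l i < w" for i b w
    using all[OF that(1)] that(2,3) by (meson not_le)
  \<comment> \<open>The induction goes down from \<open>k\<close>, where the sequence is
    \<open>G\<close> itself; once position \<open>j\<close> has been treated, the remainders are
    below twice the place \<open>t j i\<close>.\<close>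
  have main: "\<exists>\<rho> i1. rec1 \<rho> \<and> (\<forall>i. i1 \<le> i \<longrightarrow> up i (\<rho> i) = \<rho> (i + 1) + 1 \<and> (j < k \<longrightarrow> \<rho> i < 2 * t j i))"
    if "j \<le> k" for j
    using that
  proof (induction rule: inc_induct)
    case base
    show ?case using G nz by (intro exI[of _ G] exI[of _ 0]) auto
  next
    case (step j)
    then have j: "j < k" by simp
    from step.IH obtain \<rho> i1 where \<rho>: "rec1 \<rho>" "\<And>i. i1 \<le> i \<Longrightarrow> up i (\<rho> i) = \<rho> (i + 1) + 1"
      "\<And>i. i1 \<le> i \<Longrightarrow> Suc j < k \<Longrightarrow> \<rho> i < 2 * t (Suc j) i" by blast
    \<comment> \<open>The base following \<open>t j i\<close>. Any place from there on is at least
      \<open>t (Suc j) i\<close>, and the remainders are already below twice that number, so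
      \<open>up_cut\<close> applies.\<close>
    define w where "w i = 3 * t j i" for i
    have w: "rec1 w" unfolding w_def by (intro rec1I rec_intros R_app1[OF t(1)[OF j]]) auto
    have upw: "up i (w i) = w (i + 1)" for i unfolding w_def by (rule up3(1)[OF j])
    have wpos: "0 < w i" for i using pos[OF j, of i] unfolding w_def lin by linarith
    have cut: "up i (\<rho> i) = w (i + 1) * dv (\<rho> i) (w i) + up i (md (\<rho> i) (w i))" if i: "i1 \<le> i" for i
      unfolding upw[symmetric]
    proof (rule up_cut)
      show "ent X i (w i)" unfolding w_def by (rule ent_triple[OF t(3)[OF j]])
      fix b assume b: "tri i b" "w i \<le> b"
      have lt: "t l i < w i" if "l < Suc j" for l
      proof -
        have "t l i \<le> t j i" using that sorted[of l j i] j by (cases "l = j") (auto intro: less_imp_le)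
        then show ?thesis using pos[OF j, of i] unfolding w_def lin by linarith
      qed
      have k: "Suc j < k"
      proof (rule ccontr)
        assume "\<not> Suc j < k"
        then have "Suc j = k" using j by simp
        then show False using no_tri[OF b] lt by blast
      qed
      have "t (Suc j) i \<le> b" by (rule ge_next[OF b lt k])
      then show "\<rho> i < 2 * b" using \<rho>(3)[OF i k] unfolding lin by linarith
    qed
    have "up i (md (\<rho> i) (w i)) < w (i + 1)" for i
      unfolding upw[symmetric] by (rule up_mono[OF dv_md(2)[OF wpos]])
    from descent[of \<rho> w i1 up, OF \<rho>(1) w wpos \<rho>(2) cut this] obtain i2 where
      i2: "i1 \<le> i2" "\<And>i. i2 \<le> i \<Longrightarrow> up i (md (\<rho> i) (w i)) = md (\<rho> (i + 1)) (w (i + 1)) + 1" by blast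
    define \<sigma> where "\<sigma> i = md (\<rho> i) (w i)" for i
    have \<sigma>: "rec1 \<sigma>" unfolding \<sigma>_def by (intro rec1I R_app2[OF rec2_md] R_app1[OF \<rho>(1)] R_app1[OF w] R_var) simp_all
    have \<sigma>up: "\<And>i. i2 \<le> i \<Longrightarrow> up i (\<sigma> i) = \<sigma> (i + 1) + 1" unfolding \<sigma>_def by (rule i2(2))
    have \<sigma>lt: "\<sigma> i < 3 * t j i" for i unfolding \<sigma>_def using dv_md(2)[OF wpos] by (simp add: w_def)
    \<comment> \<open>Below \<open>3 * t j i\<close> linearity may fail at \<open>t j i\<close>,
      whose upgrade can be smaller than \<open>t j (i + 1)\<close>. The split at
      \<open>2 * t j i\<close>, which is not a base, has quotient 0 or 1 and rests on
      \<open>up3\<close> instead of \<open>up_cut\<close>.\<close>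
    define v where "v i = 2 * t j i" for i
    have v: "rec1 v" unfolding v_def by (intro rec1I rec_intros R_app1[OF t(1)[OF j]]) auto
    have upv: "up i (v i) = v (i + 1)" for i unfolding v_def by (rule t(4)[OF j])
    have vpos: "0 < v i" for i using pos[OF j, of i] unfolding v_def lin by linarith
    have cut': "up i (\<sigma> i) = v (i + 1) * dv (\<sigma> i) (v i) + up i (md (\<sigma> i) (v i))" for i
    proof (cases "\<sigma> i < v i")
      case True
      then have "dv (\<sigma> i) (v i) = 0" by (intro dv_eqI[of _ _ _ "\<sigma> i"]) simp_all
      moreover from this have "md (\<sigma> i) (v i) = \<sigma> i" using dv_md(1)[OF vpos, of "\<sigma> i" i] by simp
      ultimately show ?thesis by simp
    next
      case False
      then obtain r where r: "\<sigma> i = v i + r" by (auto simp: not_less le_iff_add)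
      have rt: "r < t j i" using \<sigma>lt[of i] unfolding r v_def lin by linarith
      have "r < v i" using rt pos[OF j, of i] unfolding v_def lin by linarith
      then have "dv (\<sigma> i) (v i) = 1" using r by (intro dv_eqI[of _ _ _ r]) simp_all
      moreover from this have "md (\<sigma> i) (v i) = r" using dv_md(1)[OF vpos, of "\<sigma> i" i] r by simp
      ultimately show ?thesis using up3(2)[OF j rt] r by (simp add: v_def)
    qed
    have "up i (md (\<sigma> i) (v i)) < v (i + 1)" for i
      unfolding upv[symmetric] by (rule up_mono[OF dv_md(2)[OF vpos]])
    from descent[of \<sigma> v i2 up, OF \<sigma> v vpos \<sigma>up cut' this] obtain i3 where
      i3: "\<And>i. i3 \<le> i \<Longrightarrow> up i (md (\<sigma> i) (v i)) = md (\<sigma> (i + 1)) (v (i + 1)) + 1" by blast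
    have "rec1 (\<lambda>i. md (\<sigma> i) (v i))"
      by (intro rec1I R_app2[OF rec2_md] R_app1[OF \<sigma>] R_app1[OF v] R_var) simp_all
    moreover have "md (\<sigma> i) (v i) < 2 * t j i" for i using dv_md(2)[OF vpos, of "\<sigma> i" i] by (simp add: v_def)
    ultimately show ?case using i3 by (intro exI[of _ "\<lambda>i. md (\<sigma> i) (v i)"] exI[of _ i3]) auto
  qed
  from main[of 0] obtain \<rho> i1 where \<rho>: "rec1 \<rho>" "\<And>i. i1 \<le> i \<Longrightarrow> up i (\<rho> i) = \<rho> (i + 1) + 1"
    "\<And>i. i1 \<le> i \<Longrightarrow> 0 < k \<Longrightarrow> \<rho> i < 2 * t 0 i" by auto
  define w where "w i = st.mB i" for i
  have wmin: "smin (ent X i) (w i)" for i unfolding w_def by (rule st.mins(1))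
  have w: "rec1 w"
  proof -
    have "y = w i \<longleftrightarrow> ent X i y \<and> (\<forall>x. x < y \<longrightarrow> \<not> ent X i x)" for y i
      using wmin[of i] unfolding smin_def by (meson antisym not_le)
    then show ?thesis unfolding rec1_def by (simp only:) (intro D1_S1 rec_intros D1_ent X; simp)
  qed
  \<comment> \<open>The minimum \<open>mC\<close> of one step and the minimum \<open>mB\<close> of
    the next are the same description, whence unfolding suffices.\<close>
  have upw: "up i (w i) = w (i + 1)" for i
    unfolding up_def w_def st.U_min by (simp only: st.mC_def st.mB_def)
  have went: "ent X i (w i)" for i using wmin[of i] by (simp add: smin_def)
  have wpos: "0 < w i" for i using sbh_gt1[OF sbh went[of i]] by (rule less_le_trans[rotated]) simp
  have cut: "up i (\<rho> i) = w (i + 1) * dv (\<rho> i) (w i) + up i (md (\<rho> i) (w i))" if i: "i1 \<le> i" for i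
    unfolding upw[symmetric]
  proof (rule up_cut[OF went])
    fix b assume b: "tri i b" "w i \<le> b"
    then obtain l where "l < k" using all by blast
    then have k: "0 < k" by simp
    have "t 0 i \<le> b" by (rule ge_next[OF b _ k]) simp
    then show "\<rho> i < 2 * b" using \<rho>(3)[OF i k] unfolding lin by linarith
  qed
  have "up i (md (\<rho> i) (w i)) < w (i + 1)" for i
    unfolding upw[symmetric] by (rule up_mono[OF dv_md(2)[OF wpos]])
  from descent[of \<rho> w i1 up, OF \<rho>(1) w wpos \<rho>(2) cut this] obtain i2 where
    i2: "\<And>i. i2 \<le> i \<Longrightarrow> up i (md (\<rho> i) (w i)) = md (\<rho> (i + 1)) (w (i + 1)) + 1" by blast
  define \<sigma> where "\<sigma> i = md (\<rho> i) (w i)" for i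
  have \<sigma>: "rec1 \<sigma>" unfolding \<sigma>_def by (intro rec1I R_app2[OF rec2_md] R_app1[OF \<rho>(1)] R_app1[OF w] R_var) simp_all
  \<comment> \<open>Below all bases the upgrade is the identity, so from \<open>i2\<close> on the
    sequence drops by 1 at every step and has no least value.\<close>
  have dec: "\<sigma> i = \<sigma> (i + 1) + 1" if "i2 \<le> i" for i
  proof -
    have "\<sigma> i < st.mB i" unfolding \<sigma>_def using dv_md(2)[OF wpos] by (simp add: w_def)
    then have "up i (\<sigma> i) = \<sigma> i" unfolding up_def by (rule st.U_small)
    then show ?thesis using i2[OF that] by (simp add: \<sigma>_def)
  qed
  have "S1 1 (\<lambda>e. \<exists>i. i2 \<le> i \<and> \<sigma> i = e 0)"
    by (intro S1_ex D1_S1 rec_intros R_app1[OF \<sigma>]) auto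
  from S1_least[of "\<lambda>x. \<exists>i. i2 \<le> i \<and> \<sigma> i = x", OF this, of "\<sigma> i2"]
  obtain i where i: "i2 \<le> i" "\<And>i'. i2 \<le> i' \<Longrightarrow> \<not> \<sigma> i' < \<sigma> i" by blast
  have "i2 \<le> i + 1" using i(1) by (simp add: add_increasing2)
  then have "\<not> \<sigma> (i + 1) < \<sigma> i" by (rule i(2))
  then show False using dec[OF i(1)] by simp
qed

end

lemma (in rca_eval) goal_holds: "sat e0 f (goal k)"
  unfolding sat_goal
proof (intro ballI impI allI, elim conjE)
  fix A n
  assume A: "A \<in> range f" "sdyn A"
    and S: "\<forall>b. ent A 0 b \<longrightarrow> (\<exists>m s. smin (ent A 0) m \<and> snext (ent A 0) b s \<and>
       s \<le> (1 + 1 + 1) * b \<and> s \<le> b * m)"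
    and ex: "sexact k (\<lambda>b. ent A 0 b \<and> snext (ent A 0) b ((1 + 1 + 1) * b))"
  have three: "1 + 1 + 1 = (3 :: 'm)" by simp
  have bh: "sbh (ent A 0)" using A(2) by (simp add: sdyn_def)
  have dfn: "dfn (ent A 0)" by (intro D1_ent A(1) R_const R_var) simp
  have nx: "ent A 0 (2 * b) \<or> snext (ent A 0) b (3 * b) \<and> (\<forall>m. m < 3 \<longrightarrow> \<not> ent A 0 m)"
    if b: "ent A 0 b" for b
  proof -
    obtain m s where ms: "smin (ent A 0) m" "snext (ent A 0) b s" "s \<le> 3 * b" "s \<le> b * m"
      using S b unfolding three by blast
    have s: "ent A 0 s" "b < s" using ms(2) by (auto simp: snext_def)
    show ?thesis
    proof (cases "ent A 0 (2 * b)")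
      case False
      have s3: "s = 3 * b" using next_ge(2)[OF dfn bh b s False] ms(3) by simp
      \<comment> \<open>This is where the bound \<open>s \<le> b * m\<close> enters:
        \<open>s = 3 * b\<close> rules out \<open>m \<le> 2\<close>.\<close>
      have "3 \<le> m"
      proof (rule ccontr)
        assume "\<not> 3 \<le> m"
        then have "m + 1 \<le> 3" by (simp add: less_iff_add1_le[symmetric])
        then have "m \<le> 2" unfolding lin by linarith
        then have "b * m \<le> b * 2" by (rule mult_left_mono) simp
        then show False using ms(4) s3 sbh_gt1[OF bh b] unfolding lin by linarith
      qed
      then have "\<not> ent A 0 x" if "x < 3" for x
        using ms(1) that unfolding smin_def by (meson not_le order_trans)
      then show ?thesis using ms(2) s3 by blast
    qed blast
  qed
  have "reg (ent A 0)" unfolding reg_def using nx by (auto simp: snext_def)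
  then interpret d: dyn f A using A by unfold_locales
  have tri: "d.tri 0 b \<longleftrightarrow> ent A 0 b \<and> snext (ent A 0) b ((1 + 1 + 1) * b)" for b
  proof
    assume "d.tri 0 b" then show "ent A 0 b \<and> snext (ent A 0) b ((1 + 1 + 1) * b)"
      using nx[of b] unfolding d.tri_def three by blast
  next
    assume a: "ent A 0 b \<and> snext (ent A 0) b ((1 + 1 + 1) * b)"
    have "\<not> ent A 0 (2 * b)"
    proof
      assume "ent A 0 (2 * b)"
      moreover have "b < 2 * b" using sbh_gt1[OF bh, of b] a unfolding lin by linarith
      ultimately have "3 * b \<le> 2 * b" using a unfolding snext_def three by blast
      moreover have "2 \<le> b" using sbh_gt1[OF bh] a by blast
      ultimately show False unfolding lin by linarith
    qed
    then show "d.tri 0 b" using a by (simp add: d.tri_def)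
  qed
  obtain F where "finite F" "\<forall>x. (ent A 0 x \<and> snext (ent A 0) x ((1 + 1 + 1) * x)) \<longleftrightarrow> x \<in> F"
    using sexact_finite[OF ex] by blast
  then have fin: "finite {b. d.tri 0 b}" unfolding tri by simp
  obtain G where G: "rec1 G" "\<And>i. G i \<noteq> 0 \<longrightarrow> d.up i (G i) = G (i + 1) + 1"
    "\<And>i. sgoodstein A i n (G i)" using d.ex_goodstein[of n] by blast
  then obtain i where "G i = 0" using d.terminates[OF fin G(1,2)] by blast
  then show "\<exists>i. sgoodstein A i n 0" using G(3)[of i] by metis
qed

theorem theorem8p3:
  fixes k :: nat
  shows "RCA0 \<turnstile> sentence
    (\<^bold>\<forall>\<^sub>S \<B>.
       dynamical_hierarchy \<B> \<^bold>\<and>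
       (\<^bold>\<forall>b. entry \<B> \<^bold>0 b \<^bold>\<longrightarrow>
          (\<^bold>\<exists>m. \<^bold>\<exists>s. is_min (entry \<B> \<^bold>0) m \<^bold>\<and> is_S (entry \<B> \<^bold>0) b s \<^bold>\<and>
             s \<^bold>\<le> \<^bold>3 \<^bold>* b \<^bold>\<and> s \<^bold>\<le> b \<^bold>* m)) \<^bold>\<and>
       exactly k (\<lambda>b. entry \<B> \<^bold>0 b \<^bold>\<and> is_S (entry \<B> \<^bold>0) b (\<^bold>3 \<^bold>* b)) \<^bold>\<longrightarrow>
       (\<^bold>\<forall>n. \<^bold>\<exists>i. is_goodstein \<B> i n \<^bold>0))"
proof -
  have "RCA0 \<turnstile> goal k"
  proof (rule ccontr)
    assume "\<not> RCA0 \<turnstile> goal k"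
    \<comment> \<open>The structure refutes \<open>goal k\<close> for some \<open>k\<close> that
      need not be the given one. This is harmless as \<open>goal_holds\<close> covers every
      \<open>k\<close>.\<close>
    then obtain k e where m: "rca_struct (0 :: hm) 1 (+) (*) (<) hm_sets"
      "\<not> struct.sat (0 :: hm) 1 (+) (*) (<) (range hm_sets) e hm_sets (goal k)"
      using countermodel_hm unfolding countermodel_def by blast
    interpret rca_eval hm_sets e
      using m(1) by (simp add: rca_eval_def rca_def)
    show False using goal_holds m(2) by blast
  qed
  then show ?thesis unfolding goal_def .
qed

end
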